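(* Let $G$ be an $n$-dimensional torus, let $\Gamma$ be a finite $d$-valent graph with vertex set $V$ equipped with a GKM action of $G$, let $T\subset G$ be a circle subgroup not contained in any $G_e$, with infinitesimal generator $\xi$, and let $f\in K_G(\Gamma)$, $f_p=e^{2\pi i\alpha_p}$, be symplectic. Let $\phi:V\to\mathbb R$ be the $T$-moment map $\phi(p)=\alpha_p(\xi)$ and assume that zero is a regular value of $\phi$, i.e. $\alpha_p(\xi)\neq0$ for all $p\in V$. Let $Q(\Gamma)$ be the virtual representation of $G$ with character $\chi(f)$, and let $Q(\Gamma_{red})$ be the virtual representation of $G/T$ with character $\chi_{red}(f)=\chi_0(f)$. Then, as virtual representations of $G/T$, $$Q(\Gamma_{red})=Q(\Gamma)^T,$$ where $Q(\Gamma)^T$ is the $T$-invariant part of $Q(\Gamma)$.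
   Context: Torus notation. $\mathfrak g$ is the Lie algebra of $G$, $\mathbb Z_G=\ker(\exp:\mathfrak g\to G)$, and $\mathbb Z_G^*=\{\alpha\in\mathfrak g^*:\alpha(v)\in\mathbb Z\text{ for all }v\in\mathbb Z_G\}$ is the weight lattice. For $\alpha\in\mathbb Z_G^*$, $e^{2\pi i\alpha}:G\to S^1$ is the character $\exp(x)\mapsto e^{2\pi i\alpha(x)}$. For a compact commutative Lie group $H$, $R(H)$ is the representation ring, identified with the character ring: all finite sums $\sum m_k\chi_k$ with $m_k\in\mathbb Z$ and $\chi_k:H\to S^1$ characters. Graph and action. $E$ is the set of oriented edges of $\Gamma$ (each unoriented edge gives two oriented edges). For $e\in E$, $i(e)$ and $t(e)$ are its initial and terminal vertices and $\bar e$ is $e$ with reversed orientation. $d$-valent means each vertex $p$ has exactly $d$ oriented edges $e$ with $i(e)=p$. An action of $G$ on $\Gamma$ assigns to each $e\in E$ a one-dimensional representation $\varrho_e$ with character $\chi_e=e^{2\pi i\alpha_e}$, $\alpha_e\in\mathbb Z_G^*$, and to each $p\in V$ a $d$-dimensional representation $\tau_p$, such that, with $G_e=\ker\chi_e$: $\tau_p\simeq\bigoplus_{i(e)=p}\varrho_e$ for all $p$; $\varrho_{\bar e}\simeq\varrho_e^*$ (so $\alpha_{\bar e}=-\alpha_e$); and $\tau_{i(e)}|_{G_e}\simeq\tau_{t(e)}|_{G_e}$ for all $e$. The action is GKM if for any two distinct oriented edges $e_1\ne e_2$ with $i(e_1)=i(e_2)$ the weights $\alpha_{e_1},\alpha_{e_2}$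 are linearly independent. $K_G(\Gamma)$ is the set of functions $f:V\to R(G)$, $p\mapsto f_p$, with $r_e f_{i(e)}=r_e f_{t(e)}$ for every edge $e$, where $r_e:R(G)\to R(G_e)$ is restriction. Symplectic. Suppose $f\in K_G(\Gamma)$ has the form $f_p=e^{2\pi i\alpha_p}$ with $\alpha_p\in\mathbb Z_G^*$. Then for every oriented edge $e$ from $p$ to $q$ one has $\alpha_q-\alpha_p=m_e\alpha_e$ for some integer $m_e$; $f$ is symplectic if $m_e>0$ for all $e$. Circle and moment map. The infinitesimal generator $\xi$ is a basis vector of the group lattice $\mathbb Z_T=\ker(\exp:\mathfrak t\to T)$ of $T$; since $T\not\subset G_e$, $\alpha_e(\xi)\ne0$ for all $e$. A $T$-moment map is a function $\phi:V\to\mathbb R$ with $\frac{\phi(t(e))-\phi(i(e))}{\alpha_e(\xi)}>0$ for all $e\in E$. A regular value $c$ is a real number not of the form $\phi(p)$. $V_c$ is the set of oriented edges $e$ with $\phi(t(e))>c>\phi(i(e))$. Characters. $\chi(f)=\sum_{p\in V}f_p\prod_{i(e)=p}(1-e^{2\pi i\alpha_e})^{-1}$, known to lie in $R(G)$. For $e\in V_c$ let $p=i(e)$ and $\hat f_e=f_p\prod_{e'}(1-e^{2\pi i\alpha_{e'}})^{-1}$, the product over all $e'\ne e$ with $i(e')=p$. Let $\pi_e:G_e\to G/T$ be the composition of the inclusion $G_e\to G$ with the projection $G\to G/T$; it is surjective with finite kernel $W_e=G_e\cap T$. The push-forward is $((\pi_e)_*h)(\bar g)=\frac1{|W_e|}\sum_{w\in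 W_e}h(gw)$ for any $g\in G_e$ with $\pi_e(g)=\bar g$; on $R(G_e)$ it sends a representation to its $W_e$-invariant part viewed as a representation of $G/T$, and by the same formula it is extended to quotients such as $r_e\hat f_e$ (the restriction of $\hat f_e$ to $G_e$), giving functions defined generically on $G/T$. Put $f_c^{\#}(e)=(\pi_e)_*r_e\hat f_e$ and $\chi_c(f)=\sum_{e\in V_c}f_c^{\#}(e)$, known to lie in $R(G/T)$; $\chi_{red}(f)=\chi_0(f)$ is the case $c=0$. For a virtual representation of $G$ with character $\sum m_k e^{2\pi i\alpha_k}$, its $T$-invariant part has character $\sum_{\alpha_k(\xi)=0}m_ke^{2\pi i\alpha_k}$, viewed as a character of $G/T$. *)

theory Defs
  imports
    "HOL-Analysis.Analysis"
    "HOL-Algebra.Coset"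
    "Jordan_Normal_Form.Matrix"
    "Graph_Theory.Bidirected_Digraph"
begin

definition circle_group :: "complex monoid" where
  "circle_group = \<lparr>carrier = sphere 0 1, monoid.mult = (*), one = 1\<rparr>"

text \<open>The \<open>n\<close>-dimensional torus is \<open>(S\<^sup>1)\<^sup>n\<close> with \<open>n = CARD('n)\<close>; its Lie algebra is
  \<^typ>\<open>real ^ 'n\<close> and the dual of the Lie algebra is \<^typ>\<open>(real ^ 'n) \<Rightarrow>\<^sub>L real\<close>.\<close>

definition torus :: "(complex ^ 'n) monoid" where
  "torus = \<lparr>carrier = {z. \<forall>i. vec_nth z i \<in> carrier circle_group},
            monoid.mult = (\<lambda>z w. vec_lambda (\<lambda>i. vec_nth z i * vec_nth w i)),
            one = vec_lambda (\<lambda>i. 1)\<rparr>"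

definition torus_exp :: "real ^ 'n \<Rightarrow> complex ^ 'n" where
  "torus_exp x = vec_lambda (\<lambda>i. cis (2 * pi * vec_nth x i))"

definition group_lattice :: "(real ^ 'n) set" where
  "group_lattice = {v. torus_exp v = \<one>\<^bsub>torus\<^esub>}"

definition weight_lattice :: "((real ^ 'n) \<Rightarrow>\<^sub>L real) set" where
  "weight_lattice = {\<alpha>. \<forall>v\<in>group_lattice. blinfun_apply \<alpha> v \<in> \<int>}"

text \<open>The character \<open>exp x \<mapsto> e\<^sup>2\<^sup>\<pi>\<^sup>i\<^sup>\<alpha>\<^sup>(\<^sup>x\<^sup>)\<close>; for \<open>\<alpha>\<close> in the weight lattice the value does not depend
  on the chosen logarithm \<open>x\<close>.\<close>

definition weight_char :: "((real ^ 'n) \<Rightarrow>\<^sub>L real) \<Rightarrow> complex ^ 'n \<Rightarrow> complex" where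
  "weight_char \<alpha> =
     (\<lambda>g\<in>carrier torus. cis (2 * pi * blinfun_apply \<alpha> (SOME x. torus_exp x = g)))"

definition weight_kernel :: "((real ^ 'n) \<Rightarrow>\<^sub>L real) \<Rightarrow> (complex ^ 'n) set" where
  "weight_kernel \<alpha> = kernel torus circle_group (weight_char \<alpha>)"

definition circle_subgroup :: "(complex ^ 'n) set \<Rightarrow> bool" where
  "circle_subgroup T \<longleftrightarrow> subgroup T torus \<and>
     (\<exists>h. h \<in> iso circle_group (torus\<lparr>carrier := T\<rparr>) \<and> continuous_on (carrier circle_group) h)"

definition lie_algebra :: "(complex ^ 'n) set \<Rightarrow> (real ^ 'n) set" where
  "lie_algebra T = {x. \<forall>s. torus_exp (s *\<^sub>R x) \<in> T}"

text \<open>\<open>\<xi>\<close> is a basis of the group lattice of the circle subgroup \<open>T\<close>.\<close>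

definition infinitesimal_generator :: "(complex ^ 'n) set \<Rightarrow> real ^ 'n \<Rightarrow> bool" where
  "infinitesimal_generator T \<xi> \<longleftrightarrow> \<xi> \<noteq> 0 \<and>
     {x \<in> lie_algebra T. torus_exp x = \<one>\<^bsub>torus\<^esub>} = range (\<lambda>k::int. of_int k *\<^sub>R \<xi>)"

text \<open>A topological group is given by a group \<open>H\<close> and a topology \<open>X\<close> with \<open>topspace X = carrier H\<close>.
  The representation ring is identified with the ring of virtual characters. Characters and
  virtual characters are extensional, so that they are equal iff they agree on the group.\<close>

definition characters :: "'g monoid \<Rightarrow> 'g topology \<Rightarrow> ('g \<Rightarrow> complex) set" where
  "characters H X = {\<psi> \<in> hom H circle_group \<inter> extensional (carrier H).
                        continuous_map X euclidean \<psi>}"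

definition rep_ring :: "'g monoid \<Rightarrow> 'g topology \<Rightarrow> ('g \<Rightarrow> complex) set" where
  "rep_ring H X = {f. \<exists>S. \<exists>m :: ('g \<Rightarrow> complex) \<Rightarrow> int. finite S \<and> S \<subseteq> characters H X \<and>
                         f = (\<lambda>h\<in>carrier H. \<Sum>\<psi>\<in>S. of_int (m \<psi>) * \<psi> h)}"

abbreviation torus_topology :: "(complex ^ 'n) topology" where
  "torus_topology \<equiv> top_of_set (carrier torus)"

definition quotient_topology :: "(complex ^ 'n) set \<Rightarrow> (complex ^ 'n) set topology" where
  "quotient_topology T = topology (\<lambda>U. U \<subseteq> carrier (torus Mod T) \<and>
     openin torus_topology {g \<in> carrier torus. T #>\<^bsub>torus\<^esub> g \<in> U})"

definition representation ::
  "'g monoid \<Rightarrow> 'g topology \<Rightarrow> nat \<Rightarrow> ('g \<Rightarrow> complex mat) \<Rightarrow> bool" where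
  "representation H X k \<rho> \<longleftrightarrow>
     (\<forall>g\<in>carrier H. \<rho> g \<in> carrier_mat k k) \<and>
     \<rho> \<one>\<^bsub>H\<^esub> = 1\<^sub>m k \<and>
     (\<forall>g\<in>carrier H. \<forall>h\<in>carrier H. \<rho> (g \<otimes>\<^bsub>H\<^esub> h) = \<rho> g * \<rho> h) \<and>
     (\<forall>i<k. \<forall>j<k. continuous_map X euclidean (\<lambda>g. \<rho> g $$ (i, j)))"

text \<open>Isomorphism of the restrictions of two \<open>k\<close>-dimensional representations to the set \<open>H\<close>.\<close>

definition rep_iso_on ::
  "'g set \<Rightarrow> nat \<Rightarrow> ('g \<Rightarrow> complex mat) \<Rightarrow> ('g \<Rightarrow> complex mat) \<Rightarrow> bool" where
  "rep_iso_on H k \<rho> \<sigma> \<longleftrightarrow>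
     (\<exists>P \<in> carrier_mat k k. invertible_mat P \<and> (\<forall>g\<in>H. P * \<rho> g = \<sigma> g * P))"

definition rep_character :: "'g monoid \<Rightarrow> nat \<Rightarrow> ('g \<Rightarrow> complex mat) \<Rightarrow> 'g \<Rightarrow> complex" where
  "rep_character H k \<rho> = (\<lambda>g\<in>carrier H. \<Sum>i<k. \<rho> g $$ (i, i))"

definition dual_rep :: "'g monoid \<Rightarrow> ('g \<Rightarrow> complex mat) \<Rightarrow> 'g \<Rightarrow> complex mat" where
  "dual_rep H \<rho> g = transpose_mat (\<rho> (inv\<^bsub>H\<^esub> g))"

definition direct_sum_rep :: "('g \<Rightarrow> complex mat) list \<Rightarrow> 'g \<Rightarrow> complex mat" where
  "direct_sum_rep \<rho>s g = diag_block_mat (map (\<lambda>\<rho>. \<rho> g) \<rho>s)"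

text \<open>A finite graph is given by its oriented edges: a finite bidirected digraph, in which
  \<open>tail\<close> and \<open>head\<close> are the initial and terminal vertex and \<open>rv\<close> reverses the orientation.\<close>

definition valent_graph :: "('v, 'e) pre_digraph \<Rightarrow> ('e \<Rightarrow> 'e) \<Rightarrow> nat \<Rightarrow> bool" where
  "valent_graph \<Gamma> rv d \<longleftrightarrow> fin_digraph \<Gamma> \<and> bidirected_digraph \<Gamma> rv \<and>
     (\<forall>p\<in>verts \<Gamma>. out_degree \<Gamma> p = d)"

text \<open>The order in which the edges \<open>es\<close> at a vertex are listed is irrelevant, since it changes
  the direct sum only up to isomorphism.\<close>

definition graph_action ::
  "('v, 'e) pre_digraph \<Rightarrow> ('e \<Rightarrow> 'e) \<Rightarrow> nat \<Rightarrow> ('e \<Rightarrow> complex ^ 'n \<Rightarrow> complex mat) \<Rightarrow>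
   ('e \<Rightarrow> (real ^ 'n) \<Rightarrow>\<^sub>L real) \<Rightarrow> ('v \<Rightarrow> complex ^ 'n \<Rightarrow> complex mat) \<Rightarrow> bool" where
  "graph_action \<Gamma> rv d \<rho> \<alpha> \<tau> \<longleftrightarrow>
     (\<forall>e\<in>arcs \<Gamma>. representation torus torus_topology 1 (\<rho> e) \<and> \<alpha> e \<in> weight_lattice \<and>
        rep_character torus 1 (\<rho> e) = weight_char (\<alpha> e)) \<and>
     (\<forall>p\<in>verts \<Gamma>. representation torus torus_topology d (\<tau> p)) \<and>
     (\<forall>p\<in>verts \<Gamma>. \<exists>es. distinct es \<and> set es = out_arcs \<Gamma> p \<and>
        rep_iso_on (carrier torus) d (\<tau> p) (direct_sum_rep (map \<rho> es))) \<and>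
     (\<forall>e\<in>arcs \<Gamma>. rep_iso_on (carrier torus) 1 (\<rho> (rv e)) (dual_rep torus (\<rho> e))) \<and>
     (\<forall>e\<in>arcs \<Gamma>. rep_iso_on (weight_kernel (\<alpha> e)) d (\<tau> (tail \<Gamma> e)) (\<tau> (head \<Gamma> e)))"

definition gkm_action ::
  "('v, 'e) pre_digraph \<Rightarrow> ('e \<Rightarrow> 'e) \<Rightarrow> nat \<Rightarrow> ('e \<Rightarrow> complex ^ 'n \<Rightarrow> complex mat) \<Rightarrow>
   ('e \<Rightarrow> (real ^ 'n) \<Rightarrow>\<^sub>L real) \<Rightarrow> ('v \<Rightarrow> complex ^ 'n \<Rightarrow> complex mat) \<Rightarrow> bool" where
  "gkm_action \<Gamma> rv d \<rho> \<alpha> \<tau> \<longleftrightarrow> graph_action \<Gamma> rv d \<rho> \<alpha> \<tau> \<and>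
     (\<forall>e\<^sub>1\<in>arcs \<Gamma>. \<forall>e\<^sub>2\<in>arcs \<Gamma>. e\<^sub>1 \<noteq> e\<^sub>2 \<and> tail \<Gamma> e\<^sub>1 = tail \<Gamma> e\<^sub>2 \<longrightarrow>
        \<alpha> e\<^sub>1 \<noteq> \<alpha> e\<^sub>2 \<and> independent {\<alpha> e\<^sub>1, \<alpha> e\<^sub>2})"

definition K_graph ::
  "('v, 'e) pre_digraph \<Rightarrow> ('e \<Rightarrow> (real ^ 'n) \<Rightarrow>\<^sub>L real) \<Rightarrow> ('v \<Rightarrow> complex ^ 'n \<Rightarrow> complex) set" where
  "K_graph \<Gamma> \<alpha> = {f \<in> verts \<Gamma> \<rightarrow> rep_ring torus torus_topology.
     \<forall>e\<in>arcs \<Gamma>. restrict (f (tail \<Gamma> e)) (weight_kernel (\<alpha> e)) =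
                 restrict (f (head \<Gamma> e)) (weight_kernel (\<alpha> e))}"

definition symplectic ::
  "('v, 'e) pre_digraph \<Rightarrow> ('e \<Rightarrow> (real ^ 'n) \<Rightarrow>\<^sub>L real) \<Rightarrow> ('v \<Rightarrow> complex ^ 'n \<Rightarrow> complex) \<Rightarrow>
   ('v \<Rightarrow> (real ^ 'n) \<Rightarrow>\<^sub>L real) \<Rightarrow> bool" where
  "symplectic \<Gamma> \<alpha> f a \<longleftrightarrow> f \<in> K_graph \<Gamma> \<alpha> \<and>
     (\<forall>p\<in>verts \<Gamma>. a p \<in> weight_lattice \<and> f p = weight_char (a p)) \<and>
     (\<forall>e\<in>arcs \<Gamma>. \<exists>m::int. m > 0 \<and> a (head \<Gamma> e) - a (tail \<Gamma> e) = of_int m *\<^sub>R \<alpha> e)"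

text \<open>Sums of quotients of virtual characters are evaluated only at points where no denominator
  vanishes; \<open>graph_character\<close> and \<open>reduced_character\<close> are the (unique) virtual characters
  that agree with the respective sum at all those points.\<close>

definition graph_character ::
  "('v, 'e) pre_digraph \<Rightarrow> ('e \<Rightarrow> (real ^ 'n) \<Rightarrow>\<^sub>L real) \<Rightarrow> ('v \<Rightarrow> complex ^ 'n \<Rightarrow> complex) \<Rightarrow>
   complex ^ 'n \<Rightarrow> complex" where
  "graph_character \<Gamma> \<alpha> f = (THE h. h \<in> rep_ring torus torus_topology \<and>
     (\<forall>g\<in>carrier torus. (\<forall>e\<in>arcs \<Gamma>. weight_char (\<alpha> e) g \<noteq> 1) \<longrightarrow>
        h g = (\<Sum>p\<in>verts \<Gamma>. f p g * (\<Prod>e\<in>out_arcs \<Gamma> p. inverse (1 - weight_char (\<alpha> e) g)))))"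

definition edge_term ::
  "('v, 'e) pre_digraph \<Rightarrow> ('e \<Rightarrow> (real ^ 'n) \<Rightarrow>\<^sub>L real) \<Rightarrow> ('v \<Rightarrow> complex ^ 'n \<Rightarrow> complex) \<Rightarrow> 'e \<Rightarrow>
   complex ^ 'n \<Rightarrow> complex" where
  "edge_term \<Gamma> \<alpha> f e g = f (tail \<Gamma> e) g *
     (\<Prod>e'\<in>out_arcs \<Gamma> (tail \<Gamma> e) - {e}. inverse (1 - weight_char (\<alpha> e') g))"

text \<open>Push-forward along \<open>K \<rightarrow> G/T\<close> for a subgroup \<open>K\<close> that maps onto \<open>G/T\<close> with finite kernel
  \<open>K \<inter> T\<close>. A point \<open>C\<close> of \<open>G/T\<close> is a coset of \<open>T\<close>, so its preimages in \<open>K\<close> are the elements of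
  \<open>K \<inter> C\<close>; the value does not depend on the chosen one.\<close>

definition push_forward ::
  "(complex ^ 'n) set \<Rightarrow> (complex ^ 'n) set \<Rightarrow> (complex ^ 'n \<Rightarrow> complex) \<Rightarrow>
   (complex ^ 'n) set \<Rightarrow> complex" where
  "push_forward T K h C = (let g = (SOME g. g \<in> K \<inter> C) in
     inverse (of_nat (card (K \<inter> T))) * (\<Sum>w\<in>K \<inter> T. h (g \<otimes>\<^bsub>torus\<^esub> w)))"

definition crossing_edges :: "('v, 'e) pre_digraph \<Rightarrow> ('v \<Rightarrow> real) \<Rightarrow> real \<Rightarrow> 'e set" where
  "crossing_edges \<Gamma> \<phi> c = {e \<in> arcs \<Gamma>. \<phi> (head \<Gamma> e) > c \<and> c > \<phi> (tail \<Gamma> e)}"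

definition reduced_character ::
  "('v, 'e) pre_digraph \<Rightarrow> ('e \<Rightarrow> (real ^ 'n) \<Rightarrow>\<^sub>L real) \<Rightarrow> (complex ^ 'n) set \<Rightarrow> ('v \<Rightarrow> real) \<Rightarrow> real \<Rightarrow>
   ('v \<Rightarrow> complex ^ 'n \<Rightarrow> complex) \<Rightarrow> (complex ^ 'n) set \<Rightarrow> complex" where
  "reduced_character \<Gamma> \<alpha> T \<phi> c f = (THE h. h \<in> rep_ring (torus Mod T) (quotient_topology T) \<and>
     (\<forall>C\<in>carrier (torus Mod T).
        (\<forall>e\<in>crossing_edges \<Gamma> \<phi> c. \<forall>g\<in>weight_kernel (\<alpha> e) \<inter> C.
           \<forall>e'\<in>out_arcs \<Gamma> (tail \<Gamma> e) - {e}. weight_char (\<alpha> e') g \<noteq> 1) \<longrightarrow>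
        h C = (\<Sum>e\<in>crossing_edges \<Gamma> \<phi> c.
                 push_forward T (weight_kernel (\<alpha> e)) (edge_term \<Gamma> \<alpha> f e) C)))"

definition multiplicity_of :: "(complex ^ 'n \<Rightarrow> complex) \<Rightarrow> ((real ^ 'n) \<Rightarrow>\<^sub>L real) \<Rightarrow> int" where
  "multiplicity_of h = (THE m. finite {\<beta>. m \<beta> \<noteq> 0} \<and> {\<beta>. m \<beta> \<noteq> 0} \<subseteq> weight_lattice \<and>
     h = (\<lambda>g\<in>carrier torus. \<Sum>\<beta> | m \<beta> \<noteq> 0. of_int (m \<beta>) * weight_char \<beta> g))"

text \<open>The sum below is constant on every coset \<open>C\<close> of \<open>T\<close>; \<open>the_elem\<close> selects that value.\<close>

definition invariant_part ::
  "(complex ^ 'n) set \<Rightarrow> real ^ 'n \<Rightarrow> (complex ^ 'n \<Rightarrow> complex) \<Rightarrow> (complex ^ 'n) set \<Rightarrow> complex" where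
  "invariant_part T \<xi> h = (\<lambda>C\<in>carrier (torus Mod T). the_elem
     ((\<lambda>g. \<Sum>\<beta> | multiplicity_of h \<beta> \<noteq> 0 \<and> blinfun_apply \<beta> \<xi> = 0.
              of_int (multiplicity_of h \<beta>) * weight_char \<beta> g) ` C))"

end

theory Submission
  imports Defs "Jordan_Normal_Form.Char_Poly"
begin

text \<open>Along a coset of \<open>T\<close>, parametrised by \<open>z\<close> on the unit circle, the contribution of a vertex \<open>p\<close>
  to \<open>\<chi>(f)\<close> is the rational function
  \<open>f\<^sub>p z\<^bsup>n\<^esup> \<Prod> 1 / (1 - e\<^sup>2\<^sup>\<pi>\<^sup>i\<^sup>\<alpha> z\<^bsup>k\<^esup>)\<close> with \<open>n = \<alpha>\<^sub>p(\<xi>)\<close> and \<open>k = \<alpha>\<^sub>e(\<xi>)\<close>. Expand all of them as power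
  series at \<open>z = 0\<close>: the coefficient of \<open>z\<^sup>j\<close> in the sum is an integral combination of characters of
  degree \<open>j\<close> along \<open>\<xi>\<close>. On a generic coset all poles are simple, and partial fractions express the
  coefficient as a sum of residue terms over the edges whose initial vertex satisfies \<open>n < j\<close>. The
  terms of \<open>e\<close> and of the reversed edge are opposite, so only the edges with initial \<open>n < j\<close> and
  terminal \<open>n > j\<close> survive. Hence the coefficients vanish for large \<open>j\<close>, which makes
  \<open>\<chi>(f)\<close> a virtual character, and for \<open>j = 0\<close>, the \<open>T\<close>-invariant part, the residue terms are the
  push-forwards in the definition of \<open>\<chi>\<^sub>0(f)\<close>. Non-generic points follow by continuity.\<close>

section \<open>Power series of products of geometric factors\<close>

text \<open>Both characters are definite descriptions, so besides the equality the proof has to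
  produce virtual characters with the prescribed values and to show them unique; membership in R(G)
  or R(G/T) is not assumed. All vertices are expanded at the same point z = 0 because only
  expansions at a common centre add up to an expansion of the sum. The expansion of a vertex has the
  residue form only strictly above its lowest possible power z^n: numerator and denominator may have
  equal degree, and the extra constant of the partial fractions sits at z^n itself. A vertex with n
  = j would leave that constant behind, which is why zero must be a regular value. The terms of
  \<open>e\<close> and its reverse cancel because a pole of the factor of \<open>e\<close> is a
  point of the kernel of its character: there f agrees at both ends, and so do, through
  characteristic polynomials, the weights, while k changes sign. Being symplectic makes k > 0 on the
  surviving edges, so the residue factor 1/k is the 1/|W_e| of the push-forward. Every coefficient
  is an integral combination of exponentials and hence continuous at all x, so generic points
  suffice.\<close>

text \<open>Expansion of 1/(1 - c z^k) at z = 0. For k < 0 the function is -c^(-1) z^|k| / (1 -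
  c^(-1) z^|k|), which vanishes at 0; hence the missing term j = 0.\<close>

definition geom_fps :: "complex \<Rightarrow> int \<Rightarrow> complex fps" where
  "geom_fps c k = Abs_fps (\<lambda>j. if nat \<bar>k\<bar> dvd j
     then (if 0 < k then c ^ (j div nat \<bar>k\<bar>)
           else if j = 0 then 0 else - (inverse c ^ (j div nat \<bar>k\<bar>))) else 0)"

text \<open>With \<open>geom_num\<close>, writes 1/(1 - c z^k) as a quotient of polynomials,
  expanding the fraction by -c^(-1) z^|k| if k < 0. For k \<noteq> 0 the constant term is 1 for both
  signs.\<close>

definition geom_den :: "complex \<Rightarrow> int \<Rightarrow> complex poly" where
  "geom_den c k = 1 - monom (c powi sgn k) (nat \<bar>k\<bar>)"

definition geom_num :: "complex \<Rightarrow> int \<Rightarrow> complex poly" where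
  "geom_num c k = (if 0 < k then 1 else - monom (inverse c) (nat \<bar>k\<bar>))"

text \<open>Multiplication by 1 - b z^K subtracts from each coefficient b times the one K places
  before, so the geometric progression telescopes to its first term, at z^0 for k > 0 and at z^K for
  k < 0.\<close>

lemma geom_fps_mult_den:
  assumes "k \<noteq> 0"
  shows "geom_fps c k * fps_of_poly (geom_den c k) = fps_of_poly (geom_num c k)"
proof (rule fps_ext)
  fix j
  define K where "K = nat \<bar>k\<bar>"
  have K: "K > 0" using assms by (simp add: K_def)
  define b where "b = c powi sgn k"
  have eq: "fps_nth (geom_fps c k * fps_of_poly (geom_den c k)) j =
      fps_nth (geom_fps c k) j - b * (if j < K then 0 else fps_nth (geom_fps c k) (j - K))"
    by (simp add: geom_den_def fps_of_poly_diff fps_of_poly_monom algebra_simps fps_X_power_mult_right_nth fps_X_power_mult_nth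
          flip: b_def K_def)
  have dvd: "K dvd j - K \<longleftrightarrow> K dvd j" "(j - K) div K = j div K - 1" if "\<not> j < K"
    using that K by (auto simp: le_div_geq dvd_minus_self)
  have pos: "j div K > 0" if "\<not> j < K"
    using that K by (simp add: div_greater_zero_iff)
  show "fps_nth (geom_fps c k * fps_of_poly (geom_den c k)) j = fps_nth (fps_of_poly (geom_num c k)) j"
  proof (cases "k > 0")
    case True
    have "b = c" using True by (simp add: b_def)
    moreover have "c ^ (j div K) = c * c ^ (j div K - 1)" if "\<not> j < K"
      using pos[OF that] by (metis power_minus_mult mult.commute)
    moreover have "fps_nth (geom_fps c k) i = (if K dvd i then c ^ (i div K) else 0)" for i
      using True by (simp add: geom_fps_def K_def)
    moreover have "fps_nth (fps_of_poly (geom_num c k)) j = (if j = 0 then 1 else 0)"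
      using True by (simp add: geom_num_def)
    ultimately show ?thesis
      unfolding eq using dvd K by (auto dest: dvd_imp_le)
  next
    case False
    with assms have "k < 0" by simp
    then have b: "b = inverse c" by (simp add: b_def power_int_minus)
    have j: "j = K" if "K dvd j" "\<not> j < K" "\<not> K < j" using that by simp
    have "inverse c ^ (j div K) = inverse c * inverse c ^ (j div K - 1)" if "\<not> j < K"
      using pos[OF that] by (metis power_minus_mult mult.commute)
    moreover have "fps_nth (geom_fps c k) i =
        (if K dvd i \<and> i > 0 then - (inverse c ^ (i div K)) else 0)" for i
      using \<open>k < 0\<close> by (auto simp: geom_fps_def K_def)
    moreover have "fps_nth (fps_of_poly (geom_num c k)) j = (if j = K then - inverse c else 0)"
      using \<open>k < 0\<close> K by (simp add: geom_num_def K_def)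
    ultimately show ?thesis
      unfolding eq b using dvd K by (cases "j = K") (auto dest: dvd_imp_le)
  qed
qed

lemma geom_fps_conv_radius:
  assumes "norm c = 1"
  shows "fps_conv_radius (geom_fps c k) \<ge> 1"
  unfolding fps_conv_radius_def
proof (rule conv_radius_geI_ex)
  fix r :: real assume r: "0 < r" "ereal r < 1"
  have "summable (\<lambda>n. r ^ n)" using r by (simp add: summable_geometric)
  moreover have "norm (fps_nth (geom_fps c k) n * of_real r ^ n) \<le> r ^ n" for n
    using r assms by (auto simp: geom_fps_def norm_mult norm_power norm_inverse)
  ultimately have "summable (\<lambda>n. fps_nth (geom_fps c k) n * of_real r ^ n)"
    by (rule summable_comparison_test'[where N = 0]) 
  then show "\<exists>z. norm z = r \<and> summable (\<lambda>n. fps_nth (geom_fps c k) n * z ^ n)"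
    using r by (intro exI[of _ "of_real r :: complex"]) auto
qed

lemma poly_geom_num_div_den:
  assumes "c \<noteq> 0" "k \<noteq> 0" "z \<noteq> 0"
  shows "poly (geom_num c k) z / poly (geom_den c k) z = inverse (1 - c * z powi k)"
proof (cases "k > 0")
  case True
  then show ?thesis
    by (simp add: geom_num_def geom_den_def poly_monom power_int_def inverse_eq_divide)
next
  case False
  with assms(2) have k: "k < 0" by simp
  define w where "w = c * z powi k"
  have w: "w \<noteq> 0" using assms by (simp add: w_def)
  have "inverse c * z ^ nat \<bar>k\<bar> = inverse w"
    using k by (simp add: w_def power_int_def field_simps)
  then have "poly (geom_num c k) z / poly (geom_den c k) z = - inverse w / (1 - inverse w)"
    using k by (simp add: geom_num_def geom_den_def poly_monom power_int_minus)
  also have "\<dots> = inverse (1 - w)"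
    \<comment> \<open>At w = 1 both sides are 0, since division by 0 gives 0.\<close>
    using w by (cases "w = 1") (simp_all add: field_simps)
  finally show ?thesis by (simp add: w_def)
qed

lemma geom_den_root:
  assumes "c \<noteq> 0" "k \<noteq> 0"
  shows "poly (geom_den c k) z = 0 \<longleftrightarrow> z \<noteq> 0 \<and> c * z powi k = 1"
proof (cases "z = 0")
  case True
  with assms show ?thesis by (simp add: geom_den_def poly_monom power_0_left)
next
  case False
  then show ?thesis
  proof (cases "k > 0")
    case True
    with False show ?thesis
      by (auto simp: geom_den_def poly_monom power_int_def)
  next
    case F: False
    with assms(2) have k: "k < 0" by simp
    have "c * z powi k = inverse (inverse c * z ^ nat (- k))"
      using k by (simp add: power_int_def field_simps)
    moreover have "poly (geom_den c k) z = 1 - inverse c * z ^ nat (- k)"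
      using k by (simp add: geom_den_def poly_monom power_int_minus)
    ultimately show ?thesis using False by (metis inverse_1 inverse_inverse_eq eq_iff_diff_eq_0)
  qed
qed

text \<open>The zeros are the |k|-th roots of a nonzero number. There are as many as the degree, so
  all are simple.\<close>

lemma card_geom_den_roots:
  assumes "c \<noteq> 0" "k \<noteq> 0"
  shows "card {z. poly (geom_den c k) z = 0} = nat \<bar>k\<bar>"
proof -
  have "{z. poly (geom_den c k) z = 0} = {z. z ^ nat \<bar>k\<bar> = inverse (c powi sgn k)}"
    using assms by (auto simp: geom_den_def poly_monom field_simps)
  then show ?thesis
    using assms by (simp add: card_nth_roots)
qed

text \<open>At a zero, b z^K = 1. Together with the numerator value sgn k this makes the weight
  -N(z)/(z D'(z)) of a single factor equal to 1/k for both signs of k.\<close>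

lemma poly_pderiv_geom_den:
  assumes "c \<noteq> 0" "k \<noteq> 0" "poly (geom_den c k) z = 0"
  shows "z * poly (pderiv (geom_den c k)) z = - of_int \<bar>k\<bar>"
proof -
  define K where "K = nat \<bar>k\<bar>"
  have K: "K > 0" using assms by (simp add: K_def)
  have "z * poly (pderiv (geom_den c k)) z = - (of_nat K * (c powi sgn k * z ^ K))"
    using K by (cases K) (simp_all add: geom_den_def pderiv_diff pderiv_monom poly_monom mult_ac flip: K_def)
  moreover have "c powi sgn k * z ^ K = 1"
    using assms(3) by (simp add: geom_den_def poly_monom flip: K_def)
  ultimately show ?thesis by (simp add: K_def)
qed

lemma poly_geom_num_root:
  assumes "c \<noteq> 0" "k \<noteq> 0" "poly (geom_den c k) z = 0"
  shows "poly (geom_num c k) z = of_int (sgn k)"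
  using assms by (auto simp: geom_den_def geom_num_def poly_monom power_int_minus)

lemma degree_geom_den:
  assumes "c \<noteq> 0" "k \<noteq> 0"
  shows "degree (geom_den c k) = nat \<bar>k\<bar>"
proof -
  have "geom_den c k = monom (- (c powi sgn k)) (nat \<bar>k\<bar>) + 1"
    by (simp add: geom_den_def minus_monom)
  moreover have "degree (monom (- (c powi sgn k)) (nat \<bar>k\<bar>)) = nat \<bar>k\<bar>"
    using assms by (simp add: degree_monom_eq)
  ultimately show ?thesis using assms by (simp add: degree_add_eq_left)
qed

lemma degree_geom_num: "degree (geom_num c k) \<le> nat \<bar>k\<bar>"
  by (simp add: geom_num_def degree_monom_le)

text \<open>Lagrange interpolation at the zeros of \<open>D\<close>.\<close>

lemma partial_fraction_simple_roots:
  fixes N D :: "complex poly"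
  assumes Z: "Z = {z. poly D z = 0}" and card: "card Z = degree D" and D0: "poly D 0 \<noteq> 0"
    and deg: "degree N \<le> degree D"
  shows "\<exists>a. fps_of_poly N = fps_of_poly D * (fps_const a +
    (\<Sum>w\<in>Z. fps_const (- poly N w / (w * poly (pderiv D) w)) * Abs_fps (\<lambda>j. inverse w ^ j)))"
proof -
  have Dn0: "D \<noteq> 0" using D0 by auto
  have fin: "finite Z" using poly_roots_finite[OF Dn0] by (simp add: Z)
  have w0: "w \<noteq> 0" if "w \<in> Z" for w using that D0 by (auto simp: Z)
  \<comment> \<open>The linear factor is normalised to 1 - z/w, whose inverse is the geometric
    series in z/w.\<close>
  have "\<exists>Q. D = [:1, - inverse w:] * Q" if "w \<in> Z" for w
  proof -
    have "[:- w, 1:] dvd D" using that by (simp add: Z poly_eq_0_iff_dvd)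
    then obtain Q where "D = [:- w, 1:] * Q" by (auto elim: dvdE)
    moreover have "[:- w, 1:] = [:1, - inverse w:] * [:- w:]" using w0[OF that] by simp
    ultimately have "D = [:1, - inverse w:] * ([:- w:] * Q)" by (simp only: mult.assoc)
    then show ?thesis by blast
  qed
  then obtain Q where Q: "\<And>w. w \<in> Z \<Longrightarrow> D = [:1, - inverse w:] * Q w" by metis
  have Q0: "Q w \<noteq> 0" if "w \<in> Z" for w using Q[OF that] Dn0 by auto
  have degQ: "degree (Q w) < degree D" if "w \<in> Z" for w
  proof -
    have "degree D = degree [:1, - inverse w:] + degree (Q w)"
      unfolding Q[OF that] using Q0[OF that] by (subst degree_mult_eq) auto
    then show ?thesis using w0[OF that] by simp
  qed
  have Qroot: "poly (Q w) v = 0" if "w \<in> Z" "v \<in> Z" "v \<noteq> w" for v w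
  proof -
    have "poly D v = (1 - v * inverse w) * poly (Q w) v" 
      using arg_cong[OF Q[OF that(1)], of "\<lambda>p. poly p v"] by (simp add: algebra_simps)
    moreover have "poly D v = 0" using that by (simp add: Z)
    moreover have "1 - v * inverse w \<noteq> 0" using that w0[OF that(1)] by (simp add: field_simps)
    ultimately show ?thesis by simp
  qed
  \<comment> \<open>Simplicity of the zeros: otherwise \<open>Q w\<close>, of smaller degree than D,
    would vanish on all of Z.\<close>
  have Qnr: "poly (Q w) w \<noteq> 0" if "w \<in> Z" for w
  proof
    assume "poly (Q w) w = 0"
    then have "Z \<subseteq> {v. poly (Q w) v = 0}" using Qroot[OF that] by auto
    then have "card Z \<le> card {v. poly (Q w) v = 0}"
      by (intro card_mono poly_roots_finite Q0 that)
    also have "\<dots> \<le> degree (Q w)" by (rule card_poly_roots_bound[OF Q0[OF that]])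
    finally show False using degQ[OF that] card by simp
  qed
  have der: "w * poly (pderiv D) w = - poly (Q w) w" if "w \<in> Z" for w
  proof -
    have "pderiv D = pderiv ([:1, - inverse w:] * Q w)" using Q[OF that] by simp
    also have "\<dots> = [:1, - inverse w:] * pderiv (Q w) + Q w * [:- inverse w:]"
      by (simp only: pderiv_mult) (simp add: pderiv_pCons)
    finally have "poly (pderiv D) w =
        poly ([:1, - inverse w:] * pderiv (Q w) + Q w * [:- inverse w:]) w" by simp
    also have "\<dots> = (1 - w * inverse w) * poly (pderiv (Q w)) w - poly (Q w) w * inverse w"
      by (simp add: algebra_simps)
    finally show ?thesis using w0[OF that] by simp
  qed
  define r where "r w = - poly N w / (w * poly (pderiv D) w)" for w
  \<comment> \<open>The polynomial part of N/D. Subtracting a D lowers the degree below that of D,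
    so that vanishing on Z forces \<open>E = 0\<close>.\<close>
  define a where "a = coeff N (degree D) / lead_coeff D"
  define E where "E = N - Polynomial.smult a D - (\<Sum>w\<in>Z. Polynomial.smult (r w) (Q w))"
  have "E = 0"
  proof (rule ccontr)
    assume E: "E \<noteq> 0"
    have "degree E \<le> degree D"
      unfolding E_def using deg fin degQ
      by (intro degree_diff_le degree_sum_le) (auto intro: order.trans[OF degree_smult_le] less_imp_le)
    moreover have "coeff E (degree D) = 0"
      using degQ Dn0 by (simp add: E_def a_def coeff_sum coeff_eq_0)
    ultimately have dE: "degree E < degree D" using E
      by (metis le_neq_implies_less leading_coeff_0_iff)
    have "poly E v = 0" if "v \<in> Z" for v
    proof -
      have "(\<Sum>w\<in>Z. r w * poly (Q w) v) = (\<Sum>w\<in>Z. if w = v then poly N v else 0)"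
        using Qroot that Qnr[OF that] by (intro sum.cong) (auto simp: r_def der)
      also have "\<dots> = poly N v" using that fin by simp
      finally show ?thesis using that by (simp add: E_def poly_sum Z)
    qed
    then have "Z \<subseteq> {v. poly E v = 0}" by auto
    then have "card Z \<le> card {v. poly E v = 0}" by (intro card_mono poly_roots_finite E)
    also have "\<dots> \<le> degree E" by (rule card_poly_roots_bound[OF E])
    finally show False using dE card by simp
  qed
  then have N: "N = Polynomial.smult a D + (\<Sum>w\<in>Z. Polynomial.smult (r w) (Q w))" by (simp add: E_def algebra_simps)
  have geo: "fps_of_poly [:1, - inverse w:] * Abs_fps (\<lambda>j. inverse w ^ j) = 1" if "w \<in> Z" for w
  proof (rule fps_ext)
    fix n
    show "fps_nth (fps_of_poly [:1, - inverse w:] * Abs_fps (\<lambda>j. inverse w ^ j)) n = fps_nth 1 n"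
      by (cases n) (simp_all add: fps_of_poly_pCons algebra_simps)
  qed
  have smultQ: "fps_of_poly (Polynomial.smult (r w) (Q w)) =
      fps_of_poly D * (fps_const (r w) * Abs_fps (\<lambda>j. inverse w ^ j))" if "w \<in> Z" for w
  proof -
    have "fps_of_poly D * (fps_const (r w) * Abs_fps (\<lambda>j. inverse w ^ j)) =
       fps_const (r w) * fps_of_poly (Q w) * (fps_of_poly [:1, - inverse w:] * Abs_fps (\<lambda>j. inverse w ^ j))"
      by (subst Q[OF that]) (simp add: fps_of_poly_mult mult_ac)
    then show ?thesis by (simp only: geo[OF that] fps_of_poly_smult mult_1_right)
  qed
  have "fps_of_poly N = fps_of_poly (Polynomial.smult a D) +
      (\<Sum>w\<in>Z. fps_of_poly (Polynomial.smult (r w) (Q w)))"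
    by (subst N) (simp only: fps_of_poly_add fps_of_poly_sum)
  also have "(\<Sum>w\<in>Z. fps_of_poly (Polynomial.smult (r w) (Q w))) =
      fps_of_poly D * (\<Sum>w\<in>Z. fps_const (r w) * Abs_fps (\<lambda>j. inverse w ^ j))"
    unfolding sum_distrib_left by (intro sum.cong refl smultQ)
  finally have "fps_of_poly N = fps_of_poly D * (fps_const a +
    (\<Sum>w\<in>Z. fps_const (r w) * Abs_fps (\<lambda>j. inverse w ^ j)))"
    by (simp only: fps_of_poly_smult distrib_left mult.commute[of "fps_const a"])
  then show ?thesis unfolding r_def by blast
qed


section \<open>Evaluation and coefficients of products of geometric factors\<close>

lemma prod_geom_fps_conv_radius:
  assumes "finite E" "\<And>e. e \<in> E \<Longrightarrow> norm (c e) = 1"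
  shows "fps_conv_radius (\<Prod>e\<in>E. geom_fps (c e) (k e)) \<ge> 1"
  using assms
proof (induction E rule: finite_induct)
  case (insert e E)
  have "1 \<le> min (fps_conv_radius (geom_fps (c e) (k e)))
                  (fps_conv_radius (\<Prod>e\<in>E. geom_fps (c e) (k e)))"
    using insert by (auto intro: geom_fps_conv_radius)
  also have "\<dots> \<le> fps_conv_radius (\<Prod>e\<in>insert e E. geom_fps (c e) (k e))"
    using insert by (simp add: fps_conv_radius_mult)
  finally show ?case .
qed auto

lemma eval_geom_fps:
  assumes "norm c = 1" "k \<noteq> 0" "z \<noteq> 0" "norm z < 1"
  shows "eval_fps (geom_fps c k) z = inverse (1 - c * z powi k)"
proof -
  have c: "c \<noteq> 0" using assms(1) by auto
  have "ereal (norm z) < 1" using assms by simp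
  then have r: "ereal (norm z) < fps_conv_radius (geom_fps c k)"
    using geom_fps_conv_radius[OF assms(1), of k] by (rule less_le_trans)
  have "eval_fps (geom_fps c k * fps_of_poly (geom_den c k)) z
      = eval_fps (geom_fps c k) z * eval_fps (fps_of_poly (geom_den c k)) z"
    by (rule eval_fps_mult) (use r in auto)
  then have eq: "poly (geom_num c k) z = eval_fps (geom_fps c k) z * poly (geom_den c k) z"
    using assms by (simp add: geom_fps_mult_den)
  have "norm z powi k \<noteq> 1"
    using assms power_Suc_less_one[of "norm z" "nat \<bar>k\<bar> - 1"]
    by (cases "k > 0") (auto simp: power_int_def power_inverse)
  have "poly (geom_den c k) z \<noteq> 0"
  proof
    assume "poly (geom_den c k) z = 0"
    then have "norm (c * z powi k) = 1" using geom_den_root[OF c assms(2)] by simp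
    with \<open>norm z powi k \<noteq> 1\<close> show False using assms(1) by (simp add: norm_mult norm_power_int)
  qed
  with eq have "eval_fps (geom_fps c k) z = poly (geom_num c k) z / poly (geom_den c k) z"
    by (simp add: field_simps)
  then show ?thesis using poly_geom_num_div_den[OF c assms(2,3)] by simp
qed

lemma eval_prod_geom_fps:
  assumes "finite E" "\<And>e. e \<in> E \<Longrightarrow> norm (c e) = 1" "\<And>e. e \<in> E \<Longrightarrow> k e \<noteq> 0"
    and z: "z \<noteq> 0" "norm z < 1"
  shows "eval_fps (\<Prod>e\<in>E. geom_fps (c e) (k e)) z = (\<Prod>e\<in>E. inverse (1 - c e * z powi k e))"
  using assms(1-3)
proof (induction E rule: finite_induct)
  case (insert e E)
  have "ereal (norm z) < 1" using z by simp
  then have "ereal (norm z) < fps_conv_radius (geom_fps (c e) (k e))"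
       "ereal (norm z) < fps_conv_radius (\<Prod>e\<in>E. geom_fps (c e) (k e))"
    using geom_fps_conv_radius[of "c e" "k e"] prod_geom_fps_conv_radius[of E c k] insert
    by (auto intro: less_le_trans[of _ "1 :: ereal"])
  then show ?case using insert z by (simp add: eval_fps_mult eval_geom_fps)
qed auto

text \<open>By \<open>simple\<close> the factors have disjoint zero sets, so the zeros of the
  product are as many as its degree and partial fractions apply. The weight at a zero of factor e is
  1/k_e times the other factors. The constant of the partial fractions affects only coefficient 0,
  hence \<open>j > 0\<close>.\<close>

lemma prod_geom_fps_coeff:
  fixes c :: "'e \<Rightarrow> complex"
  assumes fin: "finite E" and c: "\<And>e. e \<in> E \<Longrightarrow> c e \<noteq> 0" and k: "\<And>e. e \<in> E \<Longrightarrow> k e \<noteq> 0"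
    and simple: "\<And>e e' z. \<lbrakk>e \<in> E; e' \<in> E; e \<noteq> e'; z \<noteq> 0; c e * z powi k e = 1\<rbrakk> \<Longrightarrow> c e' * z powi k e' \<noteq> 1"
    and j: "j > 0"
  shows "fps_nth (\<Prod>e\<in>E. geom_fps (c e) (k e)) j =
    (\<Sum>e\<in>E. \<Sum>z | z \<noteq> 0 \<and> c e * z powi k e = 1.
       inverse z ^ j * (\<Prod>e'\<in>E - {e}. inverse (1 - c e' * z powi k e')) / of_int (k e))"
proof -
  define D where "D = (\<Prod>e\<in>E. geom_den (c e) (k e))"
  define N where "N = (\<Prod>e\<in>E. geom_num (c e) (k e))"
  define Z where "Z e = {z. poly (geom_den (c e) (k e)) z = 0}" for e
  have Z_eq: "Z e = {z. z \<noteq> 0 \<and> c e * z powi k e = 1}" if "e \<in> E" for e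
    using geom_den_root[OF c k] that by (auto simp: Z_def)
  have den0: "poly (geom_den (c e) (k e)) 0 = 1" if "e \<in> E" for e
    using k[OF that] by (simp add: geom_den_def poly_monom power_0_left)
  then have den_n0: "geom_den (c e) (k e) \<noteq> 0" if "e \<in> E" for e
    using that by force
  have D0: "poly D 0 = 1" using den0 by (simp add: D_def poly_prod)
  have finZ: "finite (Z e)" if "e \<in> E" for e
    unfolding Z_def by (rule poly_roots_finite[OF den_n0[OF that]])
  have disj: "Z e \<inter> Z e' = {}" if "e \<in> E" "e' \<in> E" "e \<noteq> e'" for e e'
    using simple that by (auto simp: Z_eq)
  have UZ: "(\<Union>e\<in>E. Z e) = {z. poly D z = 0}"
    using fin by (auto simp: D_def poly_prod Z_def)
  have "card (\<Union>e\<in>E. Z e) = (\<Sum>e\<in>E. nat \<bar>k e\<bar>)"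
    using fin finZ disj card_geom_den_roots[OF c k] by (subst card_UN_disjoint) (auto simp: Z_def)
  also have "\<dots> = degree D"
    unfolding D_def using degree_geom_den[OF c k] den_n0
    by (subst degree_prod_eq_sum_degree) auto
  finally have card: "card (\<Union>e\<in>E. Z e) = degree D" .
  have "degree N \<le> (\<Sum>e\<in>E. degree (geom_num (c e) (k e)))"
    unfolding N_def using degree_prod_sum_le[OF fin] by (simp add: o_def)
  also have "\<dots> \<le> (\<Sum>e\<in>E. nat \<bar>k e\<bar>)" by (intro sum_mono degree_geom_num)
  also have "\<dots> = degree D"
    unfolding D_def using degree_geom_den[OF c k] den_n0
    by (subst degree_prod_eq_sum_degree) auto
  finally have degN: "degree N \<le> degree D" .
  define r where "r w = - poly N w / (w * poly (pderiv D) w)" for w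
  obtain a where a: "fps_of_poly N = fps_of_poly D * (fps_const a +
    (\<Sum>w\<in>(\<Union>e\<in>E. Z e). fps_const (r w) * Abs_fps (\<lambda>j. inverse w ^ j)))"
    using partial_fraction_simple_roots[OF UZ card _ degN] D0 unfolding r_def by auto
  have "(\<Prod>e\<in>E. geom_fps (c e) (k e)) * fps_of_poly D = fps_of_poly N"
    unfolding D_def N_def fps_of_poly_prod prod.distrib[symmetric]
    using geom_fps_mult_den k by (intro prod.cong) auto
  with a have "fps_of_poly D * (\<Prod>e\<in>E. geom_fps (c e) (k e)) = fps_of_poly D * (fps_const a +
    (\<Sum>w\<in>(\<Union>e\<in>E. Z e). fps_const (r w) * Abs_fps (\<lambda>j. inverse w ^ j)))"
    by (simp add: mult.commute)
  moreover have "D \<noteq> 0" using D0 by auto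
  ultimately have "(\<Prod>e\<in>E. geom_fps (c e) (k e)) = fps_const a +
    (\<Sum>w\<in>(\<Union>e\<in>E. Z e). fps_const (r w) * Abs_fps (\<lambda>j. inverse w ^ j))"
    by simp
  then have "fps_nth (\<Prod>e\<in>E. geom_fps (c e) (k e)) j = (\<Sum>w\<in>(\<Union>e\<in>E. Z e). r w * inverse w ^ j)"
    using j by (simp add: fps_sum_nth)
  also have "\<dots> = (\<Sum>e\<in>E. \<Sum>w\<in>Z e. r w * inverse w ^ j)"
    using fin finZ disj by (intro sum.UNION_disjoint) auto
  also have "\<dots> = (\<Sum>e\<in>E. \<Sum>z\<in>Z e.
       inverse z ^ j * (\<Prod>e'\<in>E - {e}. inverse (1 - c e' * z powi k e')) / of_int (k e))"
  proof (intro sum.cong refl)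
    fix e z assume e: "e \<in> E" and z: "z \<in> Z e"
    have z0: "z \<noteq> 0" using z e by (simp add: Z_eq)
    have zr: "poly (geom_den (c e) (k e)) z = 0" using z by (simp add: Z_def)
    \<comment> \<open>At a zero of factor e only the summand of the product rule that differentiates
      this factor survives.\<close>
    have "poly (pderiv D) z = (\<Sum>a\<in>E. poly (\<Prod>e'\<in>E - {a}. geom_den (c e') (k e')) z *
        poly (pderiv (geom_den (c a) (k a))) z)"
      by (simp add: D_def pderiv_prod poly_sum)
    also have "\<dots> = (\<Sum>a\<in>E. if a = e then poly (\<Prod>e'\<in>E - {e}. geom_den (c e') (k e')) z *
        poly (pderiv (geom_den (c e) (k e))) z else 0)"
      using e zr fin by (intro sum.cong) (auto simp: poly_prod)
    also have "\<dots> = (\<Prod>e'\<in>E - {e}. poly (geom_den (c e') (k e')) z) *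
        poly (pderiv (geom_den (c e) (k e))) z"
      using e fin by (simp add: poly_prod)
    finally have "z * poly (pderiv D) z = (\<Prod>e'\<in>E - {e}. poly (geom_den (c e') (k e')) z) *
        - of_int \<bar>k e\<bar>"
      by (simp only: mult.left_commute[of z] poly_pderiv_geom_den[OF c[OF e] k[OF e] zr])
    moreover have "poly N z = of_int (sgn (k e)) * (\<Prod>e'\<in>E - {e}. poly (geom_num (c e') (k e')) z)"
      using e fin poly_geom_num_root[OF c k zr] by (simp add: N_def poly_prod prod.remove)
    ultimately have "r z = (of_int (sgn (k e)) / of_int \<bar>k e\<bar>) *
       ((\<Prod>e'\<in>E - {e}. poly (geom_num (c e') (k e')) z) / (\<Prod>e'\<in>E - {e}. poly (geom_den (c e') (k e')) z))"
      by (simp add: r_def)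
    also have "of_int (sgn (k e)) / of_int \<bar>k e\<bar> = (1 / of_int (k e) :: complex)"
      using k[OF e] by (auto simp: abs_if sgn_if)
    also have "(\<Prod>e'\<in>E - {e}. poly (geom_num (c e') (k e')) z) / (\<Prod>e'\<in>E - {e}. poly (geom_den (c e') (k e')) z)
       = (\<Prod>e'\<in>E - {e}. inverse (1 - c e' * z powi k e'))"
      unfolding prod_dividef[symmetric]
      using c k z0 poly_geom_num_div_den by (intro prod.cong) auto
    finally show "r z * inverse z ^ j =
       inverse z ^ j * (\<Prod>e'\<in>E - {e}. inverse (1 - c e' * z powi k e')) / of_int (k e)"
      by simp
  qed
  finally show ?thesis using Z_eq by simp
qed

section \<open>The torus and its characters\<close>

lemma carrier_circle_group [simp]: "z \<in> carrier circle_group \<longleftrightarrow> norm z = 1"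
  and mult_circle_group [simp]: "mult circle_group = (*)"
  and one_circle_group [simp]: "one circle_group = 1"
  by (simp_all add: circle_group_def)

lemma vec_nth_torus_exp [simp]: "vec_nth (torus_exp x) i = cis (2 * pi * vec_nth x i)"
  by (simp add: torus_exp_def)

lemma torus_exp_in_carrier [simp]: "torus_exp x \<in> carrier torus"
  by (simp add: torus_def)

lemma mult_torus: "z \<otimes>\<^bsub>torus\<^esub> w = (\<chi> i. vec_nth z i * vec_nth w i)"
  by (simp add: torus_def)

lemma one_torus: "\<one>\<^bsub>torus\<^esub> = (\<chi> i. 1)"
  by (simp add: torus_def)

lemma torus_exp_add: "torus_exp (x + y) = torus_exp x \<otimes>\<^bsub>torus\<^esub> torus_exp y"
  by (simp add: Finite_Cartesian_Product.vec_eq_iff mult_torus cis_mult distrib_left)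

lemma torus_exp_0: "torus_exp 0 = \<one>\<^bsub>torus\<^esub>"
  by (simp add: Finite_Cartesian_Product.vec_eq_iff one_torus)

lemma torus_exp_surj:
  assumes "g \<in> carrier torus"
  shows "\<exists>x. g = torus_exp x"
proof
  have "vec_nth g i = cis (Arg (vec_nth g i))" for i
  proof -
    have "norm (vec_nth g i) = 1" using assms by (simp add: torus_def)
    then show ?thesis using rcis_cmod_Arg[of "vec_nth g i"] unfolding rcis_def by simp
  qed
  then show "g = torus_exp (\<chi> i. Arg (vec_nth g i) / (2 * pi))"
    unfolding Finite_Cartesian_Product.vec_eq_iff by auto
qed

lemma carrier_torus_eq: "carrier torus = range torus_exp"
  using torus_exp_surj by auto

lemma comm_group_torus: "comm_group (torus :: (complex ^ 'n) monoid)"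
proof (rule comm_groupI)
  fix x :: "complex ^ 'n" assume "x \<in> carrier torus"
  then obtain a where a: "x = torus_exp a" using torus_exp_surj by blast
  then have "torus_exp (- a) \<otimes>\<^bsub>torus\<^esub> x = \<one>\<^bsub>torus\<^esub>"
    by (simp flip: torus_exp_add torus_exp_0)
  then show "\<exists>y\<in>carrier torus. y \<otimes>\<^bsub>torus\<^esub> x = \<one>\<^bsub>torus\<^esub>" by force
next
qed (auto simp: torus_def mult_ac norm_mult)

interpretation torus: comm_group "torus :: (complex ^ 'n) monoid"
  by (rule comm_group_torus)

lemma torus_exp_minus: "torus_exp (- x) = inv\<^bsub>torus\<^esub> torus_exp x"
  by (rule torus.inv_equality[symmetric]) (simp_all flip: torus_exp_add torus_exp_0)

lemma continuous_on_torus_exp: "continuous_on UNIV torus_exp"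
  unfolding torus_exp_def
  by (intro continuous_on_vec_lambda continuous_on_cis continuous_intros)

lemma cis_eq_1_iff: "cis t = 1 \<longleftrightarrow> (\<exists>k::int. t = 2 * pi * of_int k)"
proof
  assume "cis t = 1"
  then have "cos t = 1" by (simp add: complex_eq_iff)
  then show "\<exists>k::int. t = 2 * pi * of_int k" using cos_one_2pi_int[of t] by (auto simp: mult_ac)
qed (auto simp: complex_eq_iff cos_int_2pin sin_int_2pin)

lemma cis_2pi_eq_1_iff: "cis (2 * pi * t) = 1 \<longleftrightarrow> t \<in> \<int>"
  by (auto simp: cis_eq_1_iff Ints_def)

lemma group_lattice_iff: "v \<in> group_lattice \<longleftrightarrow> (\<forall>i. vec_nth v i \<in> \<int>)"
  by (simp add: group_lattice_def Finite_Cartesian_Product.vec_eq_iff one_torus cis_2pi_eq_1_iff)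

lemma torus_exp_eq_iff: "torus_exp x = torus_exp y \<longleftrightarrow> x - y \<in> group_lattice"
proof -
  have "torus_exp x = torus_exp (x - y) \<otimes>\<^bsub>torus\<^esub> torus_exp y"
    by (simp flip: torus_exp_add)
  then have "torus_exp x = torus_exp y \<longleftrightarrow> torus_exp (x - y) = \<one>\<^bsub>torus\<^esub>"
    by (metis torus.l_one torus.r_cancel_one torus_exp_in_carrier)
  then show ?thesis by (simp add: group_lattice_def)
qed

section \<open>Exponentials of weights on the Lie algebra\<close>

definition exp_weight :: "((real ^ 'n) \<Rightarrow>\<^sub>L real) \<Rightarrow> real ^ 'n \<Rightarrow> complex" where
  "exp_weight \<beta> x = cis (2 * pi * blinfun_apply \<beta> x)"

lemma norm_exp_weight [simp]: "norm (exp_weight \<beta> x) = 1"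
  by (simp add: exp_weight_def)

lemma exp_weight_nonzero [simp]: "exp_weight \<beta> x \<noteq> 0"
  by (simp add: exp_weight_def)

lemma exp_weight_add: "exp_weight (\<beta> + \<gamma>) x = exp_weight \<beta> x * exp_weight \<gamma> x"
  by (simp add: exp_weight_def blinfun.add_left cis_mult distrib_left)

lemma exp_weight_0 [simp]: "exp_weight 0 x = 1"
  by (simp add: exp_weight_def)

lemma exp_weight_minus: "exp_weight (- \<beta>) x = inverse (exp_weight \<beta> x)"
  by (simp add: exp_weight_def blinfun.minus_left)

lemma exp_weight_add_right: "exp_weight \<beta> (x + y) = exp_weight \<beta> x * exp_weight \<beta> y"
  by (simp add: exp_weight_def blinfun.add_right cis_mult distrib_left)

lemma continuous_on_exp_weight [continuous_intros]:
  "continuous_on S h \<Longrightarrow> continuous_on S (\<lambda>x. exp_weight \<beta> (h x))"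
  unfolding exp_weight_def by (intro continuous_on_cis continuous_intros)

lemma weight_latticeD: "\<lbrakk>\<beta> \<in> weight_lattice; v \<in> group_lattice\<rbrakk> \<Longrightarrow> blinfun_apply \<beta> v \<in> \<int>"
  by (simp add: weight_lattice_def)

lemma weight_lattice_add: "\<lbrakk>\<beta> \<in> weight_lattice; \<gamma> \<in> weight_lattice\<rbrakk> \<Longrightarrow> \<beta> + \<gamma> \<in> weight_lattice"
  by (simp add: weight_lattice_def blinfun.add_left)

lemma weight_lattice_minus: "\<beta> \<in> weight_lattice \<Longrightarrow> - \<beta> \<in> weight_lattice"
  by (simp add: weight_lattice_def blinfun.minus_left)

lemma weight_lattice_0: "0 \<in> weight_lattice"
  by (simp add: weight_lattice_def)

lemma weight_char_torus_exp:
  assumes "\<beta> \<in> weight_lattice"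
  shows "weight_char \<beta> (torus_exp x) = exp_weight \<beta> x"
proof -
  define y where "y = (SOME y. torus_exp y = torus_exp x)"
  have "torus_exp y = torus_exp x"
    unfolding y_def by (rule someI_ex) blast
  then have "y - x \<in> group_lattice" by (simp add: torus_exp_eq_iff)
  then have "exp_weight \<beta> (y - x) = 1"
    using weight_latticeD[OF assms] by (simp add: exp_weight_def cis_2pi_eq_1_iff)
  moreover have "exp_weight \<beta> y = exp_weight \<beta> x * exp_weight \<beta> (y - x)"
    by (simp flip: exp_weight_add_right)
  ultimately show ?thesis
    by (simp add: weight_char_def exp_weight_def y_def)
qed

text \<open>Equal exponentials make s t an integer for every real s, where t is the difference of
  the weights at x. If t were nonzero, s = 1/(2t) would give 1/2.\<close>

lemma exp_weight_eq_iff: "(\<forall>x. exp_weight \<beta> x = exp_weight \<gamma> x) \<longleftrightarrow> \<beta> = \<gamma>"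
proof
  assume eq: "\<forall>x. exp_weight \<beta> x = exp_weight \<gamma> x"
  show "\<beta> = \<gamma>"
  proof (rule blinfun_eqI)
    fix x
    define t where "t = blinfun_apply (\<beta> - \<gamma>) x"
    have int: "s * t \<in> \<int>" for s
    proof -
      have "exp_weight (\<beta> + - \<gamma>) (s *\<^sub>R x) = 1"
        using eq by (simp only: exp_weight_add exp_weight_minus) simp
      then show ?thesis
        by (simp add: exp_weight_def cis_2pi_eq_1_iff blinfun.scaleR_right t_def)
    qed
    have "t = 0"
    proof (rule ccontr)
      assume "t \<noteq> 0"
      then have "1 / 2 \<in> (\<int> :: real set)" using int[of "1 / (2 * t)"] by simp
      then obtain k :: int where "1 / 2 = real_of_int k" by (auto elim: Ints_cases)
      then have "real_of_int (2 * k) = real_of_int 1" by simp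
      then have "2 * k = 1" by (simp only: of_int_eq_iff)
      then show False by presburger
    qed
    then show "blinfun_apply \<beta> x = blinfun_apply \<gamma> x" by (simp add: t_def blinfun.diff_left)
  qed
qed auto

section \<open>Density, independence of homomorphisms, maps into the circle\<close>

text \<open>Riesz representation, bringing functionals into the form required by
  \<open>negligible_hyperplane\<close>.\<close>

lemma blinfun_eq_inner: "\<exists>a. \<forall>x. blinfun_apply \<beta> x = a \<bullet> x"
  for \<beta> :: "'a::euclidean_space \<Rightarrow>\<^sub>L real"
proof
  show "\<forall>x. blinfun_apply \<beta> x = (\<Sum>b\<in>Basis. blinfun_apply \<beta> b *\<^sub>R b) \<bullet> x"
  proof
    fix x
    have "blinfun_apply \<beta> x = blinfun_apply \<beta> (\<Sum>b\<in>Basis. (x \<bullet> b) *\<^sub>R b)"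
      by (simp only: euclidean_representation)
    also have "\<dots> = (\<Sum>b\<in>Basis. blinfun_apply \<beta> b *\<^sub>R b) \<bullet> x"
      unfolding inner_sum_left blinfun.sum_right
      by (intro sum.cong refl) (simp add: blinfun.scaleR_right inner_commute)
    finally show "blinfun_apply \<beta> x = (\<Sum>b\<in>Basis. blinfun_apply \<beta> b *\<^sub>R b) \<bullet> x" .
  qed
qed

text \<open>A countable union of hyperplanes is a Lebesgue null set and so contains no nonempty open
  set.\<close>

lemma closure_avoiding_hyperplanes:
  fixes \<gamma> :: "'i \<Rightarrow> 'a::euclidean_space \<Rightarrow>\<^sub>L real"
  assumes "finite I" "\<And>i. i \<in> I \<Longrightarrow> \<gamma> i \<noteq> 0" "\<And>i. i \<in> I \<Longrightarrow> countable (L i)"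
  shows "closure {x. \<forall>i\<in>I. blinfun_apply (\<gamma> i) x \<notin> L i} = UNIV"
proof -
  define B where "B = (\<Union>i\<in>I. \<Union>l\<in>L i. {x. blinfun_apply (\<gamma> i) x = l})"
  have "negligible {x. blinfun_apply (\<gamma> i) x = l}" if i: "i \<in> I" for i l
  proof -
    obtain a where a: "\<And>x. blinfun_apply (\<gamma> i) x = a \<bullet> x" using blinfun_eq_inner by blast
    have "a \<noteq> 0" using a assms(2)[OF i] by (auto intro: blinfun_eqI)
    then show ?thesis by (simp add: a negligible_hyperplane)
  qed
  then have "negligible (\<Union>l\<in>L i. {x. blinfun_apply (\<gamma> i) x = l})" if "i \<in> I" for i
    using that assms(3) by (intro negligible_countable_Union) auto
  then have "negligible B"
    unfolding B_def using assms(1) by (intro negligible_Union) auto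
  then have "interior B = {}"
    by (meson interior_subset negligible_subset open_interior open_not_negligible)
  moreover have "{x. \<forall>i\<in>I. blinfun_apply (\<gamma> i) x \<notin> L i} = - B" by (auto simp: B_def)
  ultimately show ?thesis by (simp add: closure_complement)
qed

text \<open>Carries identities from generic points to an open set such as the complement of the
  zeros of the denominators: the open set where f and g differ would meet X.\<close>

lemma eq_on_open_from_dense:
  fixes f g :: "'a::topological_space \<Rightarrow> 'b::real_normed_vector"
  assumes U: "open U" and X: "closure X = UNIV"
    and cont: "continuous_on U f" "continuous_on U g"
    and eq: "\<And>x. x \<in> U \<Longrightarrow> x \<in> X \<Longrightarrow> f x = g x"
    and x: "x \<in> U"
  shows "f x = g x"
proof (rule ccontr)
  assume "f x \<noteq> g x"
  define W where "W = U \<inter> (\<lambda>x. f x - g x) -` (- {0})"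
  have "open W"
    unfolding W_def by (rule continuous_open_preimage[OF continuous_on_diff[OF cont] U]) auto
  moreover have "x \<in> W" using x \<open>f x \<noteq> g x\<close> by (simp add: W_def)
  ultimately have "W \<inter> closure X \<noteq> {}" unfolding X by blast
  then have "W \<inter> X \<noteq> {}"
    using open_Int_closure_eq_empty[OF \<open>open W\<close>, of X] by blast
  then obtain y where "y \<in> W" "y \<in> X" by blast
  then show False using eq[of y] by (simp add: W_def)
qed

text \<open>Dedekind's argument: subtracting \<open>h j y\<close> times the relation at x from the
  relation at x + y removes the term j and leaves a shorter relation with coefficients
  \<open>m i * (h i y - h j y)\<close>.\<close>

lemma distinct_hom_independent:
  fixes h :: "'i \<Rightarrow> 'a::real_vector \<Rightarrow> complex"
  assumes fin: "finite S"
    and hom: "\<And>i x y. i \<in> S \<Longrightarrow> h i (x + y) = h i x * h i y"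
    and n0: "\<And>i x. i \<in> S \<Longrightarrow> h i x \<noteq> 0"
    and dist: "\<And>i j. \<lbrakk>i \<in> S; j \<in> S; i \<noteq> j\<rbrakk> \<Longrightarrow> \<exists>x. h i x \<noteq> h j x"
    and zero: "\<And>x. (\<Sum>i\<in>S. m i * h i x) = 0"
  shows "\<forall>i\<in>S. m i = 0"
  using assms
proof (induction S arbitrary: m rule: finite_induct)
  case (insert j S)
  have "\<forall>i\<in>S. m i * (h i y - h j y) = 0" for y
  proof (rule insert.IH)
    fix x
    have "(\<Sum>i\<in>S. m i * (h i y - h j y) * h i x) =
      (\<Sum>i\<in>insert j S. m i * (h i y - h j y) * h i x)"
      using insert.hyps by simp
    also have "\<dots> = (\<Sum>i\<in>insert j S. m i * h i (x + y)) - h j y * (\<Sum>i\<in>insert j S. m i * h i x)"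
      using insert.prems(1) unfolding sum_distrib_left sum_subtractf[symmetric]
      by (intro sum.cong refl) (simp add: algebra_simps)
    also have "\<dots> = 0" by (simp only: insert.prems(4)) simp
    finally show "(\<Sum>i\<in>S. m i * (h i y - h j y) * h i x) = 0" .
  qed (use insert.prems in auto)
  then have S: "m i = 0" if "i \<in> S" for i
    using insert.prems(3)[of i j] that insert.hyps by fastforce
  then have "m j * h j 0 = 0"
    using insert.prems(4)[of 0] insert.hyps by simp
  then show ?case using S insert.prems(2) by auto
qed auto

text \<open>Cauchy's functional equation: linear on the rationals by additivity, then everywhere by
  density.\<close>

lemma continuous_additive_real:
  fixes v :: "real \<Rightarrow> real"
  assumes add: "\<And>s t. v (s + t) = v s + v t" and cont: "continuous_on UNIV v"
  shows "v s = s * v 1"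
proof -
  interpret additive v by standard (rule add)
  have nat: "v (of_nat n * t) = of_nat n * v t" for n t
    by (induction n) (simp_all add: distrib_right add zero)
  have int: "v (of_int n * t) = of_int n * v t" for n t
  proof (cases "n \<ge> 0")
    case True
    then show ?thesis using nat[of "nat n" t] by simp
  next
    case False
    then have "of_int n * t = - (of_nat (nat (- n)) * t)" by simp
    then have "v (of_int n * t) = - (of_nat (nat (- n)) * v t)" by (simp only: minus nat)
    then show ?thesis using False by simp
  qed
  have rat: "v q = q * v 1" if "q \<in> \<rat>" for q
  proof -
    obtain a b :: int where ab: "b > 0" "q = of_int a / of_int b"
      using \<open>q \<in> \<rat>\<close> by (metis Rats_cases')
    have "of_int b * v q = v (of_int b * q)" by (simp only: int)
    also have "\<dots> = v (of_int a * 1)" using ab by simp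
    also have "\<dots> = of_int a * v 1" by (simp only: int)
    also have "\<dots> = of_int b * (q * v 1)" using ab by simp
    finally show ?thesis using ab(1) by simp
  qed
  show ?thesis
    by (rule eq_on_open_from_dense[where U = UNIV and X = \<rat> and f = v and g = "\<lambda>s. s * v 1" and x = s])
       (use Rats_closure_real in \<open>auto intro!: cont continuous_intros intro: rat\<close>)
qed

text \<open>A continuous argument v of u is additive up to an error in the integral multiples of 2
  pi. The error is continuous on the connected plane, hence a constant c; then v + c is additive and
  still an argument of u.\<close>

lemma continuous_hom_circle:
  fixes u :: "real \<Rightarrow> complex"
  assumes cont: "continuous_on UNIV u" and mult: "\<And>s t. u (s + t) = u s * u t"
    and norm: "\<And>s. norm (u s) = 1"
  shows "\<exists>b. \<forall>s. u s = cis (s * b)"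
proof -
  have "u s \<noteq> 0" for s using norm[of s] by auto
  then obtain g where g: "continuous_on UNIV g" "\<And>s. u s = exp (g s)"
    using continuous_logarithm_on_contractible[OF cont convex_imp_contractible[OF convex_UNIV]]
    by (metis UNIV_I)
  define v where "v s = Im (g s)" for s
  have contv: "continuous_on UNIV v" unfolding v_def by (intro continuous_intros g)
  have u: "u s = cis (v s)" for s
  proof -
    have "exp (Re (g s)) = 1" using norm[of s] unfolding g(2) norm_exp_eq_Re .
    then show ?thesis unfolding g(2) exp_eq_polar v_def by simp
  qed
  define w where "w = (\<lambda>p::real \<times> real. (v (fst p + snd p) - v (fst p) - v (snd p)) / (2 * pi))"
  have w: "w p \<in> \<int>" for p
  proof -
    have "cis (v (fst p + snd p)) = cis (v (fst p)) * cis (v (snd p))"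
      using mult u by metis
    then have "cis (v (fst p + snd p) - v (fst p) - v (snd p)) = 1"
      by (simp flip: cis_divide)
    then have "cis (2 * pi * w p) = 1" by (simp add: w_def)
    then show ?thesis by (simp only: cis_2pi_eq_1_iff)
  qed
  have "w constant_on UNIV"
  proof (rule continuous_discrete_range_constant)
    show "connected (UNIV :: (real \<times> real) set)" by (rule connected_UNIV)
    show "continuous_on UNIV w"
      unfolding w_def by (intro continuous_intros continuous_on_compose2[OF contv]) auto
    fix x
    have "1 \<le> norm (w y - w x)" if "w y \<noteq> w x" for y
    proof -
      obtain a b :: int where "w y = of_int a" "w x = of_int b" using w by (metis Ints_cases)
      with that show ?thesis by (simp flip: of_int_diff)
    qed
    then show "\<exists>e>0. \<forall>y. y \<in> UNIV \<and> w y \<noteq> w x \<longrightarrow> e \<le> norm (w y - w x)"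
      by (intro exI[of _ 1]) auto
  qed
  then obtain n where n: "\<And>p. w p = n" by (auto simp: constant_on_def)
  define c where "c = 2 * pi * n"
  have vc: "v (s + t) = v s + v t + c" for s t
    using n[of "(s, t)"] by (simp add: w_def c_def field_simps)
  have "n \<in> \<int>" using w[of 0] n by simp
  then have "cis c = 1" by (simp add: c_def cis_2pi_eq_1_iff)
  then have u': "u s = cis (v s + c)" for s by (simp add: u flip: cis_mult)
  have "v s + c = s * (v 1 + c)" for s
    by (rule continuous_additive_real[of "\<lambda>s. v s + c"])
       (auto simp: vc intro!: continuous_intros contv)
  then show ?thesis using u' by metis
qed

section \<open>Weight spans and the quotient by a circle\<close>

text \<open>Serves uniqueness in the definite descriptions: a continuous function is determined by
  its values on a dense set.\<close>

lemma rep_ring_continuous: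
  assumes f: "f \<in> rep_ring H X" and X: "topspace X = carrier H"
  shows "continuous_map X euclidean f"
proof -
  obtain S m where S: "finite S" "S \<subseteq> characters H X"
    and f: "f = (\<lambda>h\<in>carrier H. \<Sum>\<psi>\<in>S. of_int (m \<psi>) * \<psi> h)"
    using f by (auto simp: rep_ring_def)
  have "continuous_map X euclidean (\<lambda>h. \<Sum>\<psi>\<in>S. of_int (m \<psi>) * \<psi> h)"
  proof (intro continuous_map_sum S(1))
    fix \<psi> assume "\<psi> \<in> S"
    then have "continuous_map X euclidean \<psi>" using S(2) by (auto simp: characters_def)
    moreover have "continuous_map euclidean euclidean (\<lambda>z :: complex. of_int (m \<psi>) * z)"
      by (simp add: continuous_intros)
    ultimately show "continuous_map X euclidean (\<lambda>h. of_int (m \<psi>) * \<psi> h)"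
      by (rule continuous_map_compose[unfolded o_def])
  qed
  then show ?thesis
    by (rule continuous_map_eq) (simp add: f X)
qed

lemma rep_ring_extensional: "f \<in> rep_ring H X \<Longrightarrow> f \<in> extensional (carrier H)"
  by (auto simp: rep_ring_def)

text \<open>\<open>rep_ring\<close> attaches multiplicities to characters, so an indexing by weights
  has to be injective for them to be transported.\<close>

lemma rep_ringI:
  assumes "finite S" "inj_on c S" "\<And>\<beta>. \<beta> \<in> S \<Longrightarrow> c \<beta> \<in> characters H X"
  shows "(\<lambda>h\<in>carrier H. \<Sum>\<beta>\<in>S. of_int (m \<beta>) * c \<beta> h) \<in> rep_ring H X"
proof -
  have "(\<Sum>\<beta>\<in>S. of_int (m \<beta>) * c \<beta> h) =
     (\<Sum>\<psi>\<in>c ` S. of_int (m (the_inv_into S c \<psi>)) * \<psi> h)" for h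
    using assms(2) by (simp add: sum.reindex the_inv_into_f_f)
  then show ?thesis
    unfolding rep_ring_def using assms(1,3)
    by (intro CollectI exI[of _ "c ` S"] exI[of _ "\<lambda>\<psi>. m (the_inv_into S c \<psi>)"]) auto
qed

text \<open>The definition of \<open>weight_char\<close> evaluates at a chosen logarithm, which
  hides continuity. As a Laurent monomial, with the integral values on the standard basis as
  exponents, it is visibly continuous.\<close>

lemma weight_char_eq_prod:
  assumes "\<beta> \<in> weight_lattice" "g \<in> carrier torus"
  shows "weight_char \<beta> g = (\<Prod>i\<in>UNIV. vec_nth g i powi \<lfloor>blinfun_apply \<beta> (axis i 1)\<rfloor>)"
proof -
  obtain x where g: "g = torus_exp x" using torus_exp_surj[OF assms(2)] by blast
  have b: "of_int \<lfloor>blinfun_apply \<beta> (axis i 1)\<rfloor> = blinfun_apply \<beta> (axis i 1)" for i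
  proof -
    have "axis i 1 \<in> (group_lattice :: (real ^ 'a) set)" by (simp add: group_lattice_iff axis_def)
    from weight_latticeD[OF assms(1) this] show ?thesis by (auto elim: Ints_cases)
  qed
  have "blinfun_apply \<beta> x = blinfun_apply \<beta> (\<Sum>i\<in>UNIV. vec_nth x i *s axis i 1)"
    by (simp only: basis_expansion)
  also have "\<dots> = (\<Sum>i\<in>UNIV. vec_nth x i * blinfun_apply \<beta> (axis i 1))"
    by (simp add: blinfun.sum_right scalar_mult_eq_scaleR blinfun.scaleR_right)
  finally have "exp_weight \<beta> x = (\<Prod>i\<in>UNIV. cis (2 * pi * (vec_nth x i * blinfun_apply \<beta> (axis i 1))))"
    by (simp add: exp_weight_def cis_conv_exp sum_distrib_left exp_sum flip: of_real_mult)
  also have "\<dots> = (\<Prod>i\<in>UNIV. vec_nth g i powi \<lfloor>blinfun_apply \<beta> (axis i 1)\<rfloor>)"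
    by (intro prod.cong refl) (simp add: g cis_power_int b mult_ac)
  finally show ?thesis using assms by (simp add: g weight_char_torus_exp)
qed

lemma weight_char_in_characters:
  assumes "\<beta> \<in> weight_lattice"
  shows "weight_char \<beta> \<in> characters torus torus_topology"
proof -
  have "weight_char \<beta> \<in> hom torus circle_group"
  proof (rule homI)
    fix g h assume gh: "g \<in> carrier (torus :: (complex ^ 'a) monoid)" "h \<in> carrier (torus :: (complex ^ 'a) monoid)"
    obtain x y where "g = torus_exp x" "h = torus_exp y" using torus_exp_surj gh by metis
    then show "weight_char \<beta> (g \<otimes>\<^bsub>torus\<^esub> h) = weight_char \<beta> g \<otimes>\<^bsub>circle_group\<^esub> weight_char \<beta> h"
      using assms by (simp add: weight_char_torus_exp exp_weight_add_right flip: torus_exp_add)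
  next
    fix g assume "g \<in> carrier (torus :: (complex ^ 'a) monoid)"
    then obtain x where "g = torus_exp x" using torus_exp_surj by blast
    then show "weight_char \<beta> g \<in> carrier circle_group"
      using assms by (simp add: weight_char_torus_exp)
  qed
  moreover have "weight_char \<beta> \<in> extensional (carrier torus)" by (simp add: weight_char_def)
  moreover have "continuous_on (carrier torus) (weight_char \<beta>)"
  proof -
    have "vec_nth g i \<noteq> 0" if "g \<in> carrier torus" for g :: "complex ^ 'a" and i
    proof -
      have "norm (vec_nth g i) = 1" using that by (simp add: torus_def)
      then show ?thesis by auto
    qed
    then have "continuous_on (carrier torus) (\<lambda>g :: complex ^ 'a. \<Prod>i\<in>UNIV. vec_nth g i powi \<lfloor>blinfun_apply \<beta> (axis i 1)\<rfloor>)"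
      by (intro continuous_intros) blast
    then show ?thesis
      by (rule continuous_on_eq) (simp add: weight_char_eq_prod[OF assms])
  qed
  ultimately show ?thesis by (simp add: characters_def)
qed

lemma inj_on_weight_char: "inj_on weight_char weight_lattice"
proof (rule inj_onI)
  fix \<beta> \<gamma> :: "(real ^ 'n) \<Rightarrow>\<^sub>L real"
  assume "\<beta> \<in> weight_lattice" "\<gamma> \<in> weight_lattice" "weight_char \<beta> = weight_char \<gamma>"
  then have "\<forall>x. exp_weight \<beta> x = exp_weight \<gamma> x" by (metis weight_char_torus_exp)
  then show "\<beta> = \<gamma>" by (simp only: exp_weight_eq_iff)
qed

section \<open>Integral combinations of exponentials\<close>

definition weight_span :: "((real ^ 'n) \<Rightarrow>\<^sub>L real) set \<Rightarrow> (real ^ 'n \<Rightarrow> complex) set" where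
  "weight_span W = {F. \<exists>S. \<exists>m :: _ \<Rightarrow> int. finite S \<and> S \<subseteq> W \<and>
     F = (\<lambda>x. \<Sum>\<beta>\<in>S. of_int (m \<beta>) * exp_weight \<beta> x)}"

lemma weight_spanI:
  "\<lbrakk>finite S; S \<subseteq> W; \<And>x. F x = (\<Sum>\<beta>\<in>S. of_int (m \<beta>) * exp_weight \<beta> x)\<rbrakk> \<Longrightarrow> F \<in> weight_span W"
  unfolding weight_span_def by blast

lemma weight_spanE:
  assumes "F \<in> weight_span W"
  obtains S and m :: "_ \<Rightarrow> int" where "finite S" "S \<subseteq> W"
    "F = (\<lambda>x. \<Sum>\<beta>\<in>S. of_int (m \<beta>) * exp_weight \<beta> x)"
  using assms unfolding weight_span_def by blast

lemma weight_span_0: "(\<lambda>_. 0) \<in> weight_span W"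
  by (rule weight_spanI[of "{}"]) auto

lemma weight_span_single: "\<beta> \<in> W \<Longrightarrow> (\<lambda>x. of_int k * exp_weight \<beta> x) \<in> weight_span W"
  by (rule weight_spanI[of "{\<beta>}" _ _ "\<lambda>_. k"]) auto

lemma weight_span_add:
  assumes "F \<in> weight_span W" "G \<in> weight_span W"
  shows "(\<lambda>x. F x + G x) \<in> weight_span W"
proof -
  obtain S and m :: "_ \<Rightarrow> int" where S: "finite S" "S \<subseteq> W"
    "F = (\<lambda>x. \<Sum>\<beta>\<in>S. of_int (m \<beta>) * exp_weight \<beta> x)" using assms(1) by (rule weight_spanE)
  obtain S' and m' :: "_ \<Rightarrow> int" where S': "finite S'" "S' \<subseteq> W"
    "G = (\<lambda>x. \<Sum>\<beta>\<in>S'. of_int (m' \<beta>) * exp_weight \<beta> x)" using assms(2) by (rule weight_spanE)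
  define k where "k \<beta> = (if \<beta> \<in> S then m \<beta> else 0) + (if \<beta> \<in> S' then m' \<beta> else 0)" for \<beta>
  have "F x + G x = (\<Sum>\<beta>\<in>S \<union> S'. of_int (k \<beta>) * exp_weight \<beta> x)" for x
  proof -
    have "F x = (\<Sum>\<beta>\<in>S \<union> S'. of_int (if \<beta> \<in> S then m \<beta> else 0) * exp_weight \<beta> x)"
      unfolding S(3) using S(1) S'(1) by (intro sum.mono_neutral_cong_left) auto
    moreover have "G x = (\<Sum>\<beta>\<in>S \<union> S'. of_int (if \<beta> \<in> S' then m' \<beta> else 0) * exp_weight \<beta> x)"
      unfolding S'(3) using S(1) S'(1) by (intro sum.mono_neutral_cong_left) auto
    ultimately show ?thesis by (simp only: k_def of_int_add distrib_right sum.distrib)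
  qed
  then show ?thesis using S S' by (intro weight_spanI[of "S \<union> S'" _ _ k]) auto
qed

lemma weight_span_sum:
  assumes "\<And>i. i \<in> I \<Longrightarrow> F i \<in> weight_span W"
  shows "(\<lambda>x. \<Sum>i\<in>I. F i x) \<in> weight_span W"
  using assms
proof (induction I rule: infinite_finite_induct)
  case (insert i I)
  then have "(\<lambda>x. F i x + (\<Sum>i\<in>I. F i x)) \<in> weight_span W"
    by (intro weight_span_add) auto
  then show ?case using insert.hyps by simp
qed (auto intro: weight_span_0)

lemma weight_span_mult:
  assumes "F \<in> weight_span W" "G \<in> weight_span W'"
    and "\<And>\<beta> \<gamma>. \<lbrakk>\<beta> \<in> W; \<gamma> \<in> W'\<rbrakk> \<Longrightarrow> \<beta> + \<gamma> \<in> W''"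
  shows "(\<lambda>x. F x * G x) \<in> weight_span W''"
proof -
  obtain S and m :: "_ \<Rightarrow> int" where S: "finite S" "S \<subseteq> W"
    "F = (\<lambda>x. \<Sum>\<beta>\<in>S. of_int (m \<beta>) * exp_weight \<beta> x)" using assms(1) by (rule weight_spanE)
  obtain S' and m' :: "_ \<Rightarrow> int" where S': "finite S'" "S' \<subseteq> W'"
    "G = (\<lambda>x. \<Sum>\<beta>\<in>S'. of_int (m' \<beta>) * exp_weight \<beta> x)" using assms(2) by (rule weight_spanE)
  have "(\<lambda>x. F x * G x) =
      (\<lambda>x. \<Sum>\<beta>\<in>S. \<Sum>\<gamma>\<in>S'. of_int (m \<beta> * m' \<gamma>) * exp_weight (\<beta> + \<gamma>) x)"
    unfolding S(3) S'(3) sum_product by (simp add: exp_weight_add mult_ac)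
  also have "\<dots> \<in> weight_span W''"
    using S(2) S'(2) assms(3) by (intro weight_span_sum weight_span_single) auto
  finally show ?thesis .
qed

lemma weight_span_mono: "\<lbrakk>F \<in> weight_span W; W \<subseteq> W'\<rbrakk> \<Longrightarrow> F \<in> weight_span W'"
  unfolding weight_span_def by blast

lemma rep_ring_of_weight_span:
  assumes "F \<in> weight_span weight_lattice"
  shows "\<exists>h\<in>rep_ring torus torus_topology. \<forall>x. h (torus_exp x) = F x"
proof -
  obtain S and m :: "_ \<Rightarrow> int" where S: "finite S" "S \<subseteq> weight_lattice"
    "F = (\<lambda>x. \<Sum>\<beta>\<in>S. of_int (m \<beta>) * exp_weight \<beta> x)" using assms(1) by (rule weight_spanE)
  show ?thesis
  proof (intro bexI)
    show "(\<lambda>g\<in>carrier torus. \<Sum>\<beta>\<in>S. of_int (m \<beta>) * weight_char \<beta> g) \<in> rep_ring torus torus_topology"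
      using S inj_on_subset[OF inj_on_weight_char S(2)] weight_char_in_characters
      by (intro rep_ringI) auto
  next
    show "\<forall>x. (\<lambda>g\<in>carrier torus. \<Sum>\<beta>\<in>S. of_int (m \<beta>) * weight_char \<beta> g) (torus_exp x) = F x"
      using S by (auto intro!: sum.cong simp: weight_char_torus_exp)
  qed
qed

text \<open>Gives the uniqueness of multiplicities that the definite description in
  \<open>multiplicity_of\<close> requires.\<close>

lemma exp_weight_independent:
  assumes fin: "finite {\<beta>. m \<beta> \<noteq> 0}" "finite {\<beta>. m' \<beta> \<noteq> (0 :: int)}"
    and eq: "\<And>x. (\<Sum>\<beta> | m \<beta> \<noteq> (0 :: int). of_int (m \<beta>) * exp_weight \<beta> x) =
        (\<Sum>\<beta> | m' \<beta> \<noteq> 0. of_int (m' \<beta>) * exp_weight \<beta> x)"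
  shows "m = m'"
proof -
  define S where "S = {\<beta>. m \<beta> \<noteq> 0} \<union> {\<beta>. m' \<beta> \<noteq> 0}"
  have S: "finite S" using fin by (simp add: S_def)
  have "\<forall>\<beta>\<in>S. complex_of_int (m \<beta> - m' \<beta>) = 0"
  proof (rule distinct_hom_independent[OF S])
    fix x
    have "(\<Sum>\<beta> | m \<beta> \<noteq> 0. of_int (m \<beta>) * exp_weight \<beta> x) = (\<Sum>\<beta>\<in>S. of_int (m \<beta>) * exp_weight \<beta> x)"
      "(\<Sum>\<beta> | m' \<beta> \<noteq> 0. of_int (m' \<beta>) * exp_weight \<beta> x) = (\<Sum>\<beta>\<in>S. of_int (m' \<beta>) * exp_weight \<beta> x)"
      using S by (auto intro!: sum.mono_neutral_left simp: S_def)
    with eq[of x] show "(\<Sum>\<beta>\<in>S. of_int (m \<beta> - m' \<beta>) * exp_weight \<beta> x) = 0"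
      by (simp add: left_diff_distrib sum_subtractf)
  qed (auto simp: exp_weight_add_right simp flip: exp_weight_eq_iff)
  then have "m \<beta> = m' \<beta>" if "\<beta> \<in> S" for \<beta>
    using that by (simp only: of_int_eq_0_iff) simp
  moreover have "m \<beta> = m' \<beta>" if "\<beta> \<notin> S" for \<beta>
    using that by (simp add: S_def)
  ultimately show ?thesis by (intro ext) blast
qed

section \<open>Cosets of the circle and characters of the quotient\<close>

text \<open>The form in which the circle is used: the image of the one-parameter group of \<xi>,
  with period lattice exactly the integers, so that a coset of T is the image of a line x + s
  \<xi>.\<close>

locale torus_circle =
  fixes T :: "(complex ^ 'n) set" and \<xi> :: "real ^ 'n"
  assumes subgroup_T: "subgroup T torus"
    and T_eq: "T = range (\<lambda>s. torus_exp (s *\<^sub>R \<xi>))"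
    and torus_exp_xi: "torus_exp (s *\<^sub>R \<xi>) = \<one>\<^bsub>torus\<^esub> \<longleftrightarrow> s \<in> \<int>"
begin

lemma normal_T: "T \<lhd> torus"
  using subgroup_T by (simp add: torus.normal_iff_subgroup)

text \<open>The floor only changes the type: on the weight lattice the value at \<xi> is an
  integer.\<close>

definition xi_degree :: "((real ^ 'n) \<Rightarrow>\<^sub>L real) \<Rightarrow> int" where
  "xi_degree \<beta> = \<lfloor>blinfun_apply \<beta> \<xi>\<rfloor>"

lemma xi_in_group_lattice: "\<xi> \<in> group_lattice"
  using torus_exp_xi[of 1] by (simp add: group_lattice_def)

lemma of_int_xi_degree: "\<beta> \<in> weight_lattice \<Longrightarrow> of_int (xi_degree \<beta>) = blinfun_apply \<beta> \<xi>"
  unfolding xi_degree_def using weight_latticeD[OF _ xi_in_group_lattice] by (auto elim: Ints_cases)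

lemma xi_degree_add:
  assumes "\<beta> \<in> weight_lattice" "\<gamma> \<in> weight_lattice"
  shows "xi_degree (\<beta> + \<gamma>) = xi_degree \<beta> + xi_degree \<gamma>"
proof -
  have "real_of_int (xi_degree (\<beta> + \<gamma>)) = of_int (xi_degree \<beta> + xi_degree \<gamma>)"
    using assms by (simp add: of_int_xi_degree weight_lattice_add blinfun.add_left)
  then show ?thesis by (simp only: of_int_eq_iff)
qed

lemma xi_degree_minus:
  assumes "\<beta> \<in> weight_lattice"
  shows "xi_degree (- \<beta>) = - xi_degree \<beta>"
proof -
  have "real_of_int (xi_degree (- \<beta>)) = of_int (- xi_degree \<beta>)"
    using assms by (simp add: of_int_xi_degree weight_lattice_minus blinfun.minus_left)
  then show ?thesis by (simp only: of_int_eq_iff)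
qed

lemma exp_weight_translate:
  assumes "\<beta> \<in> weight_lattice"
  shows "exp_weight \<beta> (x + s *\<^sub>R \<xi>) = exp_weight \<beta> x * cis (2 * pi * s) powi xi_degree \<beta>"
  using assms unfolding exp_weight_add_right cis_power_int of_int_xi_degree[OF assms]
  by (simp add: exp_weight_def blinfun.scaleR_right mult_ac)

lemma coset_eq: "T #>\<^bsub>torus\<^esub> torus_exp x = range (\<lambda>s. torus_exp (x + s *\<^sub>R \<xi>))"
  unfolding r_coset_def T_eq by (auto simp: torus_exp_add[symmetric] add.commute)

lemma carrier_torus_Mod: "carrier (torus Mod T) = range (\<lambda>x. T #>\<^bsub>torus\<^esub> torus_exp x)"
  by (auto simp: FactGroup_def RCOSETS_def carrier_torus_eq)

lemma coset_in_carrier [simp]: "T #>\<^bsub>torus\<^esub> torus_exp x \<in> carrier (torus Mod T)"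
  by (auto simp: carrier_torus_Mod)

lemma openin_quotient_topology:
  "openin (quotient_topology T) U \<longleftrightarrow> U \<subseteq> carrier (torus Mod T) \<and>
     openin torus_topology {g \<in> carrier torus. T #>\<^bsub>torus\<^esub> g \<in> U}"
proof -
  have "istopology (\<lambda>U. U \<subseteq> carrier (torus Mod T) \<and>
     openin torus_topology {g \<in> carrier torus. T #>\<^bsub>torus\<^esub> g \<in> U})"
    unfolding istopology_def
  proof (intro conjI allI impI)
    fix U V
    assume "U \<subseteq> carrier (torus Mod T) \<and> openin torus_topology {g \<in> carrier torus. T #>\<^bsub>torus\<^esub> g \<in> U}"
      and "V \<subseteq> carrier (torus Mod T) \<and> openin torus_topology {g \<in> carrier torus. T #>\<^bsub>torus\<^esub> g \<in> V}"
    moreover have "{g \<in> carrier torus. T #>\<^bsub>torus\<^esub> g \<in> U \<inter> V} =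
      {g \<in> carrier torus. T #>\<^bsub>torus\<^esub> g \<in> U} \<inter> {g \<in> carrier torus. T #>\<^bsub>torus\<^esub> g \<in> V}" by blast
    ultimately show "U \<inter> V \<subseteq> carrier (torus Mod T)"
      "openin torus_topology {g \<in> carrier torus. T #>\<^bsub>torus\<^esub> g \<in> U \<inter> V}"
      by (auto simp only: openin_Int)
  next
    fix K
    assume K: "\<forall>U\<in>K. U \<subseteq> carrier (torus Mod T) \<and>
       openin torus_topology {g \<in> carrier torus. T #>\<^bsub>torus\<^esub> g \<in> U}"
    then show "\<Union>K \<subseteq> carrier (torus Mod T)" by blast
    have "{g \<in> carrier torus. T #>\<^bsub>torus\<^esub> g \<in> \<Union>K} =
      (\<Union>U\<in>K. {g \<in> carrier torus. T #>\<^bsub>torus\<^esub> g \<in> U})" by blast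
    then show "openin torus_topology {g \<in> carrier torus. T #>\<^bsub>torus\<^esub> g \<in> \<Union>K}"
      using K by (simp only:) (intro openin_Union, blast)
  qed
  then show ?thesis by (simp add: quotient_topology_def)
qed

lemma topspace_quotient_topology: "topspace (quotient_topology T) = carrier (torus Mod T)"
proof
  have "{g \<in> carrier torus. T #>\<^bsub>torus\<^esub> g \<in> carrier (torus Mod T)} = carrier torus"
    by (auto simp: carrier_torus_eq carrier_torus_Mod)
  then have "openin (quotient_topology T) (carrier (torus Mod T))"
    unfolding openin_quotient_topology by (simp only:) simp
  then show "carrier (torus Mod T) \<subseteq> topspace (quotient_topology T)" by (rule openin_subset)
  show "topspace (quotient_topology T) \<subseteq> carrier (torus Mod T)"
    using openin_topspace[of "quotient_topology T"] unfolding openin_quotient_topology by blast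
qed

lemma continuous_map_coset:
  "continuous_map (top_of_set UNIV) (quotient_topology T) (\<lambda>x. T #>\<^bsub>torus\<^esub> torus_exp x)"
proof -
  have "continuous_map (top_of_set UNIV) torus_topology torus_exp"
    using continuous_on_torus_exp by (simp add: continuous_map_in_subtopology image_subset_iff)
  moreover have "continuous_map torus_topology (quotient_topology T) (\<lambda>g. T #>\<^bsub>torus\<^esub> g)"
    unfolding continuous_map_def topspace_quotient_topology openin_quotient_topology
    by (auto simp: carrier_torus_eq carrier_torus_Mod)
  ultimately show ?thesis by (rule continuous_map_compose[unfolded o_def])
qed

lemma rep_ring_quotient_continuous:
  assumes "h \<in> rep_ring (torus Mod T) (quotient_topology T)"
  shows "continuous_on UNIV (\<lambda>x. h (T #>\<^bsub>torus\<^esub> torus_exp x))"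
proof -
  have "continuous_map (quotient_topology T) euclidean h"
    using assms by (rule rep_ring_continuous) (rule topspace_quotient_topology)
  from continuous_map_compose[OF continuous_map_coset this] show ?thesis
    by (simp add: o_def)
qed

lemma exp_weight_const_on_coset:
  assumes "\<beta> \<in> weight_lattice" "blinfun_apply \<beta> \<xi> = 0"
  shows "exp_weight \<beta> (x + s *\<^sub>R \<xi>) = exp_weight \<beta> x"
  using assms by (simp add: exp_weight_def blinfun.add_right blinfun.scaleR_right)

text \<open>For a lattice weight that vanishes on \<xi> the chosen representative does not
  matter.\<close>

definition quotient_char :: "((real ^ 'n) \<Rightarrow>\<^sub>L real) \<Rightarrow> (complex ^ 'n) set \<Rightarrow> complex" where
  "quotient_char \<beta> = (\<lambda>C\<in>carrier (torus Mod T). weight_char \<beta> (SOME g. g \<in> C))"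

lemma quotient_char_coset:
  assumes "\<beta> \<in> weight_lattice" "blinfun_apply \<beta> \<xi> = 0"
  shows "quotient_char \<beta> (T #>\<^bsub>torus\<^esub> torus_exp x) = exp_weight \<beta> x"
proof -
  have "(SOME g. g \<in> T #>\<^bsub>torus\<^esub> torus_exp x) \<in> T #>\<^bsub>torus\<^esub> torus_exp x"
    by (rule someI_ex) (auto simp: coset_eq)
  then obtain s where s: "(SOME g. g \<in> T #>\<^bsub>torus\<^esub> torus_exp x) = torus_exp (x + s *\<^sub>R \<xi>)"
    using coset_eq by blast
  then show ?thesis
    using assms by (simp add: quotient_char_def weight_char_torus_exp exp_weight_const_on_coset)
qed

lemma quotient_char_in_characters:
  assumes "\<beta> \<in> weight_lattice" "blinfun_apply \<beta> \<xi> = 0"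
  shows "quotient_char \<beta> \<in> characters (torus Mod T) (quotient_topology T)"
proof -
  have "quotient_char \<beta> \<in> hom (torus Mod T) circle_group"
  proof (rule homI)
    fix C D assume "C \<in> carrier (torus Mod T)" "D \<in> carrier (torus Mod T)"
    then obtain x y where CD: "C = T #>\<^bsub>torus\<^esub> torus_exp x" "D = T #>\<^bsub>torus\<^esub> torus_exp y"
      by (auto simp: carrier_torus_Mod)
    have "C \<otimes>\<^bsub>torus Mod T\<^esub> D = T #>\<^bsub>torus\<^esub> torus_exp (x + y)"
      using normal.rcos_sum[OF normal_T] by (simp add: CD torus_exp_add FactGroup_def)
    then show "quotient_char \<beta> (C \<otimes>\<^bsub>torus Mod T\<^esub> D) =
        quotient_char \<beta> C \<otimes>\<^bsub>circle_group\<^esub> quotient_char \<beta> D"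
      using assms by (simp add: CD quotient_char_coset exp_weight_add_right)
  qed (use assms in \<open>auto simp: carrier_torus_Mod quotient_char_coset\<close>)
  moreover have "quotient_char \<beta> \<in> extensional (carrier (torus Mod T))"
    by (simp add: quotient_char_def)
  moreover have "continuous_map (quotient_topology T) euclidean (quotient_char \<beta>)"
    unfolding continuous_map_def topspace_quotient_topology
  proof (intro conjI allI impI)
    fix U :: "complex set" assume "openin euclidean U"
    \<comment> \<open>Openness in the quotient is openness of the preimage in the torus, where the
      character becomes \<open>weight_char \<beta>\<close>.\<close>
    moreover have "{g \<in> carrier torus. T #>\<^bsub>torus\<^esub> g \<in> {C \<in> carrier (torus Mod T). quotient_char \<beta> C \<in> U}} =
      {g \<in> topspace torus_topology. weight_char \<beta> g \<in> U}"
      using assms by (auto simp: carrier_torus_eq quotient_char_coset weight_char_torus_exp)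
    ultimately show "openin (quotient_topology T) {C \<in> carrier (torus Mod T). quotient_char \<beta> C \<in> U}"
      unfolding openin_quotient_topology
      using weight_char_in_characters[OF assms(1)] 
      by (auto simp: characters_def continuous_map_def simp del: continuous_map_iff_continuous
           topspace_euclidean_subtopology)
  qed auto
  ultimately show ?thesis by (simp add: characters_def)
qed

lemma inj_on_quotient_char: "inj_on quotient_char {\<beta> \<in> weight_lattice. blinfun_apply \<beta> \<xi> = 0}"
proof (rule inj_onI)
  fix \<beta> \<gamma> :: "(real ^ 'n) \<Rightarrow>\<^sub>L real"
  assume "\<beta> \<in> {\<beta> \<in> weight_lattice. blinfun_apply \<beta> \<xi> = 0}" "\<gamma> \<in> {\<beta> \<in> weight_lattice. blinfun_apply \<beta> \<xi> = 0}"
    "quotient_char \<beta> = quotient_char \<gamma>"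
  then have "\<forall>x. exp_weight \<beta> x = exp_weight \<gamma> x"
    using quotient_char_coset by (metis (mono_tags, lifting) mem_Collect_eq)
  then show "\<beta> = \<gamma>" by (simp only: exp_weight_eq_iff)
qed

text \<open>F and F' involve disjoint sets of weights, so their multiplicities combine into one
  function k without interference, and independence of the exponentials identifies k with
  \<open>multiplicity_of h\<close>.\<close>

lemma invariant_part_split:
  assumes h: "h \<in> extensional (carrier torus)" "\<And>x. h (torus_exp x) = F x + F' x"
    and F: "F \<in> weight_span {\<beta> \<in> weight_lattice. blinfun_apply \<beta> \<xi> = 0}"
    and F': "F' \<in> weight_span {\<beta> \<in> weight_lattice. blinfun_apply \<beta> \<xi> \<noteq> 0}"
  shows "invariant_part T \<xi> h \<in> rep_ring (torus Mod T) (quotient_topology T)"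
    and "invariant_part T \<xi> h (T #>\<^bsub>torus\<^esub> torus_exp x) = F x"
proof -
  obtain S and m :: "_ \<Rightarrow> int" where S: "finite S" "S \<subseteq> {\<beta> \<in> weight_lattice. blinfun_apply \<beta> \<xi> = 0}"
    "F = (\<lambda>x. \<Sum>\<beta>\<in>S. of_int (m \<beta>) * exp_weight \<beta> x)" using F by (rule weight_spanE)
  obtain S' and m' :: "_ \<Rightarrow> int" where S': "finite S'" "S' \<subseteq> {\<beta> \<in> weight_lattice. blinfun_apply \<beta> \<xi> \<noteq> 0}"
    "F' = (\<lambda>x. \<Sum>\<beta>\<in>S'. of_int (m' \<beta>) * exp_weight \<beta> x)" using F' by (rule weight_spanE)
  define k where "k \<beta> = (if \<beta> \<in> S then m \<beta> else if \<beta> \<in> S' then m' \<beta> else 0)" for \<beta>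
  have disj: "S \<inter> S' = {}" using S(2) S'(2) by auto
  have supp: "{\<beta>. k \<beta> \<noteq> 0} \<subseteq> S \<union> S'" by (auto simp: k_def)
  have fin: "finite {\<beta>. k \<beta> \<noteq> 0}" using supp S(1) S'(1) by (auto intro: finite_subset)
  have F_eq: "F x = (\<Sum>\<beta>\<in>S. of_int (k \<beta>) * exp_weight \<beta> x)" for x
    unfolding S(3) by (intro sum.cong) (auto simp: k_def)
  have F'_eq: "F' x = (\<Sum>\<beta>\<in>S'. of_int (k \<beta>) * exp_weight \<beta> x)" for x
    unfolding S'(3) using disj by (intro sum.cong) (auto simp: k_def)
  have sum_k: "(\<Sum>\<beta> | k \<beta> \<noteq> 0. of_int (k \<beta>) * exp_weight \<beta> x) = F x + F' x" for x
  proof -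
    have "(\<Sum>\<beta> | k \<beta> \<noteq> 0. of_int (k \<beta>) * exp_weight \<beta> x) = (\<Sum>\<beta>\<in>S \<union> S'. of_int (k \<beta>) * exp_weight \<beta> x)"
      using supp S(1) S'(1) by (intro sum.mono_neutral_left) auto
    then show ?thesis using S(1) S'(1) disj by (simp add: sum.union_disjoint F_eq F'_eq)
  qed
  let ?P = "\<lambda>m :: _ \<Rightarrow> int. finite {\<beta>. m \<beta> \<noteq> 0} \<and> {\<beta>. m \<beta> \<noteq> 0} \<subseteq> weight_lattice \<and>
     h = (\<lambda>g\<in>carrier torus. \<Sum>\<beta> | m \<beta> \<noteq> 0. of_int (m \<beta>) * weight_char \<beta> g)"
  have weight_sum: "(\<Sum>\<beta> | m \<beta> \<noteq> 0. of_int (m \<beta>) * weight_char \<beta> (torus_exp x)) =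
      (\<Sum>\<beta> | m \<beta> \<noteq> 0. of_int (m \<beta>) * exp_weight \<beta> x)"
    if "{\<beta>. m \<beta> \<noteq> 0} \<subseteq> weight_lattice" for m :: "_ \<Rightarrow> int" and x
    using that by (intro sum.cong refl) (auto simp: weight_char_torus_exp)
  have kW: "{\<beta>. k \<beta> \<noteq> 0} \<subseteq> weight_lattice" using supp S(2) S'(2) by blast
  have mult: "multiplicity_of h = k"
    unfolding multiplicity_of_def
  proof (rule the_equality)
    have "h = (\<lambda>g\<in>carrier torus. \<Sum>\<beta> | k \<beta> \<noteq> 0. of_int (k \<beta>) * weight_char \<beta> g)"
      by (rule extensionalityI[OF h(1)]) (auto simp: carrier_torus_eq weight_sum[OF kW] sum_k h(2))
    then show "?P k" using fin kW by blast
  next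
    fix m :: "_ \<Rightarrow> int" assume m: "?P m"
    have "h (torus_exp x) = (\<Sum>\<beta> | m \<beta> \<noteq> 0. of_int (m \<beta>) * exp_weight \<beta> x)" for x
    proof -
      have "h (torus_exp x) = (\<Sum>\<beta> | m \<beta> \<noteq> 0. of_int (m \<beta>) * weight_char \<beta> (torus_exp x))"
        by (subst m[THEN conjunct2, THEN conjunct2]) simp
      also have "\<dots> = (\<Sum>\<beta> | m \<beta> \<noteq> 0. of_int (m \<beta>) * exp_weight \<beta> x)"
        using m by (intro weight_sum) blast
      finally show ?thesis .
    qed
    then show "m = k"
      using m fin h(2) sum_k by (intro exp_weight_independent) auto
  qed
  have inv: "(\<Sum>\<beta> | k \<beta> \<noteq> 0 \<and> blinfun_apply \<beta> \<xi> = 0. of_int (k \<beta>) * weight_char \<beta> (torus_exp y)) = F y" for y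
  proof -
    have "(\<Sum>\<beta> | k \<beta> \<noteq> 0 \<and> blinfun_apply \<beta> \<xi> = 0. of_int (k \<beta>) * weight_char \<beta> (torus_exp y))
       = (\<Sum>\<beta> | k \<beta> \<noteq> 0 \<and> blinfun_apply \<beta> \<xi> = 0. of_int (k \<beta>) * exp_weight \<beta> y)"
      using kW by (intro sum.cong refl) (auto simp: weight_char_torus_exp)
    also have "\<dots> = F y"
      unfolding F_eq using S S'(2) supp by (intro sum.mono_neutral_left) auto
    finally show ?thesis .
  qed
  have F_const: "F (x + s *\<^sub>R \<xi>) = F x" for x s
    unfolding S(3) using S(2) by (intro sum.cong refl) (auto simp: exp_weight_const_on_coset)
  show eq: "invariant_part T \<xi> h (T #>\<^bsub>torus\<^esub> torus_exp x) = F x" for x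
  proof -
    \<comment> \<open>F is constant along the coset, so the image is a singleton and
      \<open>the_elem\<close> returns its element.\<close>
    have "(\<lambda>g. \<Sum>\<beta> | k \<beta> \<noteq> 0 \<and> blinfun_apply \<beta> \<xi> = 0. of_int (k \<beta>) * weight_char \<beta> g) `
        (T #>\<^bsub>torus\<^esub> torus_exp x) = {F x}"
      by (simp add: coset_eq image_image inv F_const)
    then show ?thesis by (simp add: invariant_part_def mult)
  qed
  have "invariant_part T \<xi> h = (\<lambda>C\<in>carrier (torus Mod T). \<Sum>\<beta>\<in>S. of_int (k \<beta>) * quotient_char \<beta> C)"
  proof (rule extensionalityI)
    fix C assume "C \<in> carrier (torus Mod T)"
    then obtain x where C: "C = T #>\<^bsub>torus\<^esub> torus_exp x" by (auto simp: carrier_torus_Mod)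
    have "F x = (\<Sum>\<beta>\<in>S. of_int (k \<beta>) * quotient_char \<beta> C)"
      unfolding F_eq C using S(2) by (intro sum.cong refl) (auto simp: quotient_char_coset)
    then show "invariant_part T \<xi> h C =
        (\<lambda>C\<in>carrier (torus Mod T). \<Sum>\<beta>\<in>S. of_int (k \<beta>) * quotient_char \<beta> C) C"
      by (simp add: C eq)
  qed (auto simp: invariant_part_def)
  also have "\<dots> \<in> rep_ring (torus Mod T) (quotient_topology T)"
    using S inj_on_subset[OF inj_on_quotient_char S(2)] quotient_char_in_characters
    by (intro rep_ringI) auto
  finally show "invariant_part T \<xi> h \<in> rep_ring (torus Mod T) (quotient_topology T)" .
qed

end

section \<open>One-parameter form of a circle subgroup\<close>

text \<open>Composed with \<open>cis (2 * pi * s)\<close>, the isomorphism h has coordinates that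
  are continuous homomorphisms from the reals to the circle, so it is a one-parameter group with a
  direction v. Since exp v = 1, v is an integral multiple of \<xi>, and T = h(circle) lies in the
  one-parameter group of \<xi>.\<close>

lemma torus_circleI:
  assumes T: "circle_subgroup T" and \<xi>: "infinitesimal_generator T \<xi>"
  shows "torus_circle T \<xi>"
proof -
  have sub: "subgroup T torus" using T by (simp add: circle_subgroup_def)
  have ker: "{x \<in> lie_algebra T. torus_exp x = \<one>\<^bsub>torus\<^esub>} = range (\<lambda>k::int. of_int k *\<^sub>R \<xi>)"
    and \<xi>0: "\<xi> \<noteq> 0"
    using \<xi> by (auto simp: infinitesimal_generator_def)
  have "\<xi> \<in> {x \<in> lie_algebra T. torus_exp x = \<one>\<^bsub>torus\<^esub>}"
    unfolding ker by (rule range_eqI[of _ _ 1]) simp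
  then have \<xi>L: "torus_exp (s *\<^sub>R \<xi>) \<in> T" for s by (simp add: lie_algebra_def)
  have exp_xi: "torus_exp (s *\<^sub>R \<xi>) = \<one>\<^bsub>torus\<^esub> \<longleftrightarrow> s \<in> \<int>" for s
  proof -
    have "s *\<^sub>R \<xi> \<in> lie_algebra T" using \<xi>L by (simp add: lie_algebra_def)
    then have "torus_exp (s *\<^sub>R \<xi>) = \<one>\<^bsub>torus\<^esub> \<longleftrightarrow> s *\<^sub>R \<xi> \<in> range (\<lambda>k::int. of_int k *\<^sub>R \<xi>)"
      using ker by blast
    also have "\<dots> \<longleftrightarrow> s \<in> \<int>" using \<xi>0 by (auto simp: Ints_def)
    finally show ?thesis .
  qed
  obtain h where iso: "h \<in> iso circle_group (torus\<lparr>carrier := T\<rparr>)"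
    and cont: "continuous_on (carrier circle_group) h"
    using T by (auto simp: circle_subgroup_def)
  have hT: "h z \<in> T" if "norm z = 1" for z
    using iso that by (auto simp: iso_def hom_def)
  have hmult: "h (z * w) = h z \<otimes>\<^bsub>torus\<^esub> h w" if "norm z = 1" "norm w = 1" for z w
    using iso that by (auto simp: iso_def hom_def)
  have bij: "bij_betw h {z. norm z = 1} T"
  proof -
    have "carrier circle_group = {z. norm z = 1}" by auto
    then show ?thesis using iso by (simp add: iso_def)
  qed
  have "\<exists>b. \<forall>s. vec_nth (h (cis (2 * pi * s))) i = cis (s * b)" for i
  proof (rule continuous_hom_circle)
    have "continuous_on UNIV (\<lambda>s::real. h (cis (2 * pi * s)))"
      by (rule continuous_on_compose2[OF cont]) (auto intro!: continuous_intros continuous_on_cis)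
    then show "continuous_on UNIV (\<lambda>s. vec_nth (h (cis (2 * pi * s))) i)"
      by (intro continuous_intros)
    show "vec_nth (h (cis (2 * pi * (s + t)))) i =
       vec_nth (h (cis (2 * pi * s))) i * vec_nth (h (cis (2 * pi * t))) i" for s t
      by (simp add: distrib_left hmult mult_torus flip: cis_mult)
    have "T \<subseteq> carrier torus" using sub by (rule subgroup.subset)
    then show "norm (vec_nth (h (cis (2 * pi * s))) i) = 1" for s
      using hT[of "cis (2 * pi * s)"] by (auto simp: torus_def)
  qed
  then obtain b where b: "\<And>i s. vec_nth (h (cis (2 * pi * s))) i = cis (s * b i)" by metis
  define v where "v = (\<chi> i. b i / (2 * pi))"
  have hv: "h (cis (2 * pi * s)) = torus_exp (s *\<^sub>R v)" for s
    by (simp add: Finite_Cartesian_Product.vec_eq_iff b v_def)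
  have "v \<in> lie_algebra T" using hT by (simp add: lie_algebra_def flip: hv)
  moreover have exp_v: "torus_exp v = \<one>\<^bsub>torus\<^esub>"
    using hv[of 1] hv[of 0] by (simp add: torus_exp_0)
  ultimately obtain k :: int where k: "v = of_int k *\<^sub>R \<xi>" using ker by blast
  have "T \<subseteq> range (\<lambda>s. torus_exp (s *\<^sub>R \<xi>))"
  proof
    fix g assume "g \<in> T"
    then obtain z where z: "norm z = 1" "g = h z" using bij by (auto simp: bij_betw_def)
    have "z = cis (2 * pi * (Arg z / (2 * pi)))"
      using z(1) rcis_cmod_Arg[of z] by (simp add: rcis_def)
    then have "g = torus_exp ((Arg z / (2 * pi) * of_int k) *\<^sub>R \<xi>)"
      using z(2) hv k by (metis scaleR_scaleR)
    then show "g \<in> range (\<lambda>s. torus_exp (s *\<^sub>R \<xi>))" by blast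
  qed
  then show ?thesis using sub exp_xi \<xi>L by (intro torus_circle.intro) auto
qed

section \<open>Expansion along the circle\<close>

lemma cis_Arg_unit: "norm z = 1 \<Longrightarrow> cis (Arg z) = z"
  using rcis_cmod_Arg[of z] by (simp add: rcis_def)

lemma exp_weight_of_int_scaleR: "exp_weight (of_int m *\<^sub>R \<beta>) x = exp_weight \<beta> x powi m"
  by (simp add: exp_weight_def blinfun.scaleR_left cis_power_int mult_ac)

lemma weight_lattice_of_int_scaleR: "\<beta> \<in> weight_lattice \<Longrightarrow> of_int m *\<^sub>R \<beta> \<in> weight_lattice"
  by (simp add: weight_lattice_def blinfun.scaleR_left)

text \<open>Radius and value are proved together because adding a summand inside
  \<open>eval_fps\<close> needs the radius of the remaining sum.\<close>

lemma eval_fps_sum_prod_geom: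
  fixes A :: "'p \<Rightarrow> complex fps"
  assumes "finite V" "\<And>p. p \<in> V \<Longrightarrow> fps_conv_radius (A p) \<ge> 1" "norm z < 1"
  shows "fps_conv_radius (\<Sum>p\<in>V. fps_const (b p) * fps_X ^ s p * A p) \<ge> 1 \<and>
    eval_fps (\<Sum>p\<in>V. fps_const (b p) * fps_X ^ s p * A p) z = (\<Sum>p\<in>V. b p * z ^ s p * eval_fps (A p) z)"
  using assms(1,2)
proof (induction V rule: finite_induct)
  case (insert p V)
  define B where "B = fps_const (b p) * fps_X ^ s p"
  define R where "R = (\<Sum>p\<in>V. fps_const (b p) * fps_X ^ s p * A p)"
  have R: "fps_conv_radius R \<ge> 1" "eval_fps R z = (\<Sum>p\<in>V. b p * z ^ s p * eval_fps (A p) z)"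
    using insert by (simp_all add: R_def)
  have z: "ereal (norm z) < 1" using assms(3) by simp
  have rB: "fps_conv_radius B = \<infinity>"
    using fps_conv_radius_mult[of "fps_const (b p)" "fps_X ^ s p"] by (simp add: B_def)
  have eB: "eval_fps B z = b p * z ^ s p" unfolding B_def by (subst eval_fps_mult) auto
  have A: "fps_conv_radius (A p) \<ge> 1" using insert by simp
  have zA: "ereal (norm z) < fps_conv_radius (A p)" using z A by (rule less_le_trans)
  have rBA: "fps_conv_radius (B * A p) \<ge> 1"
    using fps_conv_radius_mult[of B "A p"] A rB by simp
  have eBA: "eval_fps (B * A p) z = b p * z ^ s p * eval_fps (A p) z"
    using zA rB eB by (simp add: eval_fps_mult)
  have "1 \<le> fps_conv_radius (B * A p + R)"
    using fps_conv_radius_add[of "B * A p" R] rBA R(1) by (metis min_def order_trans)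
  moreover have "eval_fps (B * A p + R) z = eval_fps (B * A p) z + eval_fps R z"
    using less_le_trans[OF z rBA] less_le_trans[OF z R(1)] by (rule eval_fps_add)
  ultimately show ?case using insert.hyps eBA R(2) by (simp add: B_def R_def)
qed auto

text \<open>Representations are replaced by scalar consequences. \<open>edge_compat\<close> is what
  the isomorphism of the vertex representations on the kernel of an edge weight leaves after one
  factor is removed at each end. The functional in \<open>indep\<close> is the combination of the
  two weights that kills \<xi>, so it is constant along x + s \<xi>.\<close>

locale symplectic_gkm = torus_circle T \<xi>
  for T :: "(complex ^ 'n) set" and \<xi> :: "real ^ 'n" +
  fixes \<Gamma> :: "('v, 'e) pre_digraph" and rv :: "'e \<Rightarrow> 'e"
    and \<alpha> :: "'e \<Rightarrow> (real ^ 'n) \<Rightarrow>\<^sub>L real" and a :: "'v \<Rightarrow> (real ^ 'n) \<Rightarrow>\<^sub>L real"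
  assumes finite_verts: "finite (verts \<Gamma>)" and finite_arcs: "finite (arcs \<Gamma>)"
    and tail_in_verts: "e \<in> arcs \<Gamma> \<Longrightarrow> tail \<Gamma> e \<in> verts \<Gamma>"
    and head_in_verts: "e \<in> arcs \<Gamma> \<Longrightarrow> head \<Gamma> e \<in> verts \<Gamma>"
    and rv_in_arcs: "e \<in> arcs \<Gamma> \<Longrightarrow> rv e \<in> arcs \<Gamma>"
    and rv_rv: "e \<in> arcs \<Gamma> \<Longrightarrow> rv (rv e) = e"
    and tail_rv: "e \<in> arcs \<Gamma> \<Longrightarrow> tail \<Gamma> (rv e) = head \<Gamma> e"
    and weight_edge: "e \<in> arcs \<Gamma> \<Longrightarrow> \<alpha> e \<in> weight_lattice"
    and weight_vertex: "p \<in> verts \<Gamma> \<Longrightarrow> a p \<in> weight_lattice"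
    and weight_rv: "e \<in> arcs \<Gamma> \<Longrightarrow> \<alpha> (rv e) = - \<alpha> e"
    and degree_nonzero: "e \<in> arcs \<Gamma> \<Longrightarrow> xi_degree (\<alpha> e) \<noteq> 0"
    and indep: "\<lbrakk>e \<in> arcs \<Gamma>; e' \<in> arcs \<Gamma>; e \<noteq> e'; tail \<Gamma> e = tail \<Gamma> e'\<rbrakk> \<Longrightarrow>
       of_int (xi_degree (\<alpha> e)) *\<^sub>R \<alpha> e' - of_int (xi_degree (\<alpha> e')) *\<^sub>R \<alpha> e \<noteq> 0"
    and vertex_compat: "\<lbrakk>e \<in> arcs \<Gamma>; exp_weight (\<alpha> e) x = 1\<rbrakk> \<Longrightarrow>
       exp_weight (a (tail \<Gamma> e)) x = exp_weight (a (head \<Gamma> e)) x"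
    and edge_compat: "\<lbrakk>e \<in> arcs \<Gamma>; exp_weight (\<alpha> e) x = 1\<rbrakk> \<Longrightarrow>
       (\<Prod>e'\<in>out_arcs \<Gamma> (tail \<Gamma> e) - {e}. inverse (1 - exp_weight (\<alpha> e') x)) =
       (\<Prod>e'\<in>out_arcs \<Gamma> (head \<Gamma> e) - {rv e}. inverse (1 - exp_weight (\<alpha> e') x))"
    and positive: "e \<in> arcs \<Gamma> \<Longrightarrow> \<exists>m::int. m > 0 \<and> a (head \<Gamma> e) - a (tail \<Gamma> e) = of_int m *\<^sub>R \<alpha> e"
    and vertex_degree_nonzero: "p \<in> verts \<Gamma> \<Longrightarrow> xi_degree (a p) \<noteq> 0"
begin

lemma finite_out_arcs: "finite (out_arcs \<Gamma> p)"
  using finite_arcs by (simp add: out_arcs_def)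

lemma xi_degree_of_int_scaleR:
  assumes "\<beta> \<in> weight_lattice"
  shows "xi_degree (of_int m *\<^sub>R \<beta>) = m * xi_degree \<beta>"
proof -
  have "real_of_int (xi_degree (of_int m *\<^sub>R \<beta>)) = of_int (m * xi_degree \<beta>)"
    using assms by (simp add: of_int_xi_degree weight_lattice_of_int_scaleR blinfun.scaleR_left)
  then show ?thesis by (simp only: of_int_eq_iff)
qed

section \<open>Poles and local terms along a coset\<close>

text \<open>The exponential along the coset of x, continued from the unit circle to all z \<noteq>
  0.\<close>

definition twist :: "((real ^ 'n) \<Rightarrow>\<^sub>L real) \<Rightarrow> real ^ 'n \<Rightarrow> complex \<Rightarrow> complex" where
  "twist \<beta> x z = exp_weight \<beta> x * z powi xi_degree \<beta>"

lemma twist_cis: "\<beta> \<in> weight_lattice \<Longrightarrow> twist \<beta> x (cis (2 * pi * s)) = exp_weight \<beta> (x + s *\<^sub>R \<xi>)"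
  by (simp add: twist_def exp_weight_translate)

lemma twist_unit:
  assumes "norm z = 1"
  obtains s where "z = cis (2 * pi * s)" "\<And>\<beta>. \<beta> \<in> weight_lattice \<Longrightarrow> twist \<beta> x z = exp_weight \<beta> (x + s *\<^sub>R \<xi>)"
proof
  show "z = cis (2 * pi * (Arg z / (2 * pi)))" using assms by (simp add: cis_Arg_unit)
  then show "twist \<beta> x z = exp_weight \<beta> (x + (Arg z / (2 * pi)) *\<^sub>R \<xi>)" if "\<beta> \<in> weight_lattice" for \<beta>
    using twist_cis[OF that] by metis
qed

text \<open>The poles of the factor of \<open>e\<close> along the coset of x. For an edge they lie
  on the unit circle and correspond to the points of the coset in
  \<open>weight_kernel (\<alpha> e)\<close>.\<close>

definition roots :: "'e \<Rightarrow> real ^ 'n \<Rightarrow> complex set" where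
  "roots e x = {z. z \<noteq> 0 \<and> twist (\<alpha> e) x z = 1}"

lemma roots_norm:
  assumes e: "e \<in> arcs \<Gamma>" and z: "z \<in> roots e x"
  shows "norm z = 1"
proof -
  have "norm (twist (\<alpha> e) x z) = 1" using z by (simp add: roots_def)
  then have "norm z powi xi_degree (\<alpha> e) = 1" by (simp add: twist_def norm_mult norm_power_int)
  then have "norm z ^ nat \<bar>xi_degree (\<alpha> e)\<bar> = 1"
    by (auto simp: power_int_def abs_if power_inverse split: if_splits)
  moreover have "nat \<bar>xi_degree (\<alpha> e)\<bar> > 0" using degree_nonzero[OF e] by simp
  ultimately show ?thesis
    using power_eq_1_iff[of "norm z" "nat \<bar>xi_degree (\<alpha> e)\<bar>"] by simp
qed

lemma roots_finite_card:
  assumes e: "e \<in> arcs \<Gamma>"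
  shows "card (roots e x) = nat \<bar>xi_degree (\<alpha> e)\<bar>" and "finite (roots e x)"
proof -
  have eq: "roots e x = {z. poly (geom_den (exp_weight (\<alpha> e) x) (xi_degree (\<alpha> e))) z = 0}"
    by (simp add: roots_def twist_def geom_den_root[OF exp_weight_nonzero degree_nonzero[OF e]])
  show *: "card (roots e x) = nat \<bar>xi_degree (\<alpha> e)\<bar>"
    unfolding eq by (rule card_geom_den_roots[OF exp_weight_nonzero degree_nonzero[OF e]])
  show "finite (roots e x)"
    using * degree_nonzero[OF e] by (intro card_ge_0_finite) simp
qed

text \<open>The quotient \<open>edge_term\<close> on the Lie algebra; \<open>local_twist\<close> is
  the same quotient along a coset, in the variable z.\<close>

definition local_term :: "'e \<Rightarrow> real ^ 'n \<Rightarrow> complex" where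
  "local_term e x = exp_weight (a (tail \<Gamma> e)) x *
     (\<Prod>e'\<in>out_arcs \<Gamma> (tail \<Gamma> e) - {e}. inverse (1 - exp_weight (\<alpha> e') x))"

definition local_twist :: "'e \<Rightarrow> real ^ 'n \<Rightarrow> complex \<Rightarrow> complex" where
  "local_twist e x z = twist (a (tail \<Gamma> e)) x z *
     (\<Prod>e'\<in>out_arcs \<Gamma> (tail \<Gamma> e) - {e}. inverse (1 - twist (\<alpha> e') x z))"

lemma local_twist_cis:
  "e \<in> arcs \<Gamma> \<Longrightarrow> local_twist e x (cis (2 * pi * s)) = local_term e (x + s *\<^sub>R \<xi>)"
  unfolding local_twist_def local_term_def
  by (simp add: twist_cis weight_vertex tail_in_verts weight_edge)

lemma head_rv: "e \<in> arcs \<Gamma> \<Longrightarrow> head \<Gamma> (rv e) = tail \<Gamma> e"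
  using tail_rv[of "rv e"] by (simp add: rv_in_arcs rv_rv)

lemma roots_rv:
  assumes e: "e \<in> arcs \<Gamma>"
  shows "roots (rv e) x = roots e x"
proof -
  have "twist (\<alpha> (rv e)) x z = inverse (twist (\<alpha> e) x z)" for z
    using e by (simp add: twist_def weight_rv exp_weight_minus xi_degree_minus weight_edge power_int_minus)
  then show ?thesis by (auto simp: roots_def)
qed

text \<open>A root is a point of the kernel of the edge weight, where the classes at the two ends
  agree and so do the products over the remaining edges.\<close>

lemma local_twist_rv:
  assumes e: "e \<in> arcs \<Gamma>" and z: "z \<in> roots e x"
  shows "local_twist (rv e) x z = local_twist e x z"
proof -
  obtain s where s: "z = cis (2 * pi * s)"
    "\<And>\<beta>. \<beta> \<in> weight_lattice \<Longrightarrow> twist \<beta> x z = exp_weight \<beta> (x + s *\<^sub>R \<xi>)"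
    using twist_unit[OF roots_norm[OF e z]] by blast
  have 1: "exp_weight (\<alpha> e) (x + s *\<^sub>R \<xi>) = 1"
    using z s(2)[OF weight_edge[OF e]] by (simp add: roots_def)
  show ?thesis
    unfolding s(1) local_twist_cis[OF e] local_twist_cis[OF rv_in_arcs[OF e]]
    unfolding local_term_def tail_rv[OF e] vertex_compat[OF e 1] edge_compat[OF e 1] ..
qed

text \<open>Multiplication by \<open>z ^ shift\<close> turns the Laurent expansions at all vertices into power series.\<close>

definition shift :: nat where
  "shift = (\<Sum>p\<in>verts \<Gamma>. nat \<bar>xi_degree (a p)\<bar>)"

definition height :: "'v \<Rightarrow> nat" where
  "height p = nat (xi_degree (a p) + int shift)"

lemma abs_degree_le_shift: "p \<in> verts \<Gamma> \<Longrightarrow> \<bar>xi_degree (a p)\<bar> \<le> int shift"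
proof -
  assume p: "p \<in> verts \<Gamma>"
  have "nat \<bar>xi_degree (a p)\<bar> \<le> shift"
    unfolding shift_def using finite_verts p by (intro member_le_sum) auto
  then show ?thesis by simp
qed

lemma int_height: "p \<in> verts \<Gamma> \<Longrightarrow> int (height p) = xi_degree (a p) + int shift"
  using abs_degree_le_shift[of p] by (simp add: height_def)

lemma height_le: "p \<in> verts \<Gamma> \<Longrightarrow> height p \<le> 2 * shift"
  using abs_degree_le_shift[of p] int_height[of p] by linarith

definition vertex_fps :: "real ^ 'n \<Rightarrow> 'v \<Rightarrow> complex fps" where
  "vertex_fps x p = (\<Prod>e\<in>out_arcs \<Gamma> p. geom_fps (exp_weight (\<alpha> e) x) (xi_degree (\<alpha> e)))"

text \<open>Coefficient j has degree j - \<open>shift\<close> along \<xi>, so the T-invariant part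
  is coefficient \<open>shift\<close>.\<close>

definition graph_fps :: "real ^ 'n \<Rightarrow> complex fps" where
  "graph_fps x = (\<Sum>p\<in>verts \<Gamma>. fps_const (exp_weight (a p) x) * fps_X ^ height p * vertex_fps x p)"

lemma graph_fps_nth:
  "fps_nth (graph_fps x) j = (\<Sum>p | p \<in> verts \<Gamma> \<and> height p \<le> j.
     exp_weight (a p) x * fps_nth (vertex_fps x p) (j - height p))"
proof -
  have "fps_nth (fps_const b * fps_X ^ s * A) j = (if s \<le> j then b * fps_nth A (j - s) else 0)"
    for b :: complex and s A
    by (simp add: mult.assoc fps_X_power_mult_nth)
  then show ?thesis
    using finite_verts by (simp add: graph_fps_def fps_sum_nth sum.If_cases Int_def)
qed

section \<open>Degrees of the coefficients along the circle\<close>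

text \<open>A nonzero coefficient is 1 or -1 times the exponential of m \<beta>, where m has the
  sign of the degree of \<beta>; so m \<beta> has degree |k| i = j for either sign of k.\<close>

lemma geom_fps_weight_span:
  assumes \<beta>: "\<beta> \<in> weight_lattice" and k: "xi_degree \<beta> \<noteq> 0"
  shows "(\<lambda>x. fps_nth (geom_fps (exp_weight \<beta> x) (xi_degree \<beta>)) j) \<in>
    weight_span {\<gamma> \<in> weight_lattice. xi_degree \<gamma> = int j}"
proof (cases "nat \<bar>xi_degree \<beta>\<bar> dvd j")
  case False
  then show ?thesis by (simp add: geom_fps_def weight_span_0)
next
  case True
  then obtain i where i: "j = nat \<bar>xi_degree \<beta>\<bar> * i" by (elim dvdE)
  have div: "j div nat \<bar>xi_degree \<beta>\<bar> = i" using k by (simp add: i)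
  define m where "m = sgn (xi_degree \<beta>) * int i"
  have "xi_degree (of_int m *\<^sub>R \<beta>) = int j"
    using xi_degree_of_int_scaleR[OF \<beta>, of m] by (simp add: m_def i abs_if sgn_if)
  then have mem: "of_int m *\<^sub>R \<beta> \<in> {\<gamma> \<in> weight_lattice. xi_degree \<gamma> = int j}"
    using weight_lattice_of_int_scaleR[OF \<beta>, of m] by blast
  define c :: int where "c = (if xi_degree \<beta> > 0 then 1 else if j = 0 then 0 else -1)"
  have "fps_nth (geom_fps (exp_weight \<beta> x) (xi_degree \<beta>)) j = of_int c * exp_weight (of_int m *\<^sub>R \<beta>) x" for x
  proof -
    have "fps_nth (geom_fps (exp_weight \<beta> x) (xi_degree \<beta>)) j = (if 0 < xi_degree \<beta>
        then exp_weight \<beta> x ^ i else if j = 0 then 0 else - (inverse (exp_weight \<beta> x) ^ i))"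
      using True by (simp only: geom_fps_def fps_nth_Abs_fps if_True div)
    then show ?thesis
      using k unfolding exp_weight_of_int_scaleR
      by (auto simp: c_def m_def power_int_minus power_inverse sgn_if)
  qed
  then show ?thesis using weight_span_single[OF mem, of c] by simp
qed

text \<open>In the Cauchy product the degrees i and j - i add up to j.\<close>

lemma prod_geom_fps_weight_span:
  assumes "finite E" "E \<subseteq> arcs \<Gamma>"
  shows "(\<lambda>x. fps_nth (\<Prod>e\<in>E. geom_fps (exp_weight (\<alpha> e) x) (xi_degree (\<alpha> e))) j) \<in>
    weight_span {\<gamma> \<in> weight_lattice. xi_degree \<gamma> = int j}"
  using assms
proof (induction E arbitrary: j rule: finite_induct)
  case empty
  have "0 \<in> {\<gamma> \<in> weight_lattice. xi_degree \<gamma> = 0}"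
    by (simp add: weight_lattice_0 xi_degree_def)
  from weight_span_single[OF this, of 1] show ?case
    by (cases "j = 0") (auto simp: weight_span_0)
next
  case (insert e E)
  have "(\<lambda>x. fps_nth (geom_fps (exp_weight (\<alpha> e) x) (xi_degree (\<alpha> e))) i *
     fps_nth (\<Prod>e\<in>E. geom_fps (exp_weight (\<alpha> e) x) (xi_degree (\<alpha> e))) (j - i))
     \<in> weight_span {\<gamma> \<in> weight_lattice. xi_degree \<gamma> = int j}" if "i \<in> {0..j}" for i
    using insert that
    by (intro weight_span_mult[OF geom_fps_weight_span insert.IH])
       (auto simp: weight_edge degree_nonzero xi_degree_add weight_lattice_add)
  then show ?case
    unfolding prod.insert[OF insert.hyps] fps_mult_nth by (rule weight_span_sum)
qed

lemma graph_fps_weight_span: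
  "(\<lambda>x. fps_nth (graph_fps x) j) \<in>
     weight_span {\<gamma> \<in> weight_lattice. xi_degree \<gamma> = int j - int shift}"
  unfolding graph_fps_nth
proof (rule weight_span_sum)
  fix p assume p: "p \<in> {p. p \<in> verts \<Gamma> \<and> height p \<le> j}"
  have "(\<lambda>x. exp_weight (a p) x) \<in> weight_span {a p}"
    using weight_span_single[of "a p" "{a p}" 1] by simp
  moreover have "(\<lambda>x. fps_nth (vertex_fps x p) (j - height p)) \<in>
      weight_span {\<gamma> \<in> weight_lattice. xi_degree \<gamma> = int (j - height p)}"
    unfolding vertex_fps_def
    by (rule prod_geom_fps_weight_span[OF finite_out_arcs]) (auto simp: out_arcs_def)
  ultimately show "(\<lambda>x. exp_weight (a p) x * fps_nth (vertex_fps x p) (j - height p)) \<in>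
      weight_span {\<gamma> \<in> weight_lattice. xi_degree \<gamma> = int j - int shift}"
    using p by (rule_tac weight_span_mult)
      (auto simp: weight_vertex weight_lattice_add xi_degree_add int_height of_nat_diff)
qed

section \<open>Generic points and cancellation over reversed edges\<close>

definition generic :: "real ^ 'n \<Rightarrow> bool" where
  "generic x \<longleftrightarrow> (\<forall>e\<in>arcs \<Gamma>. \<forall>e'\<in>arcs \<Gamma>. e \<noteq> e' \<longrightarrow> tail \<Gamma> e = tail \<Gamma> e' \<longrightarrow> roots e x \<inter> roots e' x = {})"

lemma genericD:
  "\<lbrakk>generic x; e \<in> arcs \<Gamma>; e' \<in> arcs \<Gamma>; e \<noteq> e'; tail \<Gamma> e = tail \<Gamma> e'; z \<in> roots e x\<rbrakk> \<Longrightarrow>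
    twist (\<alpha> e') x z \<noteq> 1"
  unfolding generic_def roots_def by blast

text \<open>A common root yields s at which the two weights take integral values N and M on x + s
  \<xi>. Eliminating s puts x on one of the countably many hyperplanes \<gamma> = k M - k'
  N.\<close>

lemma closure_generic: "closure {x. generic x} = UNIV"
proof -
  define I where "I = {(e, e'). e \<in> arcs \<Gamma> \<and> e' \<in> arcs \<Gamma> \<and> e \<noteq> e' \<and> tail \<Gamma> e = tail \<Gamma> e'}"
  define \<gamma> where "\<gamma> = (\<lambda>(e, e'). of_int (xi_degree (\<alpha> e)) *\<^sub>R \<alpha> e' - of_int (xi_degree (\<alpha> e')) *\<^sub>R \<alpha> e)"
  define L where "L = (\<lambda>(e, e'). range (\<lambda>(M::int, N::int).
      of_int (xi_degree (\<alpha> e)) * of_int M - of_int (xi_degree (\<alpha> e')) * of_int N :: real))"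
  have "I \<subseteq> arcs \<Gamma> \<times> arcs \<Gamma>" by (auto simp: I_def)
  then have "finite I" using finite_arcs by (meson finite_SigmaI finite_subset)
  moreover have "\<gamma> i \<noteq> 0" if "i \<in> I" for i
    using that indep by (auto simp: I_def \<gamma>_def)
  moreover have "countable (L i)" for i
    by (simp add: L_def split: prod.split)
  ultimately have dense: "closure {x. \<forall>i\<in>I. blinfun_apply (\<gamma> i) x \<notin> L i} = UNIV"
    by (intro closure_avoiding_hyperplanes) auto
  have "{x. \<forall>i\<in>I. blinfun_apply (\<gamma> i) x \<notin> L i} \<subseteq> {x. generic x}"
  proof (rule subsetI, simp only: mem_Collect_eq, rule ccontr)
    fix x assume x: "\<forall>i\<in>I. blinfun_apply (\<gamma> i) x \<notin> L i" and "\<not> generic x"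
    then obtain e e' z where e: "e \<in> arcs \<Gamma>" "e' \<in> arcs \<Gamma>" "e \<noteq> e'" "tail \<Gamma> e = tail \<Gamma> e'"
      and z: "z \<in> roots e x" "z \<in> roots e' x" unfolding generic_def by blast
    obtain s where s: "\<And>\<beta>. \<beta> \<in> weight_lattice \<Longrightarrow> twist \<beta> x z = exp_weight \<beta> (x + s *\<^sub>R \<xi>)"
      using twist_unit[OF roots_norm[OF e(1) z(1)]] by blast
    have "exp_weight (\<alpha> e) (x + s *\<^sub>R \<xi>) = 1" "exp_weight (\<alpha> e') (x + s *\<^sub>R \<xi>) = 1"
      using z s[OF weight_edge[OF e(1)]] s[OF weight_edge[OF e(2)]] by (simp_all add: roots_def)
    then obtain N M :: int where "blinfun_apply (\<alpha> e) (x + s *\<^sub>R \<xi>) = of_int N"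
      "blinfun_apply (\<alpha> e') (x + s *\<^sub>R \<xi>) = of_int M"
      unfolding exp_weight_def cis_2pi_eq_1_iff by (auto elim!: Ints_cases)
    then have NM: "blinfun_apply (\<alpha> e) x = of_int N - s * of_int (xi_degree (\<alpha> e))"
      "blinfun_apply (\<alpha> e') x = of_int M - s * of_int (xi_degree (\<alpha> e'))"
      using e by (simp_all add: blinfun.add_right blinfun.scaleR_right of_int_xi_degree weight_edge)
    have "blinfun_apply (\<gamma> (e, e')) x =
        of_int (xi_degree (\<alpha> e)) * of_int M - of_int (xi_degree (\<alpha> e')) * of_int N"
      by (simp add: \<gamma>_def blinfun.diff_left blinfun.scaleR_left NM algebra_simps)
    then have "blinfun_apply (\<gamma> (e, e')) x \<in> L (e, e')" by (auto simp: L_def)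
    moreover have "(e, e') \<in> I" using e by (simp add: I_def)
    with x have "blinfun_apply (\<gamma> (e, e')) x \<notin> L (e, e')" by (rule bspec)
    ultimately show False by contradiction
  qed
  from closure_mono[OF this] show ?thesis unfolding dense by (rule top.extremum_uniqueI)
qed

text \<open>At generic x this is minus the sum of the residues of z^(\<open>shift\<close> - j - 1)
  times the unshifted term of the initial vertex, taken at the poles that come from
  \<open>e\<close>.\<close>

definition residue_sum :: "nat \<Rightarrow> real ^ 'n \<Rightarrow> 'e \<Rightarrow> complex" where
  "residue_sum j x e = (\<Sum>z\<in>roots e x. z powi (int shift - int j) * local_twist e x z / of_int (xi_degree (\<alpha> e)))"

text \<open>Roots and local terms are the same for both orientations; only the degree in the
  denominator changes sign.\<close>

lemma residue_sum_rv:
  assumes e: "e \<in> arcs \<Gamma>"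
  shows "residue_sum j x (rv e) = - residue_sum j x e"
  unfolding residue_sum_def roots_rv[OF e] sum_negf[symmetric]
  using e by (intro sum.cong refl) (simp add: local_twist_rv weight_rv xi_degree_minus weight_edge)

text \<open>A vertex contributes its coefficient of index j - \<open>height p\<close>, for which the
  residue formula needs a positive index; therefore no vertex may have height exactly j.\<close>

lemma graph_fps_nth_generic:
  assumes gen: "generic x" and j: "\<And>p. p \<in> verts \<Gamma> \<Longrightarrow> height p \<noteq> j"
  shows "fps_nth (graph_fps x) j =
    (\<Sum>e | e \<in> arcs \<Gamma> \<and> height (tail \<Gamma> e) < j \<and> j < height (head \<Gamma> e). residue_sum j x e)"
proof -
  define V where "V = {p. p \<in> verts \<Gamma> \<and> height p < j}"
  define A where "A = {e. e \<in> arcs \<Gamma> \<and> height (tail \<Gamma> e) < j}"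
  have fin: "finite V" "finite A" using finite_verts finite_arcs by (simp_all add: V_def A_def)
  have coeff: "exp_weight (a p) x * fps_nth (vertex_fps x p) (j - height p) =
      (\<Sum>e\<in>out_arcs \<Gamma> p. residue_sum j x e)" if p: "p \<in> V" for p
  proof -
    have p': "p \<in> verts \<Gamma>" "height p < j" using p by (auto simp: V_def)
    have "fps_nth (vertex_fps x p) (j - height p) =
      (\<Sum>e\<in>out_arcs \<Gamma> p. \<Sum>z\<in>roots e x. inverse z ^ (j - height p) *
       (\<Prod>e'\<in>out_arcs \<Gamma> p - {e}. inverse (1 - twist (\<alpha> e') x z)) / of_int (xi_degree (\<alpha> e)))"
      unfolding vertex_fps_def roots_def twist_def
    proof (rule prod_geom_fps_coeff)
      fix e e' z
      assume "e \<in> out_arcs \<Gamma> p" "e' \<in> out_arcs \<Gamma> p" "e \<noteq> e'" "z \<noteq> 0"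
        "exp_weight (\<alpha> e) x * z powi xi_degree (\<alpha> e) = 1"
      then show "exp_weight (\<alpha> e') x * z powi xi_degree (\<alpha> e') \<noteq> 1"
        using genericD[OF gen, of e e' z] by (auto simp: roots_def twist_def)
    qed (use p' finite_out_arcs degree_nonzero in auto)
    also have "exp_weight (a p) x * \<dots> = (\<Sum>e\<in>out_arcs \<Gamma> p. residue_sum j x e)"
      unfolding residue_sum_def sum_distrib_left
    proof (intro sum.cong refl)
      fix e z assume e: "e \<in> out_arcs \<Gamma> p" and z: "z \<in> roots e x"
      have z0: "z \<noteq> 0" using z by (simp add: roots_def)
      have "inverse z ^ (j - height p) = z powi - int (j - height p)"
        by (simp add: power_int_minus power_inverse)
      also have "- int (j - height p) = xi_degree (a p) + (int shift - int j)"
        using p' int_height[OF p'(1)] by (simp add: of_nat_diff)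
      also have "z powi \<dots> = z powi xi_degree (a p) * z powi (int shift - int j)"
        using z0 by (simp add: power_int_add)
      finally show "exp_weight (a p) x * (inverse z ^ (j - height p) *
         (\<Prod>e'\<in>out_arcs \<Gamma> p - {e}. inverse (1 - twist (\<alpha> e') x z)) / of_int (xi_degree (\<alpha> e))) =
         z powi (int shift - int j) * local_twist e x z / of_int (xi_degree (\<alpha> e))"
        using e by (simp add: local_twist_def twist_def mult_ac)
    qed
    finally show ?thesis .
  qed
  have "{p. p \<in> verts \<Gamma> \<and> height p \<le> j} = V"
    using j by (force simp: V_def le_less)
  then have "fps_nth (graph_fps x) j = (\<Sum>p\<in>V. \<Sum>e\<in>out_arcs \<Gamma> p. residue_sum j x e)"
    unfolding graph_fps_nth using coeff by simp
  also have "\<dots> = (\<Sum>p\<in>V. \<Sum>e | e \<in> A \<and> tail \<Gamma> e = p. residue_sum j x e)"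
    by (intro sum.cong refl) (auto simp: A_def V_def)
  also have "\<dots> = (\<Sum>e\<in>A. residue_sum j x e)"
    using fin by (intro sum.group) (auto simp: A_def V_def tail_in_verts)
  also have "A = {e. e \<in> arcs \<Gamma> \<and> height (tail \<Gamma> e) < j \<and> j < height (head \<Gamma> e)} \<union>
     {e. e \<in> arcs \<Gamma> \<and> height (tail \<Gamma> e) < j \<and> height (head \<Gamma> e) < j}" (is "_ = ?C \<union> ?D")
    using j head_in_verts by (auto simp: A_def) (metis linorder_neqE_nat)
  also have "(\<Sum>e\<in>?C \<union> ?D. residue_sum j x e) = (\<Sum>e\<in>?C. residue_sum j x e) + (\<Sum>e\<in>?D. residue_sum j x e)"
    using finite_arcs by (intro sum.union_disjoint) auto
  also have "(\<Sum>e\<in>?D. residue_sum j x e) = 0"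
  proof -
    \<comment> \<open>\<open>rv\<close> permutes \<open>?D\<close>, since both ends of its edges lie
      below j; the sum is therefore its own negative.\<close>
    have "(\<Sum>e\<in>?D. residue_sum j x e) = (\<Sum>e\<in>?D. residue_sum j x (rv e))"
      by (rule sum.reindex_bij_witness[of _ rv rv]) (auto simp: rv_rv rv_in_arcs tail_rv head_rv)
    also have "\<dots> = - (\<Sum>e\<in>?D. residue_sum j x e)"
      unfolding sum_negf[symmetric] by (intro sum.cong refl) (simp add: residue_sum_rv)
    finally show ?thesis by (simp add: eq_neg_iff_add_eq_0)
  qed
  finally show ?thesis by simp
qed

lemma graph_fps_nth_large:
  assumes "generic x" "j > 2 * shift"
  shows "fps_nth (graph_fps x) j = 0"
proof -
  have no_edge: "{e. e \<in> arcs \<Gamma> \<and> height (tail \<Gamma> e) < j \<and> j < height (head \<Gamma> e)} = {}"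
    using height_le head_in_verts assms(2) by (fastforce simp: not_less)
  have "height p \<noteq> j" if "p \<in> verts \<Gamma>" for p using height_le[OF that] assms(2) by simp
  from graph_fps_nth_generic[OF assms(1) this] show ?thesis by (simp only: no_edge sum.empty)
qed

definition crossing :: "'e set" where
  "crossing = {e \<in> arcs \<Gamma>. xi_degree (a (tail \<Gamma> e)) < 0 \<and> 0 < xi_degree (a (head \<Gamma> e))}"

text \<open>At level \<open>shift\<close> the power of z in the residue terms is trivial, and
  heights below or above the level are negative or positive degrees.\<close>

lemma graph_fps_nth_shift:
  assumes "generic x"
  shows "fps_nth (graph_fps x) shift =
    (\<Sum>e\<in>crossing. \<Sum>z\<in>roots e x. local_twist e x z / of_int (xi_degree (\<alpha> e)))"
proof -
  have "height p \<noteq> shift" if "p \<in> verts \<Gamma>" for p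
    using int_height[OF that] vertex_degree_nonzero[OF that] by linarith
  from graph_fps_nth_generic[OF assms this]
  have "fps_nth (graph_fps x) shift = (\<Sum>e | e \<in> arcs \<Gamma> \<and> height (tail \<Gamma> e) < shift \<and>
     shift < height (head \<Gamma> e). residue_sum shift x e)" by blast
  also have "{e. e \<in> arcs \<Gamma> \<and> height (tail \<Gamma> e) < shift \<and> shift < height (head \<Gamma> e)} = crossing"
    using int_height[OF tail_in_verts] int_height[OF head_in_verts] by (fastforce simp: crossing_def)
  finally show ?thesis by (simp add: residue_sum_def)
qed

section \<open>The coefficient sum as the value at z = 1\<close>

definition graph_value :: "real ^ 'n \<Rightarrow> complex" where
  "graph_value x = (\<Sum>p\<in>verts \<Gamma>. exp_weight (a p) x *
     (\<Prod>e\<in>out_arcs \<Gamma> p. inverse (1 - exp_weight (\<alpha> e) x)))"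

text \<open>The series are known to converge only for |z| < 1, while the value is wanted at z = 1.
  For 0 < r < 1 the finite coefficient sum P equals the rational sum Q, and both are continuous up
  to r = 1 because no denominator vanishes at x.\<close>

lemma sum_graph_fps_generic:
  assumes gen: "generic x" and x: "\<And>e. e \<in> arcs \<Gamma> \<Longrightarrow> exp_weight (\<alpha> e) x \<noteq> 1"
  shows "(\<Sum>j\<le>2 * shift. fps_nth (graph_fps x) j) = graph_value x"
proof -
  define P where "P r = (\<Sum>j\<le>2 * shift. fps_nth (graph_fps x) j * complex_of_real r ^ j)" for r
  define Q where "Q r = (\<Sum>p\<in>verts \<Gamma>. exp_weight (a p) x * complex_of_real r ^ height p *
     (\<Prod>e\<in>out_arcs \<Gamma> p. inverse (1 - exp_weight (\<alpha> e) x * complex_of_real r powi xi_degree (\<alpha> e))))" for r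
  have PQ: "P r = Q r" if r: "0 < r" "r < 1" for r
  proof -
    have "eval_fps (graph_fps x) (complex_of_real r) =
        (\<Sum>p\<in>verts \<Gamma>. exp_weight (a p) x * complex_of_real r ^ height p * eval_fps (vertex_fps x p) (complex_of_real r))"
      unfolding graph_fps_def
      by (rule eval_fps_sum_prod_geom[THEN conjunct2])
         (use r finite_verts prod_geom_fps_conv_radius[OF finite_out_arcs] in \<open>auto simp: vertex_fps_def\<close>)
    also have "\<dots> = Q r"
      unfolding Q_def vertex_fps_def using r degree_nonzero
      by (intro sum.cong refl arg_cong2[where f = "(*)"] eval_prod_geom_fps finite_out_arcs)
         auto
    finally have "eval_fps (graph_fps x) (complex_of_real r) = Q r" .
    moreover have "eval_fps (graph_fps x) (complex_of_real r) = P r"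
      unfolding eval_fps_def P_def
      by (rule suminf_finite) (auto simp: graph_fps_nth_large[OF gen])
    ultimately show ?thesis by simp
  qed
  have "((\<lambda>r. P r) \<longlongrightarrow> P 1) (at_left 1)"
    unfolding P_def by (intro tendsto_intros)
  moreover have "((\<lambda>r. Q r) \<longlongrightarrow> Q 1) (at_left 1)"
    unfolding Q_def using x by (intro tendsto_intros) auto
  moreover have "eventually (\<lambda>r. P r = Q r) (at_left (1::real))"
    using eventually_at_left_field[of _ "1::real"] PQ by (auto intro!: exI[of _ 0])
  ultimately have "P 1 = Q 1"
    by (metis tendsto_cong tendsto_unique trivial_limit_at_left_real)
  then show ?thesis by (simp add: P_def Q_def graph_value_def)
qed

end

section \<open>The two characters\<close>

lemma continuous_on_weight_span: "F \<in> weight_span W \<Longrightarrow> continuous_on S F"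
  by (elim weight_spanE) (auto intro!: continuous_intros)

lemma open_Collect_ball_neq:
  fixes f g :: "'i \<Rightarrow> 'a::topological_space \<Rightarrow> 'b::t2_space"
  assumes "finite I" "\<And>i. i \<in> I \<Longrightarrow> continuous_on UNIV (f i)" "\<And>i. i \<in> I \<Longrightarrow> continuous_on UNIV (g i)"
  shows "open {x. \<forall>i\<in>I. f i x \<noteq> g i x}"
proof -
  have "{x. \<forall>i\<in>I. f i x \<noteq> g i x} = (\<Inter>i\<in>I. {x. f i x \<noteq> g i x})" by blast
  then show ?thesis using assms by (auto intro!: open_INT open_Collect_neq)
qed

context symplectic_gkm
begin

lemma continuous_on_prod_inverse:
  assumes "\<And>e x. \<lbrakk>e \<in> E; x \<in> U\<rbrakk> \<Longrightarrow> exp_weight (\<alpha> e) (y x) \<noteq> 1" and "continuous_on U y"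
  shows "continuous_on U (\<lambda>x. \<Prod>e\<in>E. inverse (1 - exp_weight (\<alpha> e) (y x)))"
  using assms by (intro continuous_intros) auto

lemma sum_graph_fps:
  assumes x: "\<And>e. e \<in> arcs \<Gamma> \<Longrightarrow> exp_weight (\<alpha> e) x \<noteq> 1"
  shows "(\<Sum>j\<le>2 * shift. fps_nth (graph_fps x) j) = graph_value x"
proof (rule eq_on_open_from_dense[where f = "\<lambda>x. \<Sum>j\<le>2 * shift. fps_nth (graph_fps x) j"
      and g = graph_value and U = "{x. \<forall>e\<in>arcs \<Gamma>. exp_weight (\<alpha> e) x \<noteq> 1}"
      and X = "{x. generic x}" and x = x])
  show "open {x. \<forall>e\<in>arcs \<Gamma>. exp_weight (\<alpha> e) x \<noteq> 1}"
    by (intro open_Collect_ball_neq finite_arcs continuous_intros)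
  show "closure {x. generic x} = UNIV" by (rule closure_generic)
  show "continuous_on {x. \<forall>e\<in>arcs \<Gamma>. exp_weight (\<alpha> e) x \<noteq> 1}
      (\<lambda>x. \<Sum>j\<le>2 * shift. fps_nth (graph_fps x) j)"
    by (intro continuous_on_sum continuous_on_weight_span[OF graph_fps_weight_span])
  show "continuous_on {x. \<forall>e\<in>arcs \<Gamma>. exp_weight (\<alpha> e) x \<noteq> 1} graph_value"
    unfolding graph_value_def
    by (intro continuous_on_sum continuous_on_mult continuous_on_prod_inverse continuous_intros) auto
qed (use x in \<open>auto intro: sum_graph_fps_generic\<close>)

lemma closure_nonvanishing: "closure {x. \<forall>e\<in>arcs \<Gamma>. exp_weight (\<alpha> e) x \<noteq> 1} = UNIV"
proof -
  have eq: "{x. \<forall>e\<in>arcs \<Gamma>. exp_weight (\<alpha> e) x \<noteq> 1} = {x. \<forall>e\<in>arcs \<Gamma>. blinfun_apply (\<alpha> e) x \<notin> \<int>}"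
    by (simp add: exp_weight_def cis_2pi_eq_1_iff)
  have "\<alpha> e \<noteq> 0" if "e \<in> arcs \<Gamma>" for e
    using degree_nonzero[OF that] by (auto simp: xi_degree_def)
  then show ?thesis
    unfolding eq by (intro closure_avoiding_hyperplanes finite_arcs countable_int) auto
qed

lemma rep_ring_torus_continuous:
  assumes "h \<in> rep_ring torus torus_topology"
  shows "continuous_on UNIV (\<lambda>x. h (torus_exp x))"
proof -
  have "continuous_on (carrier torus) h" using rep_ring_continuous[OF assms] by simp
  then show ?thesis by (rule continuous_on_compose2[OF _ continuous_on_torus_exp]) auto
qed

section \<open>The character of the graph\<close>

text \<open>Shows that the definite description denotes: the coefficient sum is a virtual character
  with the right values, and any other one agrees with it on a dense set.\<close>

lemma graph_character_split:
  assumes f: "\<And>p. p \<in> verts \<Gamma> \<Longrightarrow> f p = weight_char (a p)"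
  shows "graph_character \<Gamma> \<alpha> f \<in> rep_ring torus torus_topology"
    and "graph_character \<Gamma> \<alpha> f (torus_exp x) =
      fps_nth (graph_fps x) shift + (\<Sum>j\<in>{..2 * shift} - {shift}. fps_nth (graph_fps x) j)"
proof -
  let ?P = "\<lambda>h. h \<in> rep_ring torus torus_topology \<and>
     (\<forall>g\<in>carrier torus. (\<forall>e\<in>arcs \<Gamma>. weight_char (\<alpha> e) g \<noteq> 1) \<longrightarrow>
        h g = (\<Sum>p\<in>verts \<Gamma>. f p g * (\<Prod>e\<in>out_arcs \<Gamma> p. inverse (1 - weight_char (\<alpha> e) g))))"
  have vals: "(\<Sum>p\<in>verts \<Gamma>. f p (torus_exp x) *
      (\<Prod>e\<in>out_arcs \<Gamma> p. inverse (1 - weight_char (\<alpha> e) (torus_exp x)))) = graph_value x" for x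
    unfolding graph_value_def
    by (intro sum.cong prod.cong refl arg_cong2[where f = "(*)"])
       (auto simp: f weight_char_torus_exp weight_vertex weight_edge)
  have P_iff: "?P h \<longleftrightarrow> h \<in> rep_ring torus torus_topology \<and>
      (\<forall>x. (\<forall>e\<in>arcs \<Gamma>. exp_weight (\<alpha> e) x \<noteq> 1) \<longrightarrow> h (torus_exp x) = graph_value x)" for h
    unfolding carrier_torus_eq ball_simps ball_UNIV vals
    by (simp add: weight_char_torus_exp weight_edge)
  have "(\<lambda>x. \<Sum>j\<le>2 * shift. fps_nth (graph_fps x) j) \<in> weight_span weight_lattice"
    by (intro weight_span_sum weight_span_mono[OF graph_fps_weight_span]) auto
  then obtain h where h: "h \<in> rep_ring torus torus_topology"
    "\<And>x. h (torus_exp x) = (\<Sum>j\<le>2 * shift. fps_nth (graph_fps x) j)"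
    using rep_ring_of_weight_span by blast
  have "graph_character \<Gamma> \<alpha> f = h"
    unfolding graph_character_def
  proof (rule the_equality)
    show "?P h" unfolding P_iff using h sum_graph_fps by simp
    fix h' assume "?P h'"
    then have h': "h' \<in> rep_ring torus torus_topology"
      "\<And>x. \<forall>e\<in>arcs \<Gamma>. exp_weight (\<alpha> e) x \<noteq> 1 \<Longrightarrow> h' (torus_exp x) = graph_value x"
      unfolding P_iff by blast+
    have "h' (torus_exp x) = h (torus_exp x)" for x
      by (rule eq_on_open_from_dense[where f = "\<lambda>x. h' (torus_exp x)" and g = "\<lambda>x. h (torus_exp x)",
            OF open_UNIV closure_nonvanishing rep_ring_torus_continuous[OF h'(1)]
            rep_ring_torus_continuous[OF h(1)]])
         (use h'(2) h(2) sum_graph_fps in auto)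
    then show "h' = h"
      using rep_ring_extensional[OF h(1)] rep_ring_extensional[OF h'(1)]
      by (intro extensionalityI) (auto simp: carrier_torus_eq)
  qed
  with h show "graph_character \<Gamma> \<alpha> f \<in> rep_ring torus torus_topology"
    and "graph_character \<Gamma> \<alpha> f (torus_exp x) =
      fps_nth (graph_fps x) shift + (\<Sum>j\<in>{..2 * shift} - {shift}. fps_nth (graph_fps x) j)"
    by (simp_all add: sum.remove)
qed

section \<open>The push-forward as a sum over roots\<close>

text \<open>Along an edge the vertex degree grows by m k with m > 0, and a crossing edge goes from
  negative to positive degree. So 1/k needs no absolute value when compared with the normalisation
  of the push-forward.\<close>

lemma crossing_degree_pos:
  assumes "e \<in> crossing"
  shows "e \<in> arcs \<Gamma>" "xi_degree (\<alpha> e) > 0"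
proof -
  show e: "e \<in> arcs \<Gamma>" using assms by (simp add: crossing_def)
  obtain m :: int where m: "m > 0" "a (head \<Gamma> e) - a (tail \<Gamma> e) = of_int m *\<^sub>R \<alpha> e"
    using positive[OF e] by blast
  have "a (head \<Gamma> e) = a (tail \<Gamma> e) + of_int m *\<^sub>R \<alpha> e" using m(2) by (simp add: algebra_simps)
  then have "xi_degree (a (head \<Gamma> e)) = xi_degree (a (tail \<Gamma> e)) + m * xi_degree (\<alpha> e)"
    using e by (simp add: xi_degree_add weight_vertex tail_in_verts weight_edge
        weight_lattice_of_int_scaleR xi_degree_of_int_scaleR)
  then have "m * xi_degree (\<alpha> e) > 0" using assms by (simp add: crossing_def)
  then show "xi_degree (\<alpha> e) > 0" using m(1) by (simp add: zero_less_mult_iff)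
qed

lemma exp_weight_eq_1_iff: "exp_weight \<beta> x = 1 \<longleftrightarrow> blinfun_apply \<beta> x \<in> \<int>"
  by (simp add: exp_weight_def cis_2pi_eq_1_iff)

text \<open>One root gives all: multiplying it by the k-th roots of unity yields k distinct roots,
  and there are only k.\<close>

lemma sum_roots:
  assumes e: "e \<in> arcs \<Gamma>" and k: "xi_degree (\<alpha> e) = int k" and t: "exp_weight (\<alpha> e) (x + t *\<^sub>R \<xi>) = 1"
  shows "(\<Sum>z\<in>roots e x. \<psi> z) = (\<Sum>i<k. \<psi> (cis (2 * pi * (t + of_nat i / of_nat k))))"
proof -
  have k0: "k > 0" using degree_nonzero[OF e] k by simp
  define r where "r i = cis (2 * pi * (t + of_nat i / of_nat k))" for i
  have "r i \<in> roots e x" for i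
  proof -
    have "x + (t + of_nat i / of_nat k) *\<^sub>R \<xi> = (x + t *\<^sub>R \<xi>) + (of_nat i / of_nat k) *\<^sub>R \<xi>"
      by (simp add: scaleR_left_distrib)
    then have "exp_weight (\<alpha> e) (x + (t + of_nat i / of_nat k) *\<^sub>R \<xi>) =
        exp_weight (\<alpha> e) ((of_nat i / of_nat k) *\<^sub>R \<xi>)"
      using t by (simp only: exp_weight_add_right) simp
    also have "\<dots> = 1"
      using of_int_xi_degree[OF weight_edge[OF e]] k0
      by (simp add: exp_weight_eq_1_iff blinfun.scaleR_right k flip: of_int_xi_degree)
    finally show ?thesis
      unfolding roots_def r_def using twist_cis[OF weight_edge[OF e]] by simp
  qed
  then have sub: "r ` {..<k} \<subseteq> roots e x" by blast
  have inj: "inj_on r {..<k}"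
  proof (rule inj_onI)
    fix i j assume ij: "i \<in> {..<k}" "j \<in> {..<k}" "r i = r j"
    have "cis (2 * pi * ((real i - real j) / real k)) = r i / r j"
      by (simp add: r_def cis_divide field_simps diff_divide_distrib)
    also have "\<dots> = 1" using ij(3) by (simp add: r_def)
    finally obtain n :: int where "(real i - real j) / real k = of_int n"
      unfolding cis_2pi_eq_1_iff by (auto elim: Ints_cases)
    then have "real_of_int (int i - int j) = real_of_int (n * int k)"
      using k0 by (simp add: field_simps)
    then have n: "int i - int j = n * int k" by (simp only: of_int_eq_iff)
    have "\<bar>n * int k\<bar> < int k" using ij by (auto simp: n[symmetric])
    then have "n = 0" using k0 by (simp add: abs_mult)
    then show "i = j" using n by simp
  qed
  have "card (r ` {..<k}) = card (roots e x)"
    using card_image[OF inj] roots_finite_card(1)[OF e] k by simp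
  then have "r ` {..<k} = roots e x"
    using sub roots_finite_card(2)[OF e] by (intro card_subset_eq) auto
  then show ?thesis using sum.reindex[OF inj, of \<psi>] by (simp add: r_def o_def)
qed

lemma weight_kernel_iff:
  "\<beta> \<in> weight_lattice \<Longrightarrow> torus_exp y \<in> weight_kernel \<beta> \<longleftrightarrow> exp_weight \<beta> y = 1"
  by (simp add: weight_kernel_def kernel_def weight_char_torus_exp)

text \<open>On exp(s \<xi>) the character of \<open>e\<close> has the value e^(2 pi i k s), so the
  intersection is the cyclic group of the points with s = i/k.\<close>

lemma sum_weight_kernel_Int_T:
  assumes e: "e \<in> arcs \<Gamma>" and k: "xi_degree (\<alpha> e) = int k"
  shows "(\<Sum>w\<in>weight_kernel (\<alpha> e) \<inter> T. \<psi> w) = (\<Sum>i<k. \<psi> (torus_exp ((of_nat i / of_nat k) *\<^sub>R \<xi>)))"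
    and "card (weight_kernel (\<alpha> e) \<inter> T) = k"
proof -
  have k0: "k > 0" using degree_nonzero[OF e] k by simp
  define r where "r i = torus_exp ((of_nat i / of_nat k :: real) *\<^sub>R \<xi>)" for i
  have exp_eq: "torus_exp (s *\<^sub>R \<xi>) = torus_exp (t *\<^sub>R \<xi>) \<longleftrightarrow> s - t \<in> \<int>" for s t :: real
    using torus_exp_xi[of "s - t"] by (simp add: torus_exp_eq_iff group_lattice_def scaleR_left_diff_distrib)
  have wk: "torus_exp (s *\<^sub>R \<xi>) \<in> weight_kernel (\<alpha> e) \<longleftrightarrow> s * of_nat k \<in> \<int>" for s
    using of_int_xi_degree[OF weight_edge[OF e]] k
    by (simp add: weight_kernel_iff weight_edge e exp_weight_eq_1_iff blinfun.scaleR_right)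
  have inj: "inj_on r {..<k}"
  proof (rule inj_onI)
    fix i j assume ij: "i \<in> {..<k}" "j \<in> {..<k}" "r i = r j"
    then obtain n :: int where "real i / real k - real j / real k = of_int n"
      unfolding r_def exp_eq by (auto elim: Ints_cases)
    then have "real_of_int (int i - int j) = real_of_int (n * int k)"
      using k0 by (simp add: field_simps)
    then have n: "int i - int j = n * int k" by (simp only: of_int_eq_iff)
    have "\<bar>n * int k\<bar> < int k" using ij by (auto simp: n[symmetric])
    then have "n = 0" using k0 by (simp add: abs_mult)
    then show "i = j" using n by simp
  qed
  have image: "r ` {..<k} = weight_kernel (\<alpha> e) \<inter> T"
  proof
    show "r ` {..<k} \<subseteq> weight_kernel (\<alpha> e) \<inter> T"
      using k0 by (auto simp: r_def wk T_eq)
    show "weight_kernel (\<alpha> e) \<inter> T \<subseteq> r ` {..<k}"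
    proof
      fix w assume w: "w \<in> weight_kernel (\<alpha> e) \<inter> T"
      then obtain s where s: "w = torus_exp (s *\<^sub>R \<xi>)" by (auto simp: T_eq)
      with w obtain n :: int where n: "s * of_nat k = of_int n" by (auto simp: wk elim: Ints_cases)
      \<comment> \<open>Here s = n/k, and subtracting the integer n div k from s does not move the
        point of T.\<close>
      define i where "i = nat (n mod int k)"
      have i: "int i = n - int k * (n div int k)" "i < k"
        using k0 by (simp_all add: i_def minus_mult_div_eq_mod nat_less_iff)
      have "real i = real_of_int (int i)" by simp
      also have "\<dots> = s * of_nat k - real k * of_int (n div int k)"
        by (simp add: i(1) n)
      finally have "s - real i / real k = of_int (n div int k)"
        using k0 by (simp add: field_simps)
      then have "w = r i" by (simp add: s r_def exp_eq)
      then show "w \<in> r ` {..<k}" using i(2) by blast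
    qed
  qed
  show "(\<Sum>w\<in>weight_kernel (\<alpha> e) \<inter> T. \<psi> w) = (\<Sum>i<k. \<psi> (torus_exp ((of_nat i / of_nat k) *\<^sub>R \<xi>)))"
    unfolding image[symmetric] sum.reindex[OF inj] by (simp add: r_def)
  show "card (weight_kernel (\<alpha> e) \<inter> T) = k"
    unfolding image[symmetric] card_image[OF inj] by simp
qed

lemma edge_term_torus_exp:
  assumes f: "\<And>p. p \<in> verts \<Gamma> \<Longrightarrow> f p = weight_char (a p)" and e: "e \<in> arcs \<Gamma>"
  shows "edge_term \<Gamma> \<alpha> f e (torus_exp y) = local_term e y"
  unfolding edge_term_def local_term_def using e
  by (intro prod.cong refl arg_cong2[where f = "(*)"])
     (auto simp: f weight_char_torus_exp weight_vertex weight_edge tail_in_verts)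

text \<open>The parameter s solves \<alpha>(x) + s k = 0. In particular the kernel meets every coset
  of T, so it maps onto the quotient.\<close>

lemma exp_weight_shift_root:
  assumes e: "e \<in> arcs \<Gamma>" and k: "xi_degree (\<alpha> e) = int k"
  shows "exp_weight (\<alpha> e) (x + (- blinfun_apply (\<alpha> e) x / of_nat k) *\<^sub>R \<xi>) = 1"
  using degree_nonzero[OF e] of_int_xi_degree[OF weight_edge[OF e]] k
  by (simp add: exp_weight_eq_1_iff blinfun.add_right blinfun.scaleR_right del: scaleR_minus_left)

text \<open>The translates of the chosen g by the finite group run through all points of the coset
  in the kernel, that is, through the roots; hence the choice drops out.\<close>

lemma push_forward_coset:
  assumes f: "\<And>p. p \<in> verts \<Gamma> \<Longrightarrow> f p = weight_char (a p)"
    and e: "e \<in> arcs \<Gamma>" and k: "xi_degree (\<alpha> e) = int k"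
  shows "push_forward T (weight_kernel (\<alpha> e)) (edge_term \<Gamma> \<alpha> f e) (T #>\<^bsub>torus\<^esub> torus_exp x) =
    (\<Sum>z\<in>roots e x. local_twist e x z / of_nat k)"
proof -
  define C where "C = T #>\<^bsub>torus\<^esub> torus_exp x"
  define g where "g = (SOME g. g \<in> weight_kernel (\<alpha> e) \<inter> C)"
  have "torus_exp (x + (- blinfun_apply (\<alpha> e) x / of_nat k) *\<^sub>R \<xi>) \<in> weight_kernel (\<alpha> e) \<inter> C"
    unfolding C_def coset_eq Int_iff weight_kernel_iff[OF weight_edge[OF e]]
    using exp_weight_shift_root[OF e k] by blast
  then have "g \<in> weight_kernel (\<alpha> e) \<inter> C" unfolding g_def by (rule someI)
  then obtain t where g: "g = torus_exp (x + t *\<^sub>R \<xi>)" and t: "exp_weight (\<alpha> e) (x + t *\<^sub>R \<xi>) = 1"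
    unfolding C_def coset_eq using weight_kernel_iff[OF weight_edge[OF e]] by blast
  have "push_forward T (weight_kernel (\<alpha> e)) (edge_term \<Gamma> \<alpha> f e) C =
     inverse (of_nat k) * (\<Sum>w\<in>weight_kernel (\<alpha> e) \<inter> T. edge_term \<Gamma> \<alpha> f e (g \<otimes>\<^bsub>torus\<^esub> w))"
    by (simp only: push_forward_def Let_def g_def[symmetric] sum_weight_kernel_Int_T(2)[OF e k])
  also have "(\<Sum>w\<in>weight_kernel (\<alpha> e) \<inter> T. edge_term \<Gamma> \<alpha> f e (g \<otimes>\<^bsub>torus\<^esub> w)) =
     (\<Sum>i<k. local_term e (x + (t + of_nat i / of_nat k) *\<^sub>R \<xi>))"
    unfolding sum_weight_kernel_Int_T(1)[OF e k]
    by (simp add: g edge_term_torus_exp[OF f e] scaleR_left_distrib add.assoc flip: torus_exp_add)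
  also have "\<dots> = (\<Sum>z\<in>roots e x. local_twist e x z)"
    unfolding sum_roots[OF e k t] local_twist_cis[OF e] ..
  finally show ?thesis by (simp add: C_def sum_distrib_left divide_inverse mult.commute)
qed

section \<open>Continuity of the reduced sum\<close>

text \<open>Enumerates the points of the coset in the kernel by formulas continuous in x, starting
  from the solution in \<open>exp_weight_shift_root\<close>.\<close>

definition root_point :: "'e \<Rightarrow> nat \<Rightarrow> real ^ 'n \<Rightarrow> real ^ 'n" where
  "root_point e i x = x +
     (- blinfun_apply (\<alpha> e) x / of_int (xi_degree (\<alpha> e)) + of_nat i / of_int (xi_degree (\<alpha> e))) *\<^sub>R \<xi>"

lemma continuous_on_root_point [continuous_intros]: "continuous_on S (root_point e i)"
  unfolding root_point_def by (cases "xi_degree (\<alpha> e) = 0") (auto intro!: continuous_intros)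

lemma roots_eq_root_points:
  assumes e: "e \<in> arcs \<Gamma>" and k: "xi_degree (\<alpha> e) = int k"
  shows "(\<Sum>z\<in>roots e x. local_twist e x z / of_nat k) = (\<Sum>i<k. local_term e (root_point e i x) / of_nat k)"
  unfolding sum_roots[OF e k exp_weight_shift_root[OF e k]] local_twist_cis[OF e]
  by (simp add: root_point_def k)

lemma root_point_in_kernel:
  assumes e: "e \<in> arcs \<Gamma>"
  shows "torus_exp (root_point e i x) \<in> weight_kernel (\<alpha> e) \<inter> (T #>\<^bsub>torus\<^esub> torus_exp x)"
proof -
  have "exp_weight (\<alpha> e) (root_point e i x) = 1"
    using of_int_xi_degree[OF weight_edge[OF e], symmetric] degree_nonzero[OF e]
    by (simp add: exp_weight_eq_1_iff root_point_def blinfun.add_right blinfun.scaleR_right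
        left_diff_distrib)
  then show ?thesis
    unfolding coset_eq by (auto simp: weight_kernel_iff weight_edge e root_point_def)
qed

definition reduced_value :: "real ^ 'n \<Rightarrow> complex" where
  "reduced_value x = (\<Sum>e\<in>crossing. \<Sum>z\<in>roots e x. local_twist e x z / of_int (xi_degree (\<alpha> e)))"

text \<open>Replaces the root sets, which depend on x, by fixed index ranges, so that continuity can
  be read off termwise.\<close>

lemma reduced_value_eq:
  "reduced_value x = (\<Sum>e\<in>crossing. \<Sum>i<nat (xi_degree (\<alpha> e)).
     local_term e (root_point e i x) / of_int (xi_degree (\<alpha> e)))"
  unfolding reduced_value_def
proof (rule sum.cong[OF refl])
  fix e assume "e \<in> crossing"
  from crossing_degree_pos[OF this] have e: "e \<in> arcs \<Gamma>" and k: "xi_degree (\<alpha> e) = int (nat (xi_degree (\<alpha> e)))"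
    by simp_all
  have "(of_nat (nat (xi_degree (\<alpha> e))) :: complex) = of_int (xi_degree (\<alpha> e))"
    by (subst (2) k) simp
  with roots_eq_root_points[OF e k, of x]
  show "(\<Sum>z\<in>roots e x. local_twist e x z / of_int (xi_degree (\<alpha> e))) =
     (\<Sum>i<nat (xi_degree (\<alpha> e)). local_term e (root_point e i x) / of_int (xi_degree (\<alpha> e)))"
    by simp
qed

text \<open>Extends the identity from generic x to every coset on which
  \<open>reduced_character\<close> prescribes a value. U is the open set where no denominator
  vanishes at any of the finitely many root points.\<close>

lemma graph_fps_nth_shift_nonvanishing:
  assumes x: "\<And>e g e'. \<lbrakk>e \<in> crossing; g \<in> weight_kernel (\<alpha> e) \<inter> (T #>\<^bsub>torus\<^esub> torus_exp x);
      e' \<in> out_arcs \<Gamma> (tail \<Gamma> e) - {e}\<rbrakk> \<Longrightarrow> weight_char (\<alpha> e') g \<noteq> 1"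
  shows "fps_nth (graph_fps x) shift = reduced_value x"
proof -
  define I where "I = (SIGMA e:crossing. {..<nat (xi_degree (\<alpha> e))} \<times> (out_arcs \<Gamma> (tail \<Gamma> e) - {e}))"
  define U where "U = {x. \<forall>(e, i, e')\<in>I. exp_weight (\<alpha> e') (root_point e i x) \<noteq> 1}"
  have fin: "finite crossing" using finite_arcs by (simp add: crossing_def)
  then have "finite I" using finite_out_arcs by (simp add: I_def)
  then have "open {x. \<forall>j\<in>I. exp_weight (\<alpha> (snd (snd j))) (root_point (fst j) (fst (snd j)) x) \<noteq> 1}"
    by (intro open_Collect_ball_neq continuous_intros)
  then have "open U" by (simp add: U_def case_prod_beta)
  have U: "exp_weight (\<alpha> e') (root_point e i y) \<noteq> 1"
    if "y \<in> U" "e \<in> crossing" "i < nat (xi_degree (\<alpha> e))" "e' \<in> out_arcs \<Gamma> (tail \<Gamma> e) - {e}" for y e i e'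
  proof -
    have "(e, i, e') \<in> I" using that by (simp add: I_def)
    then show ?thesis using that(1) unfolding U_def by blast
  qed
  have "exp_weight (\<alpha> e') (root_point e i x) \<noteq> 1" if "(e, i, e') \<in> I" for e i e'
  proof -
    have *: "e \<in> crossing" "e' \<in> out_arcs \<Gamma> (tail \<Gamma> e) - {e}" using that by (auto simp: I_def)
    from x[OF *(1) root_point_in_kernel[OF crossing_degree_pos(1)[OF *(1)]] *(2)]
    show ?thesis using *(2) by (simp add: weight_char_torus_exp weight_edge)
  qed
  then have "x \<in> U" unfolding U_def by blast
  show ?thesis
  proof (rule eq_on_open_from_dense[OF \<open>open U\<close> closure_generic _ _ _ \<open>x \<in> U\<close>])
    show "continuous_on U (\<lambda>x. fps_nth (graph_fps x) shift)"
      by (rule continuous_on_weight_span[OF graph_fps_weight_span])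
    show "continuous_on U reduced_value"
      unfolding reduced_value_eq local_term_def divide_inverse
      using U by (intro continuous_on_sum continuous_on_mult continuous_on_prod_inverse continuous_intros) auto
    show "fps_nth (graph_fps y) shift = reduced_value y" if "y \<in> {x. generic x}" for y
      using that graph_fps_nth_shift by (simp add: reduced_value_def)
  qed
qed

section \<open>Comparison of the two characters\<close>

text \<open>Generic cosets are among those where values are prescribed and they are dense, so a
  competing virtual character agrees with h by continuity.\<close>

lemma reduced_character_eqI:
  assumes f: "\<And>p. p \<in> verts \<Gamma> \<Longrightarrow> f p = weight_char (a p)"
    and \<phi>: "crossing_edges \<Gamma> \<phi> 0 = crossing"
    and h: "h \<in> rep_ring (torus Mod T) (quotient_topology T)"
    and hx: "\<And>x. h (T #>\<^bsub>torus\<^esub> torus_exp x) = fps_nth (graph_fps x) shift"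
  shows "reduced_character \<Gamma> \<alpha> T \<phi> 0 f = h"
proof -
  let ?N = "\<lambda>C. \<forall>e\<in>crossing_edges \<Gamma> \<phi> 0. \<forall>g\<in>weight_kernel (\<alpha> e) \<inter> C.
     \<forall>e'\<in>out_arcs \<Gamma> (tail \<Gamma> e) - {e}. weight_char (\<alpha> e') g \<noteq> 1"
  let ?S = "\<lambda>C. \<Sum>e\<in>crossing_edges \<Gamma> \<phi> 0.
     push_forward T (weight_kernel (\<alpha> e)) (edge_term \<Gamma> \<alpha> f e) C"
  let ?P = "\<lambda>h. h \<in> rep_ring (torus Mod T) (quotient_topology T) \<and>
     (\<forall>C\<in>carrier (torus Mod T). ?N C \<longrightarrow> h C = ?S C)"
  have S: "?S (T #>\<^bsub>torus\<^esub> torus_exp x) = reduced_value x" for x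
    unfolding reduced_value_def \<phi>
  proof (rule sum.cong[OF refl])
    fix e assume "e \<in> crossing"
    from crossing_degree_pos[OF this] have e: "e \<in> arcs \<Gamma>" and k: "xi_degree (\<alpha> e) = int (nat (xi_degree (\<alpha> e)))"
      by simp_all
    have "(of_nat (nat (xi_degree (\<alpha> e))) :: complex) = of_int (xi_degree (\<alpha> e))"
      by (subst (2) k) simp
    with push_forward_coset[OF f e k, of x]
    show "push_forward T (weight_kernel (\<alpha> e)) (edge_term \<Gamma> \<alpha> f e) (T #>\<^bsub>torus\<^esub> torus_exp x) =
       (\<Sum>z\<in>roots e x. local_twist e x z / of_int (xi_degree (\<alpha> e)))"
      by simp
  qed
  have N_generic: "?N (T #>\<^bsub>torus\<^esub> torus_exp x)" if gen: "generic x" for x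
  proof (intro ballI)
    fix e g e' assume e: "e \<in> crossing_edges \<Gamma> \<phi> 0" and g: "g \<in> weight_kernel (\<alpha> e) \<inter> (T #>\<^bsub>torus\<^esub> torus_exp x)"
      and e': "e' \<in> out_arcs \<Gamma> (tail \<Gamma> e) - {e}"
    have arcs: "e \<in> arcs \<Gamma>" "e' \<in> arcs \<Gamma>" "tail \<Gamma> e = tail \<Gamma> e'" "e \<noteq> e'"
      using e e' by (auto simp: \<phi> crossing_def)
    obtain s where s: "g = torus_exp (x + s *\<^sub>R \<xi>)" using g unfolding coset_eq by blast
    then have "exp_weight (\<alpha> e) (x + s *\<^sub>R \<xi>) = 1"
      using g arcs by (simp add: weight_kernel_iff weight_edge)
    then have "cis (2 * pi * s) \<in> roots e x"
      using arcs by (simp add: roots_def twist_cis weight_edge)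
    from genericD[OF gen arcs(1,2,4,3) this] show "weight_char (\<alpha> e') g \<noteq> 1"
      using arcs by (simp add: s twist_cis weight_char_torus_exp weight_edge)
  qed
  have vals: "fps_nth (graph_fps x) shift = reduced_value x" if "?N (T #>\<^bsub>torus\<^esub> torus_exp x)" for x
    using that unfolding \<phi> by (intro graph_fps_nth_shift_nonvanishing) blast
  show ?thesis
    unfolding reduced_character_def
  proof (rule the_equality)
    have "h C = ?S C" if C: "C \<in> carrier (torus Mod T)" and N: "?N C" for C
    proof -
      obtain x where x: "C = T #>\<^bsub>torus\<^esub> torus_exp x" using C unfolding carrier_torus_Mod by blast
      show ?thesis unfolding x hx S by (rule vals) (use N in \<open>simp only: x\<close>)
    qed
    then show "?P h" using h by blast
  next
    fix h' assume h': "?P h'"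
    have "h' (T #>\<^bsub>torus\<^esub> torus_exp x) = h (T #>\<^bsub>torus\<^esub> torus_exp x)" for x
    proof (rule eq_on_open_from_dense[where f = "\<lambda>x. h' (T #>\<^bsub>torus\<^esub> torus_exp x)"
          and g = "\<lambda>x. h (T #>\<^bsub>torus\<^esub> torus_exp x)", OF open_UNIV closure_generic])
      show "continuous_on UNIV (\<lambda>x. h' (T #>\<^bsub>torus\<^esub> torus_exp x))"
        using h' by (intro rep_ring_quotient_continuous) blast
      show "continuous_on UNIV (\<lambda>x. h (T #>\<^bsub>torus\<^esub> torus_exp x))"
        using h by (rule rep_ring_quotient_continuous)
      fix x assume "x \<in> {x. generic x}"
      then have N: "?N (T #>\<^bsub>torus\<^esub> torus_exp x)" by (intro N_generic) simp
      then have "h' (T #>\<^bsub>torus\<^esub> torus_exp x) = ?S (T #>\<^bsub>torus\<^esub> torus_exp x)"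
        using h' coset_in_carrier by blast
      then show "h' (T #>\<^bsub>torus\<^esub> torus_exp x) = h (T #>\<^bsub>torus\<^esub> torus_exp x)"
        using S vals[OF N] hx by simp
    qed auto
    then show "h' = h"
      using h h' by (intro extensionalityI[of _ "carrier (torus Mod T)"])
        (auto simp: carrier_torus_Mod dest: rep_ring_extensional)
  qed
qed

text \<open>Coefficient \<open>shift\<close> has degree 0 and every other coefficient nonzero
  degree, so splitting off this one coefficient separates the T-invariant weights from the
  rest.\<close>

lemma reduced_character_eq_invariant_part:
  assumes f: "\<And>p. p \<in> verts \<Gamma> \<Longrightarrow> f p = weight_char (a p)"
    and \<phi>: "crossing_edges \<Gamma> \<phi> 0 = crossing"
  shows "reduced_character \<Gamma> \<alpha> T \<phi> 0 f = invariant_part T \<xi> (graph_character \<Gamma> \<alpha> f)"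
proof (rule reduced_character_eqI[OF f \<phi>])
  have deg: "blinfun_apply \<beta> \<xi> = 0 \<longleftrightarrow> xi_degree \<beta> = 0" if "\<beta> \<in> weight_lattice" for \<beta>
    using of_int_xi_degree[OF that] by (metis of_int_0_eq_iff)
  have F: "(\<lambda>x. fps_nth (graph_fps x) shift) \<in> weight_span {\<beta> \<in> weight_lattice. blinfun_apply \<beta> \<xi> = 0}"
    by (rule weight_span_mono[OF graph_fps_weight_span]) (auto simp: deg)
  have F': "(\<lambda>x. \<Sum>j\<in>{..2 * shift} - {shift}. fps_nth (graph_fps x) j) \<in>
      weight_span {\<beta> \<in> weight_lattice. blinfun_apply \<beta> \<xi> \<noteq> 0}"
    by (intro weight_span_sum weight_span_mono[OF graph_fps_weight_span]) (auto simp: deg)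
  note split = invariant_part_split[OF rep_ring_extensional[OF graph_character_split(1)[OF f]]
      graph_character_split(2)[OF f] F F']
  show "invariant_part T \<xi> (graph_character \<Gamma> \<alpha> f) \<in> rep_ring (torus Mod T) (quotient_topology T)"
    by (rule split(1))
  show "invariant_part T \<xi> (graph_character \<Gamma> \<alpha> f) (T #>\<^bsub>torus\<^esub> torus_exp x) =
      fps_nth (graph_fps x) shift" for x
    by (rule split(2))
qed

end

section \<open>Symplectic classes on GKM graphs\<close>

lemma diag_block_mat_1x1:
  assumes "\<And>A. A \<in> set As \<Longrightarrow> A \<in> carrier_mat 1 1"
  shows "diag_block_mat As \<in> carrier_mat (length As) (length As) \<and>
    upper_triangular (diag_block_mat As) \<and> diag_mat (diag_block_mat As) = map (\<lambda>A. A $$ (0, 0)) As"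
  using assms
proof (induction As)
  case Nil
  then show ?case by (auto simp: diag_mat_def)
next
  case (Cons A As)
  have A: "A \<in> carrier_mat 1 1" using Cons.prems by simp
  have IH: "diag_block_mat As \<in> carrier_mat (length As) (length As)"
    "upper_triangular (diag_block_mat As)" "diag_mat (diag_block_mat As) = map (\<lambda>A. A $$ (0, 0)) As"
    using Cons by auto
  have eq: "diag_block_mat (A # As) = four_block_mat A (0\<^sub>m 1 (length As)) (0\<^sub>m (length As) 1) (diag_block_mat As)"
    using A IH(1) by (simp add: Let_def)
  have "upper_triangular A" using A by (auto simp: upper_triangular_def)
  moreover have "diag_mat A = [A $$ (0, 0)]" using A by (simp add: diag_mat_def)
  ultimately show ?case
    unfolding eq using four_block_carrier_mat[OF A IH(1)] upper_triangular_four_block[OF A IH(1) _ IH(2)]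
      diag_four_block_mat[OF A IH(1)] IH(3)
    by simp
qed

lemma char_poly_diag_block_mat_1x1:
  assumes "\<And>A. A \<in> set As \<Longrightarrow> A \<in> carrier_mat 1 1"
  shows "char_poly (diag_block_mat As :: complex mat) = (\<Prod>A\<leftarrow>As. [:- (A $$ (0, 0)), 1:])"
proof -
  note D = diag_block_mat_1x1[OF assms]
  show ?thesis
    using char_poly_upper_triangular[of "diag_block_mat As" "length As"] D by (simp add: o_def)
qed

text \<open>An invertible intertwiner is a similarity at each point. The characteristic polynomial
  records the eigenvalues with multiplicity, which is what the denominators are built from.\<close>

lemma rep_iso_on_char_poly:
  fixes \<rho> \<sigma> :: "'g \<Rightarrow> complex mat"
  assumes iso: "rep_iso_on H k \<rho> \<sigma>" and g: "g \<in> H"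
    and dim: "\<rho> g \<in> carrier_mat k k" "\<sigma> g \<in> carrier_mat k k"
  shows "char_poly (\<rho> g) = char_poly (\<sigma> g)"
proof -
  obtain P where P: "P \<in> carrier_mat k k" "invertible_mat P" "P * \<rho> g = \<sigma> g * P"
    using iso g by (auto simp: rep_iso_on_def)
  obtain Q where Q: "P * Q = 1\<^sub>m (dim_row P)" "Q * P = 1\<^sub>m (dim_row Q)"
    using P(2) by (auto simp: invertible_mat_def inverts_mat_def)
  \<comment> \<open>\<open>invertible_mat\<close> does not state the shape of the inverse; it is
    read off from the two identity matrices.\<close>
  have dQ: "dim_col Q = k" using arg_cong[OF Q(1), of dim_col] P(1) by simp
  have dQ': "dim_row Q = k" using arg_cong[OF Q(2), of dim_col] P(1) by simp
  have Qc: "Q \<in> carrier_mat k k" using dQ dQ' by auto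
  have "\<rho> g = (Q * P) * \<rho> g" using Q(2) dQ' dim by simp
  also have "\<dots> = Q * (P * \<rho> g)" by (rule assoc_mult_mat[OF Qc P(1) dim(1)])
  also have "\<dots> = Q * \<sigma> g * P"
    unfolding P(3) using assoc_mult_mat[OF Qc dim(2) P(1)] by simp
  finally have "\<rho> g = Q * \<sigma> g * P" .
  then have "similar_mat (\<rho> g) (\<sigma> g)"
    using P(1) Q Qc dim dQ' by (intro similar_matI[of _ _ Q P k]) auto
  then show ?thesis by (rule char_poly_similar)
qed

text \<open>The factors of e and e' vanish at 1, so evaluating the full products there only gives 0
  = 0. Cancelling X - 1 as a polynomial first keeps the information.\<close>

lemma prod_one_minus_cancel:
  fixes u :: "'a \<Rightarrow> complex" and w :: "'b \<Rightarrow> complex"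
  assumes "finite E" "finite F" "e \<in> E" "e' \<in> F" "u e = 1" "w e' = 1"
    and eq: "(\<Prod>i\<in>E. [:- u i, 1:]) = (\<Prod>i\<in>F. [:- w i, 1:])"
  shows "(\<Prod>i\<in>E - {e}. 1 - u i) = (\<Prod>i\<in>F - {e'}. 1 - w i)"
proof -
  have "[:-1, 1:] * (\<Prod>i\<in>E - {e}. [:- u i, 1:]) = [:-1, 1:] * (\<Prod>i\<in>F - {e'}. [:- w i, 1:])"
    using eq assms by (simp only: prod.remove[of E e] prod.remove[of F e'])
  then have "(\<Prod>i\<in>E - {e}. [:- u i, 1:]) = (\<Prod>i\<in>F - {e'}. [:- w i, 1:])"
    by (subst (asm) mult_cancel_left) auto
  then have "poly (\<Prod>i\<in>E - {e}. [:- u i, 1:]) 1 = poly (\<Prod>i\<in>F - {e'}. [:- w i, 1:]) 1" by simp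
  then show ?thesis by (simp add: poly_prod)
qed

lemma graph_action_entry:
  assumes act: "graph_action \<Gamma> rv d \<rho> \<alpha> \<tau>" and e: "e \<in> arcs \<Gamma>"
  shows "\<alpha> e \<in> weight_lattice"
    and "\<rho> e (torus_exp x) \<in> carrier_mat 1 1"
    and "\<rho> e (torus_exp x) $$ (0, 0) = exp_weight (\<alpha> e) x"
proof -
  show W: "\<alpha> e \<in> weight_lattice" using act e by (simp add: graph_action_def)
  have "representation torus torus_topology 1 (\<rho> e)" using act e by (simp add: graph_action_def)
  then show "\<rho> e (torus_exp x) \<in> carrier_mat 1 1" unfolding representation_def by simp
  have "rep_character torus 1 (\<rho> e) (torus_exp x) = weight_char (\<alpha> e) (torus_exp x)"
    using act e by (simp add: graph_action_def)
  then show "\<rho> e (torus_exp x) $$ (0, 0) = exp_weight (\<alpha> e) x"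
    by (simp add: rep_character_def weight_char_torus_exp[OF W])
qed

text \<open>Similar 1 by 1 matrices have equal entries, and the dual takes the value at -x; the
  exponentials of the two weights thus coincide, and they determine the weights.\<close>

lemma graph_action_weight_rv:
  fixes \<alpha> :: "'e \<Rightarrow> (real ^ 'n) \<Rightarrow>\<^sub>L real"
  assumes act: "graph_action \<Gamma> rv d \<rho> \<alpha> \<tau>" and e: "e \<in> arcs \<Gamma>" "rv e \<in> arcs \<Gamma>"
  shows "\<alpha> (rv e) = - \<alpha> e"
proof -
  have "exp_weight (\<alpha> (rv e)) x = exp_weight (- \<alpha> e) x" for x
  proof -
    note R = graph_action_entry(2,3)[OF act e(2), of x]
    note S = graph_action_entry(2,3)[OF act e(1), of "- x"]
    have dual: "dual_rep torus (\<rho> e) (torus_exp x) = transpose_mat (\<rho> e (torus_exp (- x)))"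
      by (simp add: dual_rep_def torus_exp_minus)
    have D: "dual_rep torus (\<rho> e) (torus_exp x) \<in> carrier_mat 1 1"
      "dual_rep torus (\<rho> e) (torus_exp x) $$ (0, 0) = exp_weight (\<alpha> e) (- x)"
      using S by (auto simp: dual)
    have "rep_iso_on (carrier torus) 1 (\<rho> (rv e)) (dual_rep torus (\<rho> e))"
      using act e by (simp add: graph_action_def)
    from rep_iso_on_char_poly[OF this torus_exp_in_carrier R(1) D(1)]
    have "char_poly (diag_block_mat [\<rho> (rv e) (torus_exp x)]) =
        char_poly (diag_block_mat [dual_rep torus (\<rho> e) (torus_exp x)])"
      by (simp only: diag_block_mat_singleton)
    moreover have "char_poly (diag_block_mat [A]) = [:- (A $$ (0, 0)), 1:]"
      if "A \<in> carrier_mat 1 1" for A :: "complex mat"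
      by (subst char_poly_diag_block_mat_1x1) (use that in auto)
    ultimately have "[:- exp_weight (\<alpha> (rv e)) x, 1:] = [:- exp_weight (\<alpha> e) (- x), 1:]"
      by (simp only: R D)
    then have "exp_weight (\<alpha> (rv e)) x = exp_weight (\<alpha> e) (- x)" by simp
    then show ?thesis by (simp add: exp_weight_def blinfun.minus_left blinfun.minus_right)
  qed
  then show ?thesis using exp_weight_eq_iff by blast
qed

lemma graph_action_char_poly:
  assumes act: "graph_action \<Gamma> rv d \<rho> \<alpha> \<tau>" and p: "p \<in> verts \<Gamma>" and d: "out_degree \<Gamma> p = d"
  shows "\<tau> p (torus_exp x) \<in> carrier_mat d d"
    and "char_poly (\<tau> p (torus_exp x)) = (\<Prod>e\<in>out_arcs \<Gamma> p. [:- exp_weight (\<alpha> e) x, 1:])"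
proof -
  have "representation torus torus_topology d (\<tau> p)" using act p by (simp add: graph_action_def)
  then show tau: "\<tau> p (torus_exp x) \<in> carrier_mat d d" unfolding representation_def by simp
  obtain es where es: "distinct es" "set es = out_arcs \<Gamma> p"
    "rep_iso_on (carrier torus) d (\<tau> p) (direct_sum_rep (map \<rho> es))"
    using act p unfolding graph_action_def by blast
  have len: "length es = d"
    using d es(1,2) by (metis distinct_card out_degree_def)
  define As where "As = map (\<lambda>e. \<rho> e (torus_exp x)) es"
  have length_As: "length As = d" by (simp add: As_def len)
  have arcs: "e \<in> arcs \<Gamma>" if "e \<in> set es" for e using that es(2) by auto
  have As: "A \<in> carrier_mat 1 1" if "A \<in> set As" for A
    using that graph_action_entry(2)[OF act arcs] by (auto simp: As_def)
  have sum: "direct_sum_rep (map \<rho> es) (torus_exp x) = diag_block_mat As"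
    by (simp add: direct_sum_rep_def As_def o_def)
  have "direct_sum_rep (map \<rho> es) (torus_exp x) \<in> carrier_mat d d"
    unfolding sum using diag_block_mat_1x1[of As] As length_As by simp
  from rep_iso_on_char_poly[OF es(3) torus_exp_in_carrier tau this]
  have "char_poly (\<tau> p (torus_exp x)) = (\<Prod>A\<leftarrow>As. [:- (A $$ (0, 0)), 1:])"
    unfolding sum by (simp only: char_poly_diag_block_mat_1x1[of As, OF As])
  also have "\<dots> = (\<Prod>e\<leftarrow>es. [:- exp_weight (\<alpha> e) x, 1:])"
    using graph_action_entry(3)[OF act arcs]
    by (auto simp: As_def o_def intro!: arg_cong[where f = prod_list])
  also have "\<dots> = (\<Prod>e\<in>out_arcs \<Gamma> p. [:- exp_weight (\<alpha> e) x, 1:])"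
    unfolding es(2)[symmetric] by (rule prod.distinct_set_conv_list[OF es(1), symmetric])
  finally show "char_poly (\<tau> p (torus_exp x)) = (\<Prod>e\<in>out_arcs \<Gamma> p. [:- exp_weight (\<alpha> e) x, 1:])" .
qed

theorem theorem1p8:
  fixes \<Gamma> :: "('v, 'e) pre_digraph"
    and rv :: "'e \<Rightarrow> 'e"
    and d :: nat
    and \<rho> :: "'e \<Rightarrow> complex ^ 'n \<Rightarrow> complex mat"
    and \<alpha> :: "'e \<Rightarrow> (real ^ 'n) \<Rightarrow>\<^sub>L real"
    and \<tau> :: "'v \<Rightarrow> complex ^ 'n \<Rightarrow> complex mat"
    and T :: "(complex ^ 'n) set"
    and \<xi> :: "real ^ 'n"
    and f :: "'v \<Rightarrow> complex ^ 'n \<Rightarrow> complex"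
    and a :: "'v \<Rightarrow> (real ^ 'n) \<Rightarrow>\<^sub>L real"
    and \<phi> :: "'v \<Rightarrow> real"
  assumes "valent_graph \<Gamma> rv d"
    and "gkm_action \<Gamma> rv d \<rho> \<alpha> \<tau>"
    and "circle_subgroup T"
    and "\<forall>e\<in>arcs \<Gamma>. \<not> T \<subseteq> weight_kernel (\<alpha> e)"
    and "infinitesimal_generator T \<xi>"
    and "symplectic \<Gamma> \<alpha> f a"
    and "\<forall>p\<in>verts \<Gamma>. \<phi> p = blinfun_apply (a p) \<xi>"
    and "\<forall>p\<in>verts \<Gamma>. \<phi> p \<noteq> 0"
  shows "reduced_character \<Gamma> \<alpha> T \<phi> 0 f = invariant_part T \<xi> (graph_character \<Gamma> \<alpha> f)"
proof -
  have fin: "fin_digraph \<Gamma>" and bidir: "bidirected_digraph \<Gamma> rv"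
    and valent: "\<And>p. p \<in> verts \<Gamma> \<Longrightarrow> out_degree \<Gamma> p = d"
    using assms(1) by (auto simp: valent_graph_def)
  interpret G: fin_digraph \<Gamma> by (rule fin)
  interpret B: bidirected_digraph \<Gamma> rv by (rule bidir)
  interpret C: torus_circle T \<xi> using assms(3,5) by (rule torus_circleI)
  have act: "graph_action \<Gamma> rv d \<rho> \<alpha> \<tau>" using assms(2) by (simp add: gkm_action_def)
  have rv: "rv e \<in> arcs \<Gamma>" if "e \<in> arcs \<Gamma>" for e
    using that B.arev_dom B.arev_arev by metis
  note weight = graph_action_entry(1)[OF act]
  have weight_rv: "\<alpha> (rv e) = - \<alpha> e" if "e \<in> arcs \<Gamma>" for e
    using graph_action_weight_rv[OF act that rv[OF that]] .
  have deg: "C.xi_degree (\<alpha> e) \<noteq> 0" if e: "e \<in> arcs \<Gamma>" for e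
  proof
    assume "C.xi_degree (\<alpha> e) = 0"
    then have "blinfun_apply (\<alpha> e) \<xi> = 0" using C.of_int_xi_degree[OF weight[OF e]] by simp
    then have "exp_weight (\<alpha> e) (s *\<^sub>R \<xi>) = 1" for s
      by (simp add: exp_weight_def blinfun.scaleR_right)
    then have "T \<subseteq> weight_kernel (\<alpha> e)"
      using weight[OF e] by (auto simp: C.T_eq weight_kernel_def kernel_def weight_char_torus_exp)
    with assms(4) e show False by blast
  qed
  have K: "f \<in> K_graph \<Gamma> \<alpha>" and f: "\<And>p. p \<in> verts \<Gamma> \<Longrightarrow> f p = weight_char (a p)"
    and aW: "\<And>p. p \<in> verts \<Gamma> \<Longrightarrow> a p \<in> weight_lattice"
    using assms(6) by (auto simp: symplectic_def)
  have kernel: "torus_exp x \<in> weight_kernel (\<alpha> e)" if "e \<in> arcs \<Gamma>" "exp_weight (\<alpha> e) x = 1" for e x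
    using that weight by (simp add: weight_kernel_def kernel_def weight_char_torus_exp)
  have \<phi>: "\<phi> p = of_int (C.xi_degree (a p))" if "p \<in> verts \<Gamma>" for p
    using assms(7) that C.of_int_xi_degree[OF aW[OF that]] by simp
  interpret S: symplectic_gkm T \<xi> \<Gamma> rv \<alpha> a
  proof
    show "rv (rv e) = e" for e by simp
    show "tail \<Gamma> (rv e) = head \<Gamma> e" if "e \<in> arcs \<Gamma>" for e using that by simp
    fix e e' assume e: "e \<in> arcs \<Gamma>" "e' \<in> arcs \<Gamma>" "e \<noteq> e'" "tail \<Gamma> e = tail \<Gamma> e'"
    then have "\<alpha> e \<noteq> \<alpha> e'" "independent {\<alpha> e, \<alpha> e'}"
      using assms(2) unfolding gkm_action_def by blast+
    then have "\<alpha> e' \<notin> span {\<alpha> e}"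
      by (metis independent_insert insert_commute singletonD)
    show "of_int (C.xi_degree (\<alpha> e)) *\<^sub>R \<alpha> e' - of_int (C.xi_degree (\<alpha> e')) *\<^sub>R \<alpha> e \<noteq> 0"
    proof
      assume "of_int (C.xi_degree (\<alpha> e)) *\<^sub>R \<alpha> e' - of_int (C.xi_degree (\<alpha> e')) *\<^sub>R \<alpha> e = 0"
      then have "inverse (of_int (C.xi_degree (\<alpha> e))) *\<^sub>R (of_int (C.xi_degree (\<alpha> e)) *\<^sub>R \<alpha> e') =
         inverse (of_int (C.xi_degree (\<alpha> e))) *\<^sub>R (of_int (C.xi_degree (\<alpha> e')) *\<^sub>R \<alpha> e)" by simp
      then have "\<alpha> e' = (inverse (of_int (C.xi_degree (\<alpha> e))) * of_int (C.xi_degree (\<alpha> e'))) *\<^sub>R \<alpha> e"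
        using deg[OF e(1)] by simp
      then have "\<alpha> e' \<in> span {\<alpha> e}" by (metis insertI1 span_base span_scale)
      with \<open>\<alpha> e' \<notin> span {\<alpha> e}\<close> show False by blast
    qed
  next
    fix e x assume e: "e \<in> arcs \<Gamma>" and x: "exp_weight (\<alpha> e) x = 1"
    have "restrict (f (tail \<Gamma> e)) (weight_kernel (\<alpha> e)) (torus_exp x) =
        restrict (f (head \<Gamma> e)) (weight_kernel (\<alpha> e)) (torus_exp x)"
      using K e by (simp add: K_graph_def)
    then show "exp_weight (a (tail \<Gamma> e)) x = exp_weight (a (head \<Gamma> e)) x"
      using kernel[OF e x] e by (simp add: f aW weight_char_torus_exp)
    have "rep_iso_on (weight_kernel (\<alpha> e)) d (\<tau> (tail \<Gamma> e)) (\<tau> (head \<Gamma> e))"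
      using act e by (simp add: graph_action_def)
    then have "char_poly (\<tau> (tail \<Gamma> e) (torus_exp x)) = char_poly (\<tau> (head \<Gamma> e) (torus_exp x))"
      using kernel[OF e x] graph_action_char_poly(1)[OF act _ valent] e
      by (intro rep_iso_on_char_poly[of "weight_kernel (\<alpha> e)" d]) auto
    then have "(\<Prod>e\<in>out_arcs \<Gamma> (tail \<Gamma> e). [:- exp_weight (\<alpha> e) x, 1:]) =
        (\<Prod>e\<in>out_arcs \<Gamma> (head \<Gamma> e). [:- exp_weight (\<alpha> e) x, 1:])"
      using graph_action_char_poly(2)[OF act _ valent] e by simp
    then have "(\<Prod>e'\<in>out_arcs \<Gamma> (tail \<Gamma> e) - {e}. 1 - exp_weight (\<alpha> e') x) =
        (\<Prod>e'\<in>out_arcs \<Gamma> (head \<Gamma> e) - {rv e}. 1 - exp_weight (\<alpha> e') x)"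
      \<comment> \<open>On the kernel \<open>e\<close> and \<open>rv e\<close> both have eigenvalue
        1, since their weights are opposite; these are the factors removed at the two ends.\<close>
      using e rv x by (intro prod_one_minus_cancel) (auto simp: weight_rv exp_weight_minus)
    then show "(\<Prod>e'\<in>out_arcs \<Gamma> (tail \<Gamma> e) - {e}. inverse (1 - exp_weight (\<alpha> e') x)) =
        (\<Prod>e'\<in>out_arcs \<Gamma> (head \<Gamma> e) - {rv e}. inverse (1 - exp_weight (\<alpha> e') x))"
      by (simp add: prod_inversef[unfolded o_def])
  next
    fix p assume p: "p \<in> verts \<Gamma>"
    then show "C.xi_degree (a p) \<noteq> 0" using assms(8) \<phi>[OF p] by auto
  qed (use weight aW weight_rv deg rv assms(6) in \<open>auto simp: symplectic_def\<close>)
  have "crossing_edges \<Gamma> \<phi> 0 = S.crossing"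
    by (auto simp: crossing_edges_def S.crossing_def \<phi>)
  with f show ?thesis by (rule S.reduced_character_eq_invariant_part)
qed

end
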